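(* Let $a:[0,1]\to[0,\infty)$ be continuous and suppose there is a point $x_0\in(0,1)$ such that $a(x_0)=0$, $a>0$ on $[0,1]\setminus\{x_0\}$ and $\frac1a\in L^1(0,1)$. Let $A$ be the operator on $L^2_{\frac1a}(0,1)$ defined by $$Au:=a u'''',\qquad D(A):=\left\{u\in H^2_{\frac1a}(0,1):\ a u''''\in L^2_{\frac1a}(0,1)\right\}.$$ Then $(A,D(A))$ is self-adjoint and non negative on $L^2_{\frac1a}(0,1)$. Hence $-A$ generates a contractive analytic semigroup of angle $\frac{\pi}{2}$ on $L^2_{\frac1a}(0,1)$.
   Context: Functions are real valued. $L^2_{\frac1a}(0,1):=\{u\in L^2(0,1): \int_0^1 \frac{u^2}{a}\,dx<+\infty\}$, a Hilbert space with inner product $\langle u,v\rangle_{L^2_{1/a}(0,1)}=\int_0^1\frac{uv}{a}\,dx$. $H^2_0(0,1):=\{u\in H^2(0,1): u(j)=u'(j)=0,\ j=0,1\}$ and $H^2_{\frac1a}(0,1):=L^2_{\frac1a}(0,1)\cap H^2_0(0,1)$. Derivatives are in the sense of distributions on $(0,1)$; the condition $au''''\in L^2_{\frac1a}(0,1)$ means that $u''''$ is a (locally integrable) function on $(0,1)$ and $au''''\in L^2_{\frac1a}(0,1)$. Non negative means $\langle Au,u\rangle\ge 0$ for all $u\in D(A)$. A contractive analytic semigroup of angle $\frac\pi2$ is a strongly continuous semigroup of contractions that (on the complexified space) extends to an analytic semigroup on the open right half-plane. *)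

theory Defs
  imports "HOL-Analysis.Analysis"
begin

section \<open>Measurable functions on (0,1) modulo null sets\<close>

abbreviation unit_ivl :: "real measure" where
  "unit_ivl \<equiv> lebesgue_on {0<..<1}"

definition ae_eq :: "(real \<Rightarrow> real) \<Rightarrow> (real \<Rightarrow> real) \<Rightarrow> bool" where
  "ae_eq f g \<longleftrightarrow> f \<in> borel_measurable unit_ivl \<and> g \<in> borel_measurable unit_ivl \<and>
     (AE x in unit_ivl. f x = g x)"

text \<open>\<open>cls f\<close> is the class of a measurable function \<open>f\<close> (and a junk value if \<open>f\<close> is not
  measurable); \<open>fn u\<close> is some measurable representative of the class \<open>u\<close>.\<close>

quotient_type ae_fun = "real \<Rightarrow> real" / partial: ae_eq
  morphisms fn cls
proof (rule part_equivpI)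
  show "\<exists>f. ae_eq f f" by (rule exI[of _ "\<lambda>_. 0"]) (simp add: ae_eq_def)
  show "symp ae_eq" by (auto simp: symp_def ae_eq_def elim: eventually_mono)
  show "transp ae_eq" unfolding transp_def ae_eq_def
  proof (intro allI impI; elim conjE; intro conjI)
    fix f g h :: "real \<Rightarrow> real"
    assume "AE x in unit_ivl. f x = g x" "AE x in unit_ivl. g x = h x"
    then show "AE x in unit_ivl. f x = h x" by eventually_elim simp
  qed
qed

instantiation ae_fun :: real_vector
begin

lift_definition zero_ae_fun :: ae_fun is "\<lambda>_. 0"
  by (simp add: ae_eq_def)

lift_definition plus_ae_fun :: "ae_fun \<Rightarrow> ae_fun \<Rightarrow> ae_fun" is "\<lambda>f g x. f x + g x"
  unfolding ae_eq_def by (auto elim: eventually_elim2)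

lift_definition uminus_ae_fun :: "ae_fun \<Rightarrow> ae_fun" is "\<lambda>f x. - f x"
  unfolding ae_eq_def by (auto elim: eventually_mono)

lift_definition minus_ae_fun :: "ae_fun \<Rightarrow> ae_fun \<Rightarrow> ae_fun" is "\<lambda>f g x. f x - g x"
  unfolding ae_eq_def by (auto elim: eventually_elim2)

lift_definition scaleR_ae_fun :: "real \<Rightarrow> ae_fun \<Rightarrow> ae_fun" is "\<lambda>c f x. c * f x"
  unfolding ae_eq_def by (auto elim: eventually_mono)

instance
  by standard (transfer; auto simp: ae_eq_def algebra_simps)+

end

lemma ae_eq_fn: "ae_eq (fn u) (fn u)"
  by (rule Quotient3_rep_reflp[OF Quotient3_ae_fun])

lemma cls_fn: "cls (fn u) = u"
  by (rule Quotient3_abs_rep[OF Quotient3_ae_fun])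

lemma cls_eq_iff: "ae_eq f f \<Longrightarrow> ae_eq g g \<Longrightarrow> cls f = cls g \<longleftrightarrow> ae_eq f g"
  using Quotient3_rel[OF Quotient3_ae_fun] by blast


section \<open>Distributional derivatives and function spaces on (0,1)\<close>

definition test_fun :: "(real \<Rightarrow> real) \<Rightarrow> bool" where
  "test_fun \<phi> \<longleftrightarrow> (\<forall>k x. (deriv ^^ k) \<phi> field_differentiable at x) \<and>
     (\<exists>K. compact K \<and> K \<subseteq> {0<..<1} \<and> (\<forall>x. x \<notin> K \<longrightarrow> \<phi> x = 0))"

definition L1_loc :: "ae_fun set" where
  "L1_loc = {u. \<forall>K. compact K \<and> K \<subseteq> {0<..<1} \<longrightarrow> integrable (lebesgue_on K) (fn u)}"

definition L2 :: "ae_fun set" where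
  "L2 = {u. integrable unit_ivl (\<lambda>x. (fn u x)\<^sup>2)}"

text \<open>\<open>weak_deriv k u v\<close>: the \<open>k\<close>-th distributional derivative of \<open>u\<close> is the locally
  integrable function \<open>v\<close>. Such a \<open>v\<close> is unique, by the fundamental lemma of the calculus of
  variations.\<close>

definition weak_deriv :: "nat \<Rightarrow> ae_fun \<Rightarrow> ae_fun \<Rightarrow> bool" where
  "weak_deriv k u v \<longleftrightarrow> u \<in> L1_loc \<and> v \<in> L1_loc \<and>
     (\<forall>\<phi>. test_fun \<phi> \<longrightarrow>
       (LINT x|unit_ivl. fn u x * (deriv ^^ k) \<phi> x) =
       (-1) ^ k * (LINT x|unit_ivl. fn v x * \<phi> x))"

definition H2 :: "ae_fun set" where
  "H2 = {u \<in> L2. \<forall>k\<in>{1,2}. \<exists>v\<in>L2. weak_deriv k u v}"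

text \<open>The boundary values of \<open>u\<close> and \<open>u'\<close> are those of the representative of \<open>u\<close> in
  \<open>C\<^sup>1[0,1]\<close>.\<close>

definition H2_0 :: "ae_fun set" where
  "H2_0 = {u \<in> H2. \<exists>w w'. (AE x in unit_ivl. fn u x = w x) \<and>
     (\<forall>x\<in>{0..1}. (w has_real_derivative w' x) (at x within {0..1})) \<and>
     continuous_on {0..1} w' \<and> w 0 = 0 \<and> w 1 = 0 \<and> w' 0 = 0 \<and> w' 1 = 0}"

text \<open>Division by zero at a zero of \<open>a\<close> is harmless below: the zero set is a null set.\<close>

definition L2w :: "(real \<Rightarrow> real) \<Rightarrow> ae_fun set" where
  "L2w a = {u \<in> L2. integrable unit_ivl (\<lambda>x. (fn u x)\<^sup>2 / a x)}"

definition ipw :: "(real \<Rightarrow> real) \<Rightarrow> ae_fun \<Rightarrow> ae_fun \<Rightarrow> real" where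
  "ipw a u v = (LINT x|unit_ivl. fn u x * fn v x / a x)"

definition H2w :: "(real \<Rightarrow> real) \<Rightarrow> ae_fun set" where
  "H2w a = L2w a \<inter> H2_0"

definition mult_fun :: "(real \<Rightarrow> real) \<Rightarrow> ae_fun \<Rightarrow> ae_fun" where
  "mult_fun a v = cls (\<lambda>x. a x * fn v x)"

definition dom_A :: "(real \<Rightarrow> real) \<Rightarrow> ae_fun set" where
  "dom_A a = {u \<in> H2w a. \<exists>v. weak_deriv 4 u v \<and> mult_fun a v \<in> L2w a}"

definition op_A :: "(real \<Rightarrow> real) \<Rightarrow> ae_fun \<Rightarrow> ae_fun" where
  "op_A a u = mult_fun a (THE v. weak_deriv 4 u v)"


section \<open>Unbounded operators on a real Hilbert space\<close>

text \<open>Throughout, the Hilbert space is a subspace \<open>H\<close> of a real vector space, with an inner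
  product \<open>ip\<close> that is only meaningful on \<open>H\<close>.\<close>

definition hnorm :: "('v \<Rightarrow> 'v \<Rightarrow> real) \<Rightarrow> 'v \<Rightarrow> real" where
  "hnorm ip u = sqrt (ip u u)"

definition linear_map :: "'v::real_vector set \<Rightarrow> 'v set \<Rightarrow> ('v \<Rightarrow> 'v) \<Rightarrow> bool" where
  "linear_map D H A \<longleftrightarrow> (\<forall>u\<in>D. A u \<in> H) \<and> (\<forall>u\<in>D. \<forall>v\<in>D. A (u + v) = A u + A v) \<and>
     (\<forall>c. \<forall>u\<in>D. A (c *\<^sub>R u) = c *\<^sub>R A u)"

definition densely_defined_operator ::
  "'v::real_vector set \<Rightarrow> ('v \<Rightarrow> 'v \<Rightarrow> real) \<Rightarrow> 'v set \<Rightarrow> ('v \<Rightarrow> 'v) \<Rightarrow> bool" where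
  "densely_defined_operator H ip D A \<longleftrightarrow> subspace D \<and> D \<subseteq> H \<and> linear_map D H A \<and>
     (\<forall>u\<in>H. \<forall>\<epsilon>>0. \<exists>v\<in>D. hnorm ip (u - v) < \<epsilon>)"

definition adjoint_dom :: "'v set \<Rightarrow> ('v \<Rightarrow> 'v \<Rightarrow> real) \<Rightarrow> 'v set \<Rightarrow> ('v \<Rightarrow> 'v) \<Rightarrow> 'v set" where
  "adjoint_dom H ip D A = {v \<in> H. \<exists>w\<in>H. \<forall>u\<in>D. ip (A u) v = ip u w}"

definition adjoint_op :: "'v set \<Rightarrow> ('v \<Rightarrow> 'v \<Rightarrow> real) \<Rightarrow> 'v set \<Rightarrow> ('v \<Rightarrow> 'v) \<Rightarrow> 'v \<Rightarrow> 'v" where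
  "adjoint_op H ip D A v = (THE w. w \<in> H \<and> (\<forall>u\<in>D. ip (A u) v = ip u w))"

definition self_adjoint ::
  "'v::real_vector set \<Rightarrow> ('v \<Rightarrow> 'v \<Rightarrow> real) \<Rightarrow> 'v set \<Rightarrow> ('v \<Rightarrow> 'v) \<Rightarrow> bool" where
  "self_adjoint H ip D A \<longleftrightarrow> densely_defined_operator H ip D A \<and>
     adjoint_dom H ip D A = D \<and> (\<forall>v\<in>D. adjoint_op H ip D A v = A v)"

definition non_negative :: "('v \<Rightarrow> 'v \<Rightarrow> real) \<Rightarrow> 'v set \<Rightarrow> ('v \<Rightarrow> 'v) \<Rightarrow> bool" where
  "non_negative ip D A \<longleftrightarrow> (\<forall>u\<in>D. ip (A u) u \<ge> 0)"


section \<open>Contractive analytic semigroups\<close>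

definition contraction_semigroup ::
  "'v::real_vector set \<Rightarrow> ('v \<Rightarrow> 'v \<Rightarrow> real) \<Rightarrow> (real \<Rightarrow> 'v \<Rightarrow> 'v) \<Rightarrow> bool" where
  "contraction_semigroup H ip T \<longleftrightarrow>
     (\<forall>t\<ge>0. linear_map H H (T t) \<and> (\<forall>u\<in>H. hnorm ip (T t u) \<le> hnorm ip u)) \<and>
     (\<forall>u\<in>H. T 0 u = u) \<and>
     (\<forall>s\<ge>0. \<forall>t\<ge>0. \<forall>u\<in>H. T (s + t) u = T s (T t u)) \<and>
     (\<forall>u\<in>H. ((\<lambda>t. hnorm ip (T t u - u)) \<longlongrightarrow> 0) (at_right 0))"

definition is_generator_value ::
  "('v::real_vector \<Rightarrow> 'v \<Rightarrow> real) \<Rightarrow> (real \<Rightarrow> 'v \<Rightarrow> 'v) \<Rightarrow> 'v \<Rightarrow> 'v \<Rightarrow> bool" where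
  "is_generator_value ip T u v \<longleftrightarrow>
     ((\<lambda>t. hnorm ip ((1 / t) *\<^sub>R (T t u - u) - v)) \<longlongrightarrow> 0) (at_right 0)"

definition generates :: "'v::real_vector set \<Rightarrow> ('v \<Rightarrow> 'v \<Rightarrow> real) \<Rightarrow> 'v set \<Rightarrow> ('v \<Rightarrow> 'v) \<Rightarrow>
    (real \<Rightarrow> 'v \<Rightarrow> 'v) \<Rightarrow> bool" where
  "generates H ip D B T \<longleftrightarrow> D = {u \<in> H. \<exists>v\<in>H. is_generator_value ip T u v} \<and>
     (\<forall>u\<in>D. B u \<in> H \<and> is_generator_value ip T u (B u))"

text \<open>The complexification of \<open>H\<close> is \<open>H \<times> H\<close>, where \<open>(u, v)\<close> stands for \<open>u + i v\<close>.\<close>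

definition cscale :: "complex \<Rightarrow> 'v::real_vector \<times> 'v \<Rightarrow> 'v \<times> 'v" where
  "cscale c p = (Re c *\<^sub>R fst p - Im c *\<^sub>R snd p, Re c *\<^sub>R snd p + Im c *\<^sub>R fst p)"

definition cnorm :: "('v \<Rightarrow> 'v \<Rightarrow> real) \<Rightarrow> 'v \<times> 'v \<Rightarrow> real" where
  "cnorm ip p = sqrt (ip (fst p) (fst p) + ip (snd p) (snd p))"

definition bounded_clinear_on ::
  "'v::real_vector set \<Rightarrow> ('v \<Rightarrow> 'v \<Rightarrow> real) \<Rightarrow> ('v \<times> 'v \<Rightarrow> 'v \<times> 'v) \<Rightarrow> bool" where
  "bounded_clinear_on H ip F \<longleftrightarrow>
     (\<forall>p\<in>H\<times>H. F p \<in> H \<times> H) \<and> (\<forall>p\<in>H\<times>H. \<forall>q\<in>H\<times>H. F (p + q) = F p + F q) \<and>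
     (\<forall>c. \<forall>p\<in>H\<times>H. F (cscale c p) = cscale c (F p)) \<and>
     (\<exists>C. \<forall>p\<in>H\<times>H. cnorm ip (F p) \<le> C * cnorm ip p)"

text \<open>Complex differentiability at \<open>z\<close> with respect to the operator norm.\<close>

definition op_differentiable_at :: "'v::real_vector set \<Rightarrow> ('v \<Rightarrow> 'v \<Rightarrow> real) \<Rightarrow>
    (complex \<Rightarrow> 'v \<times> 'v \<Rightarrow> 'v \<times> 'v) \<Rightarrow> complex \<Rightarrow> bool" where
  "op_differentiable_at H ip S z \<longleftrightarrow> (\<exists>F. bounded_clinear_on H ip F \<and>
     (\<forall>\<epsilon>>0. \<exists>\<delta>>0. \<forall>h. norm h < \<delta> \<longrightarrow>
       (\<forall>p\<in>H\<times>H. cnorm ip (S (z + h) p - S z p - cscale h (F p)) \<le> \<epsilon> * norm h * cnorm ip p)))"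

definition sector :: "real \<Rightarrow> complex set" where
  "sector \<theta> = {z. z \<noteq> 0 \<and> \<bar>Arg z\<bar> < \<theta>}"

definition analytic_semigroup :: "'v::real_vector set \<Rightarrow> ('v \<Rightarrow> 'v \<Rightarrow> real) \<Rightarrow> real \<Rightarrow>
    (complex \<Rightarrow> 'v \<times> 'v \<Rightarrow> 'v \<times> 'v) \<Rightarrow> bool" where
  "analytic_semigroup H ip \<theta> S \<longleftrightarrow>
     (\<forall>z\<in>sector \<theta>. bounded_clinear_on H ip (S z) \<and> op_differentiable_at H ip S z) \<and>
     (\<forall>p\<in>H\<times>H. S 0 p = p) \<and>
     (\<forall>z\<in>sector \<theta>. \<forall>w\<in>sector \<theta>. \<forall>p\<in>H\<times>H. S (z + w) p = S z (S w p)) \<and>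
     (\<forall>\<theta>'. 0 < \<theta>' \<and> \<theta>' < \<theta> \<longrightarrow>
       (\<forall>p\<in>H\<times>H. ((\<lambda>z. cnorm ip (S z p - p)) \<longlongrightarrow> 0) (at 0 within sector \<theta>')))"

definition generates_contractive_analytic_semigroup :: "'v::real_vector set \<Rightarrow>
    ('v \<Rightarrow> 'v \<Rightarrow> real) \<Rightarrow> real \<Rightarrow> 'v set \<Rightarrow> ('v \<Rightarrow> 'v) \<Rightarrow> bool" where
  "generates_contractive_analytic_semigroup H ip \<theta> D B \<longleftrightarrow>
     (\<exists>T S. contraction_semigroup H ip T \<and> generates H ip D B T \<and> analytic_semigroup H ip \<theta> S \<and>
       (\<forall>t\<ge>0. \<forall>u\<in>H. \<forall>v\<in>H. S (complex_of_real t) (u, v) = (T t u, T t v)))"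

end

theory Submission
  imports Defs "HOL-Complex_Analysis.Great_Picard"
begin

text \<open>Dividing by \<open>a\<close> turns \<open>A u = f\<close> into the clamped beam equation \<open>u'''' = f / a\<close>,
  \<open>u(0) = u'(0) = u(1) = u'(1) = 0\<close>, whose right-hand side is in \<open>L\<^sup>1\<close> because \<open>1 / a\<close> is.
  The Green function of the beam gives an inverse \<open>G\<close> of \<open>A\<close>. Since
  \<open>\<langle>G f, g\<rangle> = \<integral> (G f)'' (G g)''\<close>, it is symmetric and positive, and it is compact by the theorem
  of Arzela and Ascoli. Hence \<open>A\<close> is diagonal in an orthonormal basis of eigenvectors of \<open>G\<close>
  with positive eigenvalues \<open>\<lambda>\<close>, and \<open>- A\<close> generates the semigroup of the multipliers
  \<open>exp (- z \<lambda>)\<close>, \<open>Re z > 0\<close>. That the range of \<open>G\<close> is the whole domain of \<open>A\<close> follows from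
  the lemma of du Bois-Reymond: a function with vanishing fourth derivative is a cubic polynomial,
  and the boundary conditions leave only zero.\<close>

section \<open>Hilbert spaces and orthonormal bases\<close>

text \<open>Since \<open>a\<close> vanishes inside the interval, \<open>u''''\<close> is only known
  to be in \<open>L^1\<close>. The proof therefore works with \<open>u''\<close> and never with a
  third derivative of a solution. The kernel \<open>beam_kernel\<close> represents
  \<open>u''\<close> through the load \<open>v = f / a\<close>; conversely, pairing the second
  derivative of a clamped function with it returns that function. Together with one use of Fubini
  (\<open>integral_mult_bending\<close>), these two facts give the conditions at 1, the symmetric
  form of the overview and the weak equation. Integrability of \<open>1 / a\<close> puts every load
  into \<open>L^1\<close> with a norm controlled by the weighted norm, puts continuous functions
  into the weighted space, and turns uniform convergence into convergence there, as the use of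
  Arzela and Ascoli requires. In the abstract half, an eigenvector is found on the orthogonal
  complement of a given set of eigenvectors, and Zorn's lemma replaces an enumeration. Sums over the
  basis are unordered, so countability never has to be discussed. In coefficients, each claim about
  the semigroups becomes a bound on a scalar function that is uniform in
  \<open>\<lambda> \<ge> 0\<close>.\<close>

text \<open>Stated for a nonnegative quadratic polynomial, because it is applied to \<open>\<langle>x, y\<rangle>\<close> as well
  as to \<open>\<langle>G x, y\<rangle>\<close> for a positive operator \<open>G\<close>.\<close>

lemma Cauchy_Schwarz_form:
  fixes a b c :: real
  assumes "\<And>t. 0 \<le> a + 2 * t * b + t\<^sup>2 * c"
  shows "b\<^sup>2 \<le> a * c"
proof (cases "c = 0")
  case True
  have "b = 0"
  proof (rule ccontr)
    assume "b \<noteq> 0"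
    \<comment> \<open>With \<open>c = 0\<close> the polynomial is linear, and at this
      \<open>t\<close> it takes the value -1.\<close>
    then show False
      using assms[of "(- a - 1) / (2 * b)"] True by (simp add: field_simps)
  qed
  then show ?thesis using True by simp
next
  case False
  have "0 \<le> c"
  proof (rule ccontr)
    assume "\<not> 0 \<le> c"
    then have c: "c < 0" by simp
    \<comment> \<open>Chosen so that \<open>t * \<bar>c\<bar> = \<bar>c\<bar> + \<bar>a\<bar> + 2 *
      \<bar>b\<bar>\<close>. After one more factor \<open>t \<ge> 1\<close>, the negative quadratic
      term outweighs the constant and the linear term.\<close>
    define t where "t = 1 + \<bar>a\<bar> / \<bar>c\<bar> + 2 * \<bar>b\<bar> / \<bar>c\<bar>"
    have t: "t \<ge> 1" by (simp add: t_def)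
    have tc: "t * \<bar>c\<bar> = \<bar>c\<bar> + \<bar>a\<bar> + 2 * \<bar>b\<bar>"
      using c by (simp add: t_def field_simps)
    have "t\<^sup>2 * c = - t * (t * \<bar>c\<bar>)" using c by (simp add: power2_eq_square)
    also have "\<dots> = - t * \<bar>c\<bar> - t * \<bar>a\<bar> - 2 * t * \<bar>b\<bar>" by (simp add: tc algebra_simps)
    finally have eq: "t\<^sup>2 * c = - t * \<bar>c\<bar> - t * \<bar>a\<bar> - 2 * t * \<bar>b\<bar>" .
    have "t * b \<le> t * \<bar>b\<bar>" using t by (intro mult_left_mono) auto
    moreover have "\<bar>a\<bar> \<le> t * \<bar>a\<bar>" using t mult_right_mono[of 1 t "\<bar>a\<bar>"] by simp
    moreover have "0 < t * \<bar>c\<bar>" using t c by (intro mult_pos_pos) auto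
    ultimately show False using assms[of t] eq by linarith
  qed
  with False have c: "c > 0" by simp
  have "0 \<le> a + 2 * (- b / c) * b + (- b / c)\<^sup>2 * c" by (rule assms)
  also have "\<dots> = a - b\<^sup>2 / c" using c by (simp add: power2_eq_square field_simps)
  finally show ?thesis using c by (simp add: field_simps)
qed

text \<open>An explicit carrier is used because the type \<open>ae_fun\<close> contains all
  measurable classes, while \<open>ipw a\<close> is an inner product only on those of finite
  weighted norm.\<close>

locale hilbert_space =
  fixes H :: "'v::real_vector set" and ip :: "'v \<Rightarrow> 'v \<Rightarrow> real"
  assumes subspace_H: "subspace H"
    and ip_add_left: "\<And>x y z. x \<in> H \<Longrightarrow> y \<in> H \<Longrightarrow> z \<in> H \<Longrightarrow> ip (x + y) z = ip x z + ip y z"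
    and ip_scaleR_left: "\<And>c x y. x \<in> H \<Longrightarrow> y \<in> H \<Longrightarrow> ip (c *\<^sub>R x) y = c * ip x y"
    and ip_commute: "\<And>x y. x \<in> H \<Longrightarrow> y \<in> H \<Longrightarrow> ip x y = ip y x"
    and ip_nonneg: "\<And>x. x \<in> H \<Longrightarrow> 0 \<le> ip x x"
    and ip_self_eq_0: "\<And>x. x \<in> H \<Longrightarrow> ip x x = 0 \<Longrightarrow> x = 0"
    and complete_H: "\<And>X. (\<And>n. X n \<in> H) \<Longrightarrow>
      (\<And>e. e > 0 \<Longrightarrow> \<exists>N. \<forall>m\<ge>N. \<forall>n\<ge>N. hnorm ip (X m - X n) < e) \<Longrightarrow>
      \<exists>x\<in>H. (\<lambda>n::nat. hnorm ip (X n - x)) \<longlonglongrightarrow> 0"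
begin

lemma mem_H [simp, intro]:
  "0 \<in> H" "x \<in> H \<Longrightarrow> y \<in> H \<Longrightarrow> x + y \<in> H" "x \<in> H \<Longrightarrow> y \<in> H \<Longrightarrow> x - y \<in> H"
  "x \<in> H \<Longrightarrow> c *\<^sub>R x \<in> H" "x \<in> H \<Longrightarrow> - x \<in> H"
  using subspace_H by (auto simp: subspace_0 subspace_add subspace_diff subspace_mul subspace_neg)

lemma sum_mem_H: "(\<And>i. i \<in> I \<Longrightarrow> f i \<in> H) \<Longrightarrow> sum f I \<in> H"
  using subspace_H by (rule subspace_sum)

lemma ip_scaleR_right: "x \<in> H \<Longrightarrow> y \<in> H \<Longrightarrow> ip x (c *\<^sub>R y) = c * ip x y"
  by (metis ip_commute ip_scaleR_left mem_H(4))

lemma ip_add_right: "x \<in> H \<Longrightarrow> y \<in> H \<Longrightarrow> z \<in> H \<Longrightarrow> ip x (y + z) = ip x y + ip x z"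
  by (metis ip_commute ip_add_left mem_H(2))

lemma ip_minus_left: "x \<in> H \<Longrightarrow> y \<in> H \<Longrightarrow> ip (- x) y = - ip x y"
  using ip_scaleR_left[of x y "-1"] by simp

lemma ip_minus_right: "x \<in> H \<Longrightarrow> y \<in> H \<Longrightarrow> ip x (- y) = - ip x y"
  using ip_scaleR_right[of x y "-1"] by simp

lemma ip_diff_left: "x \<in> H \<Longrightarrow> y \<in> H \<Longrightarrow> z \<in> H \<Longrightarrow> ip (x - y) z = ip x z - ip y z"
  using ip_add_left[of x "-y" z] by (simp add: ip_minus_left)

lemma ip_diff_right: "x \<in> H \<Longrightarrow> y \<in> H \<Longrightarrow> z \<in> H \<Longrightarrow> ip x (y - z) = ip x y - ip x z"
  using ip_add_right[of x y "-z"] by (simp add: ip_minus_right)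

lemmas ip_simps = ip_add_left ip_add_right ip_diff_left ip_diff_right ip_scaleR_left
  ip_scaleR_right ip_minus_left ip_minus_right

lemma ip_0_left: "y \<in> H \<Longrightarrow> ip 0 y = 0"
  using ip_scaleR_left[of 0 y 0] by simp

lemma ip_sum_left: "(\<And>i. i \<in> I \<Longrightarrow> f i \<in> H) \<Longrightarrow> y \<in> H \<Longrightarrow> ip (sum f I) y = (\<Sum>i\<in>I. ip (f i) y)"
  by (induction I rule: infinite_finite_induct) (auto simp: ip_0_left ip_add_left sum_mem_H)

lemma hnorm_nonneg: "x \<in> H \<Longrightarrow> 0 \<le> hnorm ip x"
  by (simp add: hnorm_def ip_nonneg)

lemma hnorm_square: "x \<in> H \<Longrightarrow> (hnorm ip x)\<^sup>2 = ip x x"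
  by (simp add: hnorm_def ip_nonneg)

lemma Cauchy_Schwarz_square:
  assumes "x \<in> H" "y \<in> H"
  shows "(ip x y)\<^sup>2 \<le> ip x x * ip y y"
proof (rule Cauchy_Schwarz_form)
  fix t
  have "0 \<le> ip (x + t *\<^sub>R y) (x + t *\<^sub>R y)" using assms by (intro ip_nonneg) auto
  also have "\<dots> = ip x x + 2 * t * ip x y + t\<^sup>2 * ip y y"
    using assms by (simp add: ip_simps power2_eq_square ip_commute[of y x] algebra_simps)
  finally show "0 \<le> \<dots>" .
qed

lemma Cauchy_Schwarz:
  assumes "x \<in> H" "y \<in> H"
  shows "\<bar>ip x y\<bar> \<le> hnorm ip x * hnorm ip y"
  using Cauchy_Schwarz_square[OF assms]
  by (metis hnorm_def real_sqrt_abs real_sqrt_le_iff real_sqrt_mult)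

lemma hnorm_triangle:
  assumes "x \<in> H" "y \<in> H"
  shows "hnorm ip (x + y) \<le> hnorm ip x + hnorm ip y"
proof (rule power2_le_imp_le)
  have "(hnorm ip (x + y))\<^sup>2 = ip x x + 2 * ip x y + ip y y"
    using assms by (simp add: hnorm_square ip_simps ip_commute[of y x])
  also have "\<dots> \<le> (hnorm ip x)\<^sup>2 + 2 * (hnorm ip x * hnorm ip y) + (hnorm ip y)\<^sup>2"
    using Cauchy_Schwarz[OF assms] assms by (simp add: hnorm_square)
  also have "\<dots> = (hnorm ip x + hnorm ip y)\<^sup>2"
    by (simp add: power2_sum)
  finally show "(hnorm ip (x + y))\<^sup>2 \<le> (hnorm ip x + hnorm ip y)\<^sup>2" .
  show "0 \<le> hnorm ip x + hnorm ip y" using assms hnorm_nonneg by simp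
qed

text \<open>Membership is required only eventually: along \<open>at_right 0\<close> the orbits of a
  semigroup are controlled for positive times only.\<close>

lemma tendsto_ip:
  assumes "((\<lambda>n. hnorm ip (X n - x)) \<longlongrightarrow> 0) F" "eventually (\<lambda>n. X n \<in> H) F" "x \<in> H" "y \<in> H"
  shows "((\<lambda>n. ip (X n) y) \<longlongrightarrow> ip x y) F"
proof (rule Lim_null[THEN iffD2], rule Lim_null_comparison)
  show "eventually (\<lambda>n. norm (ip (X n) y - ip x y) \<le> hnorm ip (X n - x) * hnorm ip y) F"
    using assms(2)
  proof eventually_elim
    case (elim n)
    then show ?case using Cauchy_Schwarz[of "X n - x" y] assms by (simp add: ip_diff_left)
  qed
  show "((\<lambda>n. hnorm ip (X n - x) * hnorm ip y) \<longlongrightarrow> 0) F"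
    using tendsto_mult_left_zero[OF assms(1)] .
qed

text \<open>Expanding the square of \<open>X n - x\<close> expresses the squared norm of
  \<open>X n\<close> through the distance to \<open>x\<close> and the inner product with
  \<open>x\<close>, whose limits are known.\<close>

lemma tendsto_ip_self:
  assumes "((\<lambda>n. hnorm ip (X n - x)) \<longlongrightarrow> 0) F" "eventually (\<lambda>n. X n \<in> H) F" "x \<in> H"
  shows "((\<lambda>n. ip (X n) (X n)) \<longlongrightarrow> ip x x) F"
proof -
  have "((\<lambda>n. (hnorm ip (X n - x))\<^sup>2 + 2 * ip (X n) x - ip x x) \<longlongrightarrow> 0\<^sup>2 + 2 * ip x x - ip x x) F"
    by (intro tendsto_intros assms tendsto_ip)
  moreover have "eventually (\<lambda>n. (hnorm ip (X n - x))\<^sup>2 + 2 * ip (X n) x - ip x x = ip (X n) (X n)) F"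
    using assms(2)
  proof eventually_elim
    case (elim n)
    then show ?case using assms(3) by (simp add: hnorm_square ip_simps ip_commute[of x "X n"])
  qed
  ultimately show ?thesis by (simp add: tendsto_cong)
qed

lemma limit_unique:
  assumes "(\<lambda>n::nat. hnorm ip (X n - x)) \<longlonglongrightarrow> 0" "(\<lambda>n. hnorm ip (X n - y)) \<longlonglongrightarrow> 0"
    "\<And>n. X n \<in> H" "x \<in> H" "y \<in> H"
  shows "x = y"
proof -
  have "ip x z = ip y z" if "z \<in> H" for z
    by (rule LIMSEQ_unique[OF tendsto_ip tendsto_ip]) (use assms that in auto)
  then have "ip (x - y) (x - y) = 0" using assms by (simp add: ip_diff_left)
  then show ?thesis using ip_self_eq_0[of "x - y"] assms by simp
qed

end

text \<open>Totality is expressed by a trivial orthogonal complement, the form in which a maximal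
  orthonormal set provides it.\<close>

locale hilbert_basis = hilbert_space +
  fixes B :: "'a::real_vector set"
  assumes basis_mem: "b \<in> B \<Longrightarrow> b \<in> H"
    and basis_norm: "b \<in> B \<Longrightarrow> ip b b = 1"
    and basis_orthogonal: "b \<in> B \<Longrightarrow> c \<in> B \<Longrightarrow> b \<noteq> c \<Longrightarrow> ip b c = 0"
    and basis_total: "x \<in> H \<Longrightarrow> (\<And>b. b \<in> B \<Longrightarrow> ip x b = 0) \<Longrightarrow> x = 0"
begin

lemma ip_basis_sum:
  assumes "finite F" "F \<subseteq> B" "b \<in> B"
  shows "ip (\<Sum>c\<in>F. d c *\<^sub>R c) b = (if b \<in> F then d b else 0)"
proof -
  have "ip (\<Sum>c\<in>F. d c *\<^sub>R c) b = (\<Sum>c\<in>F. d c * ip c b)"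
    using assms basis_mem by (subst ip_sum_left) (auto simp: ip_scaleR_left subset_iff)
  also have "\<dots> = (\<Sum>c\<in>F. if c = b then d c else 0)"
    using assms basis_norm basis_orthogonal by (intro sum.cong) (auto simp: subset_iff)
  finally show ?thesis using assms by simp
qed

lemma basis_sum_mem: "F \<subseteq> B \<Longrightarrow> (\<Sum>c\<in>F. d c *\<^sub>R c) \<in> H"
  using basis_mem by (intro sum_mem_H) auto

lemma ip_basis_sum_right:
  assumes "F \<subseteq> B" "x \<in> H"
  shows "ip x (\<Sum>c\<in>F. d c *\<^sub>R c) = (\<Sum>c\<in>F. d c * ip x c)"
proof -
  have "ip x (\<Sum>c\<in>F. d c *\<^sub>R c) = ip (\<Sum>c\<in>F. d c *\<^sub>R c) x"
    using assms by (intro ip_commute basis_sum_mem)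
  also have "\<dots> = (\<Sum>c\<in>F. d c * ip c x)"
    using assms basis_mem by (subst ip_sum_left) (auto simp: ip_scaleR_left subset_iff)
  also have "\<dots> = (\<Sum>c\<in>F. d c * ip x c)"
    using assms basis_mem by (intro sum.cong) (auto simp: ip_commute subset_iff)
  finally show ?thesis .
qed

lemma ip_basis_sum_self:
  assumes "finite F" "F \<subseteq> B"
  shows "ip (\<Sum>c\<in>F. d c *\<^sub>R c) (\<Sum>c\<in>F. d c *\<^sub>R c) = (\<Sum>c\<in>F. (d c)\<^sup>2)"
  using assms
  by (simp add: ip_basis_sum_right basis_sum_mem ip_basis_sum subset_iff power2_eq_square cong: sum.cong)

lemma Bessel:
  assumes "finite F" "F \<subseteq> B" "x \<in> H"
  shows "(\<Sum>c\<in>F. (ip x c)\<^sup>2) \<le> ip x x"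
proof -
  define y where "y = (\<Sum>c\<in>F. ip x c *\<^sub>R c)"
  have y: "y \<in> H" using assms by (simp add: y_def basis_sum_mem)
  have "ip x y = (\<Sum>c\<in>F. (ip x c)\<^sup>2)" "ip y y = (\<Sum>c\<in>F. (ip x c)\<^sup>2)"
    using assms by (simp_all add: y_def ip_basis_sum_self ip_basis_sum_right power2_eq_square)
  moreover have "0 \<le> ip (x - y) (x - y)" using y assms by (intro ip_nonneg) auto
  ultimately show ?thesis using assms y by (simp add: ip_simps ip_commute[of y x])
qed

text \<open>Completeness speaks of sequences, so a sequence of finite sets is selected whose partial
  sums of squares are within \<open>1 / (n + 1)\<close> of the total. The vectors built on them form
  a Cauchy sequence.\<close>

lemma Riesz_Fischer:
  assumes "(\<lambda>b. (c b)\<^sup>2) summable_on B"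
  obtains x where "x \<in> H" "\<And>b. b \<in> B \<Longrightarrow> ip x b = c b" "((\<lambda>b. (c b)\<^sup>2) has_sum ip x x) B"
proof -
  obtain s where s: "((\<lambda>b. (c b)\<^sup>2) has_sum s) B" using assms by (auto simp: summable_on_def)
  have le_s: "(\<Sum>b\<in>F. (c b)\<^sup>2) \<le> s" if "finite F" "F \<subseteq> B" for F
    by (rule has_sum_mono_neutral[OF has_sum_finite[OF that(1)] s]) (use that in auto)
  have "\<exists>F. finite F \<and> F \<subseteq> B \<and> s - 1 / real (Suc n) < (\<Sum>b\<in>F. (c b)\<^sup>2)" for n
  proof -
    have "eventually (\<lambda>F. s - 1 / real (Suc n) < (\<Sum>b\<in>F. (c b)\<^sup>2)) (finite_subsets_at_top B)"
      using s unfolding has_sum_def by (rule order_tendstoD) simp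
    then show ?thesis
      unfolding eventually_finite_subsets_at_top by auto
  qed
  then obtain F where F: "\<And>n. finite (F n)" "\<And>n. F n \<subseteq> B"
    and F_gt: "\<And>n. s - 1 / real (Suc n) < (\<Sum>b\<in>F n. (c b)\<^sup>2)" by metis
  define X where "X n = (\<Sum>b\<in>F n. c b *\<^sub>R b)" for n
  have X_mem: "X n \<in> H" for n using F by (simp add: X_def basis_sum_mem)
  have X_diff: "ip (X m - X n) (X m - X n) \<le> 1 / real (Suc m) + 1 / real (Suc n)" for m n
  proof -
    \<comment> \<open>The sets \<open>F n\<close> need not be nested. Both vectors are therefore
      written over the union, with coefficients cut off outside the respective set.\<close>
    define U where "U = F m \<union> F n"
    have U: "finite U" "U \<subseteq> B" using F by (auto simp: U_def)
    define d where "d k b = (if b \<in> F k then c b else 0)" for k b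
    have X_eq: "X k = (\<Sum>b\<in>U. d k b *\<^sub>R b)" if "k \<in> {m, n}" for k
      unfolding X_def d_def using that F U(1)
      by (intro sum.mono_neutral_cong_left) (auto simp: U_def)
    have sum_eq: "(\<Sum>b\<in>U. (d k b)\<^sup>2) = (\<Sum>b\<in>F k. (c b)\<^sup>2)" if "k \<in> {m, n}" for k
      unfolding d_def using that F U(1)
      by (intro sum.mono_neutral_cong_right) (auto simp: U_def)
    have "X m - X n = (\<Sum>b\<in>U. (d m b - d n b) *\<^sub>R b)"
      by (simp add: X_eq sum_subtractf scaleR_diff_left)
    then have "ip (X m - X n) (X m - X n) = (\<Sum>b\<in>U. (d m b - d n b)\<^sup>2)"
      using U by (simp add: ip_basis_sum_self)
    \<comment> \<open>An index in both sets contributes nothing; an index missing from one of them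
      contributes at most the mass that this set misses. Each set misses at most
      \<open>1 / (n + 1)\<close> in total.\<close>
    also have "\<dots> \<le> (\<Sum>b\<in>U. ((c b)\<^sup>2 - (d m b)\<^sup>2) + ((c b)\<^sup>2 - (d n b)\<^sup>2))"
      by (intro sum_mono) (auto simp: d_def)
    also have "\<dots> = ((\<Sum>b\<in>U. (c b)\<^sup>2) - (\<Sum>b\<in>F m. (c b)\<^sup>2)) + ((\<Sum>b\<in>U. (c b)\<^sup>2) - (\<Sum>b\<in>F n. (c b)\<^sup>2))"
      using sum_eq[of m] sum_eq[of n] by (simp only: sum.distrib sum_subtractf) simp
    also have "\<dots> \<le> 1 / real (Suc m) + 1 / real (Suc n)"
      using le_s[OF U] F_gt[of m] F_gt[of n] by linarith
    finally show ?thesis .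
  qed
  have "\<exists>N. \<forall>m\<ge>N. \<forall>n\<ge>N. hnorm ip (X m - X n) < e" if e: "e > 0" for e
  proof -
    obtain N where N: "1 / real (Suc N) < e\<^sup>2 / 2"
      using nat_approx_posE[of "e\<^sup>2 / 2"] e by auto
    show ?thesis
    proof (intro exI allI impI)
      fix m n assume "N \<le> m" "N \<le> n"
      then have "1 / real (Suc m) \<le> 1 / real (Suc N)" "1 / real (Suc n) \<le> 1 / real (Suc N)"
        by (auto simp: field_simps)
      then have "ip (X m - X n) (X m - X n) < e\<^sup>2" using X_diff[of m n] N by linarith
      then show "hnorm ip (X m - X n) < e"
        unfolding hnorm_def using e real_less_lsqrt by auto
    qed
  qed
  from complete_H[OF X_mem this] obtain x where x: "x \<in> H" "(\<lambda>n. hnorm ip (X n - x)) \<longlonglongrightarrow> 0"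
    by blast
  have inv_lim: "(\<lambda>n. 1 / real (Suc n)) \<longlonglongrightarrow> 0" by (rule lim_1_over_n[THEN LIMSEQ_Suc])
  show ?thesis
  proof
    show "x \<in> H" by fact
    show "ip x b = c b" if b: "b \<in> B" for b
    proof (rule LIMSEQ_unique)
      show "(\<lambda>n. ip (X n) b) \<longlonglongrightarrow> ip x b"
        using x X_mem b basis_mem by (intro tendsto_ip) auto
      show "(\<lambda>n. ip (X n) b) \<longlonglongrightarrow> c b"
      proof (rule Lim_null[THEN iffD2], rule Lim_null_comparison)
        show "\<forall>\<^sub>F n in sequentially. norm (ip (X n) b - c b) \<le> sqrt (1 / real (Suc n))"
        proof (intro always_eventually allI)
          fix n
          \<comment> \<open>An index missed by \<open>F n\<close> could be added to it without
            exceeding the total \<open>s\<close>, so its square is no larger than the gap.\<close>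
          have "(c b)\<^sup>2 \<le> 1 / real (Suc n)" if "b \<notin> F n"
            using le_s[of "insert b (F n)"] F[of n] F_gt[of n] b that by simp
          then have "\<bar>c b\<bar> \<le> sqrt (1 / real (Suc n))" if "b \<notin> F n"
            using that by (intro real_le_rsqrt) auto
          then show "norm (ip (X n) b - c b) \<le> sqrt (1 / real (Suc n))"
            using F b by (auto simp: X_def ip_basis_sum)
        qed
        show "(\<lambda>n. sqrt (1 / real (Suc n))) \<longlonglongrightarrow> 0"
          using tendsto_real_sqrt[OF inv_lim] by simp
      qed
    qed
    have "ip x x = s"
    proof (rule LIMSEQ_unique)
      show "(\<lambda>n. ip (X n) (X n)) \<longlonglongrightarrow> ip x x"
        using x X_mem by (intro tendsto_ip_self) auto
      show "(\<lambda>n. ip (X n) (X n)) \<longlonglongrightarrow> s"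
      proof (rule tendsto_sandwich)
        show "(\<lambda>n. s - 1 / real (Suc n)) \<longlonglongrightarrow> s" using tendsto_diff[OF tendsto_const inv_lim] by simp
        show "(\<lambda>n. s) \<longlonglongrightarrow> s" by simp
      qed (use F F_gt le_s in \<open>auto simp: X_def ip_basis_sum_self less_imp_le intro!: always_eventually\<close>)
    qed
    then show "((\<lambda>b. (c b)\<^sup>2) has_sum ip x x) B" using s by simp
  qed
qed

lemma eq_of_coefficients:
  assumes "x \<in> H" "y \<in> H" "\<And>b. b \<in> B \<Longrightarrow> ip x b = ip y b"
  shows "x = y"
  using basis_total[of "x - y"] assms basis_mem by (simp add: ip_diff_left)

text \<open>Bessel's inequality makes the squares summable, Riesz-Fischer produces a vector with the
  same coefficients for which the identity holds, and totality identifies that vector with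
  \<open>x\<close>.\<close>

lemma Parseval:
  assumes "x \<in> H"
  shows "((\<lambda>b. (ip x b)\<^sup>2) has_sum ip x x) B"
proof -
  have "(\<lambda>b. (ip x b)\<^sup>2) summable_on B"
    by (rule nonneg_bdd_above_summable_on) (use Bessel assms in \<open>auto intro!: bdd_aboveI\<close>)
  then obtain y where y: "y \<in> H" "\<And>b. b \<in> B \<Longrightarrow> ip y b = ip x b" "((\<lambda>b. (ip x b)\<^sup>2) has_sum ip y y) B"
    by (rule Riesz_Fischer) auto
  then have "y = x" using assms by (intro eq_of_coefficients)
  then show ?thesis using y by simp
qed

text \<open>Polarisation of the identity for squares, which also supplies the summability of the
  products.\<close>

lemma Parseval_ip:
  assumes "x \<in> H" "y \<in> H"
  shows "((\<lambda>b. ip x b * ip y b) has_sum ip x y) B"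
proof -
  have "((\<lambda>b. 1/4 * ((ip (x + y) b)\<^sup>2 + - (ip (x - y) b)\<^sup>2)) has_sum
      1/4 * (ip (x + y) (x + y) + - ip (x - y) (x - y))) B"
    using Parseval[of "x + y"] Parseval[of "x - y"] assms
    by (intro has_sum_cmult_right has_sum_add) (auto simp: has_sum_uminus)
  moreover have "1/4 * ((ip (x + y) b)\<^sup>2 + - (ip (x - y) b)\<^sup>2) = ip x b * ip y b" if "b \<in> B" for b
    using that assms basis_mem by (simp add: ip_simps power2_eq_square algebra_simps)
  moreover have "1/4 * (ip (x + y) (x + y) + - ip (x - y) (x - y)) = ip x y"
    using assms by (simp add: ip_simps ip_commute[of y x])
  ultimately show ?thesis by (metis (no_types, lifting) has_sum_cong)
qed

subsection \<open>Coefficients and multipliers on the complexification\<close>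

text \<open>The coefficient of \<open>u + i v\<close> with respect to a real basis vector. It turns
  \<open>cscale\<close> into multiplication of complex numbers.\<close>

definition coeff :: "'a \<times> 'a \<Rightarrow> 'a \<Rightarrow> complex" where
  "coeff p b = Complex (ip (fst p) b) (ip (snd p) b)"

lemma coeff_add: "p \<in> H \<times> H \<Longrightarrow> q \<in> H \<times> H \<Longrightarrow> b \<in> B \<Longrightarrow> coeff (p + q) b = coeff p b + coeff q b"
  by (auto simp: coeff_def ip_simps basis_mem complex_eq_iff)

lemma coeff_diff: "p \<in> H \<times> H \<Longrightarrow> q \<in> H \<times> H \<Longrightarrow> b \<in> B \<Longrightarrow> coeff (p - q) b = coeff p b - coeff q b"
  by (auto simp: coeff_def ip_simps basis_mem complex_eq_iff)

lemma coeff_cscale: "p \<in> H \<times> H \<Longrightarrow> b \<in> B \<Longrightarrow> coeff (cscale c p) b = c * coeff p b"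
  by (auto simp: coeff_def cscale_def ip_simps basis_mem complex_eq_iff)

lemma cscale_mem: "p \<in> H \<times> H \<Longrightarrow> cscale c p \<in> H \<times> H"
  by (auto simp: cscale_def)

lemma prod_mem: "p \<in> H \<times> H \<Longrightarrow> q \<in> H \<times> H \<Longrightarrow> p + q \<in> H \<times> H"
  "p \<in> H \<times> H \<Longrightarrow> q \<in> H \<times> H \<Longrightarrow> p - q \<in> H \<times> H"
  by (auto simp: plus_prod_def minus_prod_def)

lemma eq_of_coeff:
  assumes "p \<in> H \<times> H" "q \<in> H \<times> H" "\<And>b. b \<in> B \<Longrightarrow> coeff p b = coeff q b"
  shows "p = q"
proof (rule prod_eqI)
  show "fst p = fst q" "snd p = snd q"
    using assms by (auto intro!: eq_of_coefficients simp: coeff_def)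
qed

lemma cnorm_nonneg: "p \<in> H \<times> H \<Longrightarrow> 0 \<le> cnorm ip p"
  by (auto simp: cnorm_def ip_nonneg)

lemma cnorm_Parseval:
  assumes "p \<in> H \<times> H"
  shows "((\<lambda>b. (cmod (coeff p b))\<^sup>2) has_sum (cnorm ip p)\<^sup>2) B"
proof -
  have "((\<lambda>b. (ip (fst p) b)\<^sup>2 + (ip (snd p) b)\<^sup>2) has_sum ip (fst p) (fst p) + ip (snd p) (snd p)) B"
    using assms by (intro has_sum_add Parseval) auto
  moreover have "0 \<le> ip (fst p) (fst p) + ip (snd p) (snd p)"
    using assms by (auto intro!: add_nonneg_nonneg ip_nonneg)
  ultimately show ?thesis by (simp add: coeff_def cnorm_def cmod_power2)
qed

lemma exists_coeff:
  assumes "(\<lambda>b. (cmod (c b))\<^sup>2) summable_on B"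
  shows "\<exists>p\<in>H \<times> H. \<forall>b\<in>B. coeff p b = c b"
proof -
  have "(\<lambda>b. (Re (c b))\<^sup>2) summable_on B" "(\<lambda>b. (Im (c b))\<^sup>2) summable_on B"
    by (rule summable_on_comparison_test[OF assms]; simp add: cmod_power2)+
  then obtain x y where "x \<in> H" "\<forall>b\<in>B. ip x b = Re (c b)" "y \<in> H" "\<forall>b\<in>B. ip y b = Im (c b)"
    by (metis Riesz_Fischer)
  then show ?thesis by (intro bexI[of _ "(x, y)"]) (auto simp: coeff_def)
qed

text \<open>Operator norm estimates for multipliers reduce to this comparison of
  coefficients.\<close>

lemma cnorm_le:
  assumes "p \<in> H \<times> H" "q \<in> H \<times> H" "0 \<le> C" "\<And>b. b \<in> B \<Longrightarrow> cmod (coeff q b) \<le> C * cmod (coeff p b)"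
  shows "cnorm ip q \<le> C * cnorm ip p"
proof (rule power2_le_imp_le)
  have "(cnorm ip q)\<^sup>2 \<le> C\<^sup>2 * (cnorm ip p)\<^sup>2"
    using cnorm_Parseval[OF assms(2)] has_sum_cmult_right[OF cnorm_Parseval[OF assms(1)]]
  proof (rule has_sum_mono)
    fix b assume "b \<in> B"
    then show "(cmod (coeff q b))\<^sup>2 \<le> C\<^sup>2 * (cmod (coeff p b))\<^sup>2"
      using power_mono[OF assms(4), of b 2] by (simp add: power_mult_distrib)
  qed
  then show "(cnorm ip q)\<^sup>2 \<le> (C * cnorm ip p)\<^sup>2" by (simp add: power_mult_distrib)
  show "0 \<le> C * cnorm ip p" using assms cnorm_nonneg by simp
qed

text \<open>The property determines \<open>q\<close> by \<open>eq_of_coeff\<close>; a solution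
  exists for \<open>p\<close> in \<open>H \<times> H\<close> as soon as the symbol \<open>m\<close>
  is bounded on \<open>B\<close>.\<close>

definition multiplier :: "('a \<Rightarrow> complex) \<Rightarrow> 'a \<times> 'a \<Rightarrow> 'a \<times> 'a" where
  "multiplier m p = (SOME q. q \<in> H \<times> H \<and> (\<forall>b\<in>B. coeff q b = m b * coeff p b))"

definition bounded_symbol :: "('a \<Rightarrow> complex) \<Rightarrow> bool" where
  "bounded_symbol m \<longleftrightarrow> (\<exists>C. \<forall>b\<in>B. cmod (m b) \<le> C)"

lemma multiplier:
  assumes "bounded_symbol m" "p \<in> H \<times> H"
  shows "multiplier m p \<in> H \<times> H" "\<And>b. b \<in> B \<Longrightarrow> coeff (multiplier m p) b = m b * coeff p b"
proof -
  obtain C where C: "\<And>b. b \<in> B \<Longrightarrow> cmod (m b) \<le> C"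
    using assms(1) by (auto simp: bounded_symbol_def)
  have "(\<lambda>b. C\<^sup>2 * (cmod (coeff p b))\<^sup>2) summable_on B"
    using cnorm_Parseval[OF assms(2)] by (intro summable_on_cmult_right) (auto simp: summable_on_def)
  then have "(\<lambda>b. (cmod (m b * coeff p b))\<^sup>2) summable_on B"
    by (rule summable_on_comparison_test)
      (auto simp: norm_mult power_mult_distrib intro!: mult_right_mono power_mono C)
  from exists_coeff[OF this] have "\<exists>q. q \<in> H \<times> H \<and> (\<forall>b\<in>B. coeff q b = m b * coeff p b)" by blast
  from someI_ex[OF this] show "multiplier m p \<in> H \<times> H"
    "\<And>b. b \<in> B \<Longrightarrow> coeff (multiplier m p) b = m b * coeff p b"
    by (auto simp: multiplier_def)
qed

lemma multiplier_bound:
  assumes "\<And>b. b \<in> B \<Longrightarrow> cmod (m b) \<le> C" "0 \<le> C" "p \<in> H \<times> H"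
  shows "cnorm ip (multiplier m p) \<le> C * cnorm ip p"
proof -
  have m: "bounded_symbol m" using assms by (auto simp: bounded_symbol_def)
  show ?thesis
    by (rule cnorm_le) (use assms multiplier[OF m] in \<open>auto simp: norm_mult intro!: mult_right_mono\<close>)
qed

lemma bounded_clinear_multiplier:
  assumes "bounded_symbol m"
  shows "bounded_clinear_on H ip (multiplier m)"
proof -
  note m = multiplier[OF assms]
  obtain C where C: "\<And>b. b \<in> B \<Longrightarrow> cmod (m b) \<le> C"
    using assms by (auto simp: bounded_symbol_def)
  have C': "cmod (m b) \<le> max C 0" if "b \<in> B" for b using C[OF that] by simp
  show ?thesis
    unfolding bounded_clinear_on_def
  proof (intro conjI ballI allI)
    fix p q c assume p: "p \<in> H \<times> H"
    show "multiplier m p \<in> H \<times> H" by (rule m) fact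
    show "multiplier m (cscale c p) = cscale c (multiplier m p)"
      using p by (intro eq_of_coeff) (simp_all add: m coeff_cscale cscale_mem)
    assume q: "q \<in> H \<times> H"
    show "multiplier m (p + q) = multiplier m p + multiplier m q"
      using p q by (intro eq_of_coeff) (simp_all add: m coeff_add prod_mem ring_distribs del: mem_Times_iff)
  next
    show "\<exists>C. \<forall>p\<in>H \<times> H. cnorm ip (multiplier m p) \<le> C * cnorm ip p"
      using multiplier_bound[OF C'] by (intro exI[of _ "max C 0"] ballI) auto
  qed
qed

text \<open>Dominated convergence for coefficients: outside a finite set of basis vectors the
  dominating vector \<open>p\<close> makes the sum small uniformly in \<open>z\<close>, and on the
  finite set convergence of each coefficient suffices. All strong limits of semigroups below come
  from it.\<close>

lemma cnorm_tendsto_0: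
  assumes p: "p \<in> H \<times> H"
    and q: "eventually (\<lambda>z. q z \<in> H \<times> H \<and> (\<forall>b\<in>B. cmod (coeff (q z) b) \<le> C * cmod (coeff p b))) F"
    and lim: "\<And>b. b \<in> B \<Longrightarrow> ((\<lambda>z. coeff (q z) b) \<longlongrightarrow> 0) F"
  shows "((\<lambda>z. cnorm ip (q z)) \<longlongrightarrow> 0) F"
proof -
  have "((\<lambda>z. (cnorm ip (q z))\<^sup>2) \<longlongrightarrow> 0) F"
  proof (rule tendstoI)
    fix e :: real assume e: "e > 0"
    define f where "f b = C\<^sup>2 * (cmod (coeff p b))\<^sup>2" for b
    have f: "(f has_sum C\<^sup>2 * (cnorm ip p)\<^sup>2) B"
      unfolding f_def by (intro has_sum_cmult_right cnorm_Parseval p)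
    then have "eventually (\<lambda>F. C\<^sup>2 * (cnorm ip p)\<^sup>2 - e / 2 < sum f F) (finite_subsets_at_top B)"
      unfolding has_sum_def by (rule order_tendstoD) (use e in simp)
    then obtain E where E: "finite E" "E \<subseteq> B" "C\<^sup>2 * (cnorm ip p)\<^sup>2 - e / 2 < sum f E"
      unfolding eventually_finite_subsets_at_top by auto
    have tail: "(f has_sum (C\<^sup>2 * (cnorm ip p)\<^sup>2 - sum f E)) (B - E)"
      using has_sum_Diff[OF f has_sum_finite[OF E(1)] E(2)] .
    have "((\<lambda>z. \<Sum>b\<in>E. (cmod (coeff (q z) b))\<^sup>2) \<longlongrightarrow> (\<Sum>b\<in>E. (cmod 0)\<^sup>2)) F"
      using lim E by (intro tendsto_intros) auto
    then have "eventually (\<lambda>z. (\<Sum>b\<in>E. (cmod (coeff (q z) b))\<^sup>2) < e / 2) F"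
      by (rule order_tendstoD) (use e in simp)
    with q show "eventually (\<lambda>z. dist ((cnorm ip (q z))\<^sup>2) 0 < e) F"
    proof eventually_elim
      case (elim z)
      have "((\<lambda>b. (cmod (coeff (q z) b))\<^sup>2) has_sum
          ((cnorm ip (q z))\<^sup>2 - (\<Sum>b\<in>E. (cmod (coeff (q z) b))\<^sup>2))) (B - E)"
        by (intro has_sum_Diff cnorm_Parseval has_sum_finite E) (use elim in blast)
      from this tail have "(cnorm ip (q z))\<^sup>2 - (\<Sum>b\<in>E. (cmod (coeff (q z) b))\<^sup>2)
          \<le> C\<^sup>2 * (cnorm ip p)\<^sup>2 - sum f E"
      proof (rule has_sum_mono)
        fix b assume "b \<in> B - E"
        then have "cmod (coeff (q z) b) \<le> C * cmod (coeff p b)" using elim by auto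
        from power_mono[OF this, of 2] show "(cmod (coeff (q z) b))\<^sup>2 \<le> f b"
          by (simp add: f_def power_mult_distrib)
      qed
      then show ?case using E(3) elim by simp
    qed
  qed
  from tendsto_real_sqrt[OF this] have "((\<lambda>z. \<bar>cnorm ip (q z)\<bar>) \<longlongrightarrow> 0) F" by simp
  then show ?thesis by (simp add: tendsto_rabs_zero_iff)
qed

end

section \<open>Diagonal operators\<close>

context hilbert_basis
begin

text \<open>Defined through the complex multiplier, so that the real and the complex semigroup agree
  at real times. For a real symbol the second component is zero.\<close>

definition real_multiplier :: "('a \<Rightarrow> real) \<Rightarrow> 'a \<Rightarrow> 'a" where
  "real_multiplier m u = fst (multiplier (\<lambda>b. complex_of_real (m b)) (u, 0))"

lemma real_multiplier:
  assumes "bounded_symbol (\<lambda>b. complex_of_real (m b))" "u \<in> H"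
  shows "real_multiplier m u \<in> H" "\<And>b. b \<in> B \<Longrightarrow> ip (real_multiplier m u) b = m b * ip u b"
proof -
  have u: "(u, 0) \<in> H \<times> H" using assms by auto
  show "real_multiplier m u \<in> H"
    using multiplier(1)[OF assms(1) u] by (auto simp: real_multiplier_def)
  show "ip (real_multiplier m u) b = m b * ip u b" if "b \<in> B" for b
    using arg_cong[OF multiplier(2)[OF assms(1) u that], of Re]
    by (simp add: coeff_def real_multiplier_def)
qed

lemma multiplier_of_real:
  assumes "bounded_symbol (\<lambda>b. complex_of_real (m b))" "u \<in> H" "v \<in> H"
  shows "multiplier (\<lambda>b. complex_of_real (m b)) (u, v) = (real_multiplier m u, real_multiplier m v)"
  by (rule eq_of_coeff)
    (use assms multiplier[OF assms(1)] real_multiplier[OF assms(1)] in \<open>auto simp: coeff_def complex_eq_iff\<close>)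

lemma bounded_symbol_of_real:
  "(\<And>b. b \<in> B \<Longrightarrow> \<bar>m b\<bar> \<le> C) \<Longrightarrow> bounded_symbol (\<lambda>b. complex_of_real (m b))"
  by (auto simp: bounded_symbol_def intro!: exI[of _ C])

lemma cnorm_real: "u \<in> H \<Longrightarrow> cnorm ip (u, 0) = hnorm ip u"
  by (simp add: cnorm_def hnorm_def ip_0_left)

lemma hnorm_real_multiplier_le:
  assumes "\<And>b. b \<in> B \<Longrightarrow> \<bar>m b\<bar> \<le> C" "0 \<le> C" "u \<in> H"
  shows "hnorm ip (real_multiplier m u) \<le> C * hnorm ip u"
proof -
  note m = real_multiplier[OF bounded_symbol_of_real[OF assms(1)] assms(3)]
  have "cnorm ip (real_multiplier m u, 0) \<le> C * cnorm ip (u, 0)"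
    by (rule cnorm_le)
      (use assms m in \<open>auto simp: coeff_def ip_0_left basis_mem abs_mult complex_norm intro!: mult_right_mono\<close>)
  then show ?thesis using assms m by (simp add: cnorm_real)
qed

lemma hnorm_tendsto_0:
  assumes "u \<in> H" "eventually (\<lambda>t. x t \<in> H \<and> (\<forall>b\<in>B. \<bar>ip (x t) b\<bar> \<le> C * \<bar>ip u b\<bar>)) F"
    and "\<And>b. b \<in> B \<Longrightarrow> ((\<lambda>t. ip (x t) b) \<longlongrightarrow> 0) F"
  shows "((\<lambda>t. hnorm ip (x t)) \<longlongrightarrow> 0) F"
proof -
  have "((\<lambda>t. cnorm ip (x t, 0)) \<longlongrightarrow> 0) F"
  proof (rule cnorm_tendsto_0[of "(u, 0)"])
    show "(u, 0) \<in> H \<times> H" using assms by auto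
    show "eventually (\<lambda>t. (x t, 0) \<in> H \<times> H \<and>
        (\<forall>b\<in>B. cmod (coeff (x t, 0) b) \<le> C * cmod (coeff (u, 0) b))) F"
      using assms(2) by eventually_elim (auto simp: coeff_def ip_0_left basis_mem complex_norm)
    show "((\<lambda>t. coeff (x t, 0) b) \<longlongrightarrow> 0) F" if "b \<in> B" for b
      using tendsto_Complex[OF assms(3)[OF that] tendsto_const[of 0]] that
      by (simp add: coeff_def ip_0_left basis_mem zero_complex.code)
  qed
  moreover have "eventually (\<lambda>t. cnorm ip (x t, 0) = hnorm ip (x t)) F"
    using assms(2) by eventually_elim (simp add: cnorm_real)
  ultimately show ?thesis by (simp add: tendsto_cong)
qed

end

lemma sector_half_pi: "z \<in> sector (pi / 2) \<longleftrightarrow> 0 < Re z"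
  using Arg_Re_pos[of z] by (auto simp: sector_def)

text \<open>The bounds are uniform in \<open>y\<close>. They keep the symbol of the derivative of
  the semigroup and its second order remainder bounded although the eigenvalues are unbounded in
  general.\<close>

lemma mult_exp_minus_le:
  fixes x y :: real
  assumes "0 < x" "0 \<le> y"
  shows "y * exp (- x * y) \<le> 1 / x" "y\<^sup>2 * exp (- x * y) \<le> 2 / x\<^sup>2"
proof -
  have "x * y \<le> exp (x * y)" "(x * y)\<^sup>2 / 2 \<le> exp (x * y)"
    using exp_lower_Taylor_quadratic[of "x * y"] mult_nonneg_nonneg[of x y] zero_le_power2[of "x * y"] assms
    by linarith+
  then show "y * exp (- x * y) \<le> 1 / x" "y\<^sup>2 * exp (- x * y) \<le> 2 / x\<^sup>2"
    using assms by (auto simp: exp_minus field_simps)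
qed

text \<open>\<open>D_def\<close> asks for the maximal domain: all \<open>u\<close> whose
  coefficients, multiplied by \<open>lam\<close>, belong to some vector of \<open>H\<close>. Both
  the domain of the adjoint and the exact domain of the generator rest on this maximality.\<close>

locale diagonal_operator = hilbert_basis +
  fixes lam :: "'a \<Rightarrow> real" and D :: "'a set" and A :: "'a \<Rightarrow> 'a"
  assumes lam_nonneg: "b \<in> B \<Longrightarrow> 0 \<le> lam b"
    and D_def: "D = {u \<in> H. \<exists>f\<in>H. \<forall>b\<in>B. ip f b = lam b * ip u b}"
    and A_mem: "u \<in> D \<Longrightarrow> A u \<in> H"
    and ip_A: "u \<in> D \<Longrightarrow> b \<in> B \<Longrightarrow> ip (A u) b = lam b * ip u b"
begin

section \<open>Domain, density and self-adjointness of a diagonal operator\<close>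

lemma D_mem_H: "u \<in> D \<Longrightarrow> u \<in> H"
  by (simp add: D_def)

lemma mem_D: "u \<in> H \<Longrightarrow> f \<in> H \<Longrightarrow> (\<And>b. b \<in> B \<Longrightarrow> ip f b = lam b * ip u b) \<Longrightarrow> u \<in> D"
  by (auto simp: D_def)

lemma subspace_D: "subspace D"
proof (rule subspaceI)
  show "0 \<in> D" by (rule mem_D[of 0 0]) (auto simp: ip_0_left basis_mem)
  show "x + y \<in> D" if "x \<in> D" "y \<in> D" for x y
    using that D_mem_H A_mem
    by (intro mem_D[of _ "A x + A y"]) (auto simp: ip_simps ip_A basis_mem algebra_simps)
  show "c *\<^sub>R x \<in> D" if "x \<in> D" for c x
    using that D_mem_H A_mem by (intro mem_D[of _ "c *\<^sub>R A x"]) (auto simp: ip_simps ip_A basis_mem)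
qed

lemma basis_mem_D: "b \<in> B \<Longrightarrow> b \<in> D"
  using basis_mem by (auto intro!: mem_D[of b "lam b *\<^sub>R b"] simp: ip_simps dest: basis_orthogonal[of b])

lemma linear_A: "linear_map D H A"
  unfolding linear_map_def
proof (intro conjI ballI allI)
  fix u v c assume u: "u \<in> D"
  show "A u \<in> H" by (rule A_mem[OF u])
  have cu: "c *\<^sub>R u \<in> D" using subspace_D u by (rule subspace_mul)
  show "A (c *\<^sub>R u) = c *\<^sub>R A u"
    by (rule eq_of_coefficients) (use u cu D_mem_H A_mem in \<open>auto simp: ip_simps ip_A basis_mem\<close>)
  assume v: "v \<in> D"
  have uv: "u + v \<in> D" using subspace_D u v by (rule subspace_add)
  show "A (u + v) = A u + A v"
    by (rule eq_of_coefficients)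
      (use u v uv D_mem_H A_mem in \<open>auto simp: ip_simps ip_A basis_mem algebra_simps\<close>)
qed

text \<open>The resolvents \<open>(1 + A / (n + 1))\<^sup>-\<^sup>1\<close> approximate the identity.\<close>

lemma dense_D:
  assumes u: "u \<in> H" and e: "e > 0"
  shows "\<exists>v\<in>D. hnorm ip (u - v) < e"
proof -
  define m where "m n b = 1 / (1 + lam b / real (Suc n))" for n b
  have m_bound: "0 \<le> m n b" "m n b \<le> 1" if "b \<in> B" for n b
    using lam_nonneg[OF that] by (auto simp: m_def field_simps)
  have bdd: "bounded_symbol (\<lambda>b. complex_of_real (m n b))" for n
    by (rule bounded_symbol_of_real[of _ 1]) (use m_bound in auto)
  note mu = real_multiplier[OF bdd u]
  \<comment> \<open>The symbol of \<open>A\<close> applied after the resolvent is at most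
    \<open>n + 1\<close>, which places the range of the resolvent in \<open>D\<close>.\<close>
  have bdd': "bounded_symbol (\<lambda>b. complex_of_real (lam b * m n b))" for n
  proof (rule bounded_symbol_of_real[of _ "real (Suc n)"])
    fix b assume "b \<in> B"
    then show "\<bar>lam b * m n b\<bar> \<le> real (Suc n)"
      using lam_nonneg[of b] by (auto simp: m_def field_simps)
  qed
  have mD: "real_multiplier (m n) u \<in> D" for n
    using mu real_multiplier[OF bdd' u]
    by (intro mem_D[of _ "real_multiplier (\<lambda>b. lam b * m n b) u"]) auto
  have coeff_diff_eq: "ip (u - real_multiplier (m n) u) b = (1 - m n b) * ip u b" if "b \<in> B" for n b
    using u mu that by (simp add: ip_simps basis_mem algebra_simps)
  have "(\<lambda>n. hnorm ip (u - real_multiplier (m n) u)) \<longlonglongrightarrow> 0"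
  proof (rule hnorm_tendsto_0[OF u, where C = 1])
    show "\<forall>\<^sub>F n in sequentially. u - real_multiplier (m n) u \<in> H \<and>
        (\<forall>b\<in>B. \<bar>ip (u - real_multiplier (m n) u) b\<bar> \<le> 1 * \<bar>ip u b\<bar>)"
    proof (intro always_eventually allI conjI ballI)
      fix n show "u - real_multiplier (m n) u \<in> H" using u mu by auto
      fix b assume b: "b \<in> B"
      show "\<bar>ip (u - real_multiplier (m n) u) b\<bar> \<le> 1 * \<bar>ip u b\<bar>"
        unfolding coeff_diff_eq[OF b] using m_bound[OF b, of n] mult_right_mono[of "1 - m n b" 1 "\<bar>ip u b\<bar>"] by (simp add: abs_mult)
    qed
    fix b assume b: "b \<in> B"
    have "(\<lambda>n. (1 - 1 / (1 + lam b * (1 / real (Suc n)))) * ip u b) \<longlonglongrightarrow> (1 - 1 / (1 + lam b * 0)) * ip u b"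
      by (intro tendsto_intros LIMSEQ_Suc[OF lim_1_over_n]) auto
    then show "(\<lambda>n. ip (u - real_multiplier (m n) u) b) \<longlonglongrightarrow> 0"
      unfolding coeff_diff_eq[OF b] m_def by simp
  qed
  then have "\<forall>\<^sub>F n in sequentially. hnorm ip (u - real_multiplier (m n) u) < e"
    using e by (rule order_tendstoD)
  then obtain n where "hnorm ip (u - real_multiplier (m n) u) < e"
    by (auto simp: eventually_sequentially)
  then show ?thesis using mD by blast
qed

lemma densely_defined: "densely_defined_operator H ip D A"
  unfolding densely_defined_operator_def
  using subspace_D linear_A dense_D D_mem_H by blast

lemma A_symmetric:
  assumes "u \<in> D" "v \<in> D"
  shows "ip (A u) v = ip u (A v)"
proof -
  have "((\<lambda>b. ip (A u) b * ip v b) has_sum ip (A u) v) B" "((\<lambda>b. ip u b * ip (A v) b) has_sum ip u (A v)) B"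
    using assms A_mem D_mem_H by (auto intro!: Parseval_ip)
  moreover have "ip (A u) b * ip v b = ip u b * ip (A v) b" if "b \<in> B" for b
    using assms that by (simp add: ip_A)
  ultimately show ?thesis by (metis (no_types, lifting) has_sum_cong has_sum_unique)
qed

text \<open>Testing the adjoint identity with the eigenvector \<open>b\<close> reads off one
  coefficient of \<open>w\<close>. Maximality of \<open>D\<close> then leaves no room for a larger
  domain of the adjoint.\<close>

lemma adjoint_coeff:
  assumes "v \<in> H" "w \<in> H" "\<forall>u\<in>D. ip (A u) v = ip u w" "b \<in> B"
  shows "ip w b = lam b * ip v b"
proof -
  have "A b = lam b *\<^sub>R b"
    using assms(4) basis_mem_D basis_mem A_mem by (intro eq_of_coefficients)
      (auto simp: ip_A ip_simps dest: basis_orthogonal[of b])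
  then show ?thesis
    using assms basis_mem_D basis_mem ip_commute by (metis ip_scaleR_left)
qed

lemma self_adjoint_A: "self_adjoint H ip D A"
  unfolding self_adjoint_def
proof (intro conjI ballI)
  show "densely_defined_operator H ip D A" by (rule densely_defined)
  show "adjoint_dom H ip D A = D"
  proof
    show "adjoint_dom H ip D A \<subseteq> D"
      unfolding adjoint_dom_def using adjoint_coeff by (auto intro: mem_D)
    show "D \<subseteq> adjoint_dom H ip D A"
      unfolding adjoint_dom_def using A_symmetric A_mem D_mem_H by blast
  qed
  fix v assume v: "v \<in> D"
  show "adjoint_op H ip D A v = A v"
    unfolding adjoint_op_def
  proof (rule the_equality)
    show "A v \<in> H \<and> (\<forall>u\<in>D. ip (A u) v = ip u (A v))" using v A_mem A_symmetric by blast
    fix w assume w: "w \<in> H \<and> (\<forall>u\<in>D. ip (A u) v = ip u w)"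
    show "w = A v"
      using w v A_mem D_mem_H by (intro eq_of_coefficients) (auto simp: ip_A adjoint_coeff)
  qed
qed

lemma non_negative_A: "non_negative ip D A"
  unfolding non_negative_def
proof
  fix u assume u: "u \<in> D"
  have "((\<lambda>b. ip (A u) b * ip u b) has_sum ip (A u) u) B"
    using u A_mem D_mem_H by (intro Parseval_ip)
  then show "0 \<le> ip (A u) u"
    by (rule has_sum_nonneg) (use u lam_nonneg in \<open>auto simp: ip_A mult.assoc\<close>)
qed

section \<open>The real and the complex semigroup of a diagonal operator\<close>

definition heat :: "real \<Rightarrow> 'a \<Rightarrow> 'a" where
  "heat t = real_multiplier (\<lambda>b. exp (- t * lam b))"

definition complex_heat :: "complex \<Rightarrow> 'a \<times> 'a \<Rightarrow> 'a \<times> 'a" where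
  "complex_heat z = multiplier (\<lambda>b. exp (- z * complex_of_real (lam b)))"

lemma norm_exp_le_1:
  assumes "0 \<le> Re z" "b \<in> B"
  shows "cmod (exp (- z * complex_of_real (lam b))) \<le> 1"
  using assms lam_nonneg by simp

lemma bounded_symbol_exp:
  assumes "0 \<le> Re z"
  shows "bounded_symbol (\<lambda>b. exp (- z * complex_of_real (lam b)))"
  using norm_exp_le_1[OF assms] unfolding bounded_symbol_def by blast

lemma complex_heat:
  assumes "0 \<le> Re z" "p \<in> H \<times> H"
  shows "complex_heat z p \<in> H \<times> H"
    and "b \<in> B \<Longrightarrow> coeff (complex_heat z p) b = exp (- z * complex_of_real (lam b)) * coeff p b"
  using multiplier[OF bounded_symbol_exp] assms by (auto simp: complex_heat_def)

lemma heat_symbol: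
  assumes "0 \<le> t"
  shows "bounded_symbol (\<lambda>b. complex_of_real (exp (- t * lam b)))"
  by (rule bounded_symbol_of_real[of _ 1]) (use assms lam_nonneg in auto)

lemma heat:
  assumes "0 \<le> t" "u \<in> H"
  shows "heat t u \<in> H" "b \<in> B \<Longrightarrow> ip (heat t u) b = exp (- t * lam b) * ip u b"
  using real_multiplier[OF heat_symbol] assms by (auto simp: heat_def)

lemma complex_heat_of_real:
  assumes "0 \<le> t" "u \<in> H" "v \<in> H"
  shows "complex_heat (complex_of_real t) (u, v) = (heat t u, heat t v)"
  using multiplier_of_real[OF heat_symbol] assms
  by (simp add: complex_heat_def heat_def exp_of_real[symmetric])

lemma contraction_semigroup_heat: "contraction_semigroup H ip heat"
  unfolding contraction_semigroup_def
proof (intro conjI allI ballI impI)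
  fix t :: real assume t: "0 \<le> t"
  show "linear_map H H (heat t)"
    unfolding linear_map_def
  proof (intro conjI ballI allI)
    fix u v c assume u: "u \<in> H"
    show "heat t u \<in> H" by (rule heat) fact+
    show "heat t (c *\<^sub>R u) = c *\<^sub>R heat t u"
      using u t by (intro eq_of_coefficients) (auto simp: heat ip_simps basis_mem)
    assume v: "v \<in> H"
    show "heat t (u + v) = heat t u + heat t v"
      using u v t by (intro eq_of_coefficients) (auto simp: heat ip_simps basis_mem algebra_simps)
  qed
  show "hnorm ip (heat t u) \<le> hnorm ip u" if "u \<in> H" for u
    using hnorm_real_multiplier_le[of "\<lambda>b. exp (- t * lam b)" 1 u] t that lam_nonneg
    by (simp add: heat_def)
  show "heat (s + t) u = heat s (heat t u)" if "0 \<le> s" "u \<in> H" for s u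
    using that t by (intro eq_of_coefficients) (auto simp: heat exp_add[symmetric] algebra_simps)
next
  show "heat 0 u = u" if "u \<in> H" for u
    using that by (intro eq_of_coefficients) (auto simp: heat)
  fix u assume u: "u \<in> H"
  show "((\<lambda>t. hnorm ip (heat t u - u)) \<longlongrightarrow> 0) (at_right 0)"
  proof (rule hnorm_tendsto_0[OF u, where C = 1])
    show "\<forall>\<^sub>F t in at_right 0. heat t u - u \<in> H \<and> (\<forall>b\<in>B. \<bar>ip (heat t u - u) b\<bar> \<le> 1 * \<bar>ip u b\<bar>)"
      using eventually_at_right_less[of "0::real"]
    proof eventually_elim
      case (elim t)
      have "\<bar>ip (heat t u - u) b\<bar> \<le> 1 * \<bar>ip u b\<bar>" if b: "b \<in> B" for b
      proof -
        have "ip (heat t u - u) b = (exp (- t * lam b) - 1) * ip u b"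
          using elim u b by (simp add: ip_simps heat basis_mem algebra_simps)
        moreover have "\<bar>exp (- t * lam b) - 1\<bar> \<le> 1"
          using elim lam_nonneg[OF b] by (simp add: abs_le_iff order_trans[OF _ exp_ge_zero])
        ultimately show ?thesis by (simp only: abs_mult mult_right_mono abs_ge_zero)
      qed
      then show ?case using elim u heat by auto
    qed
    fix b assume b: "b \<in> B"
    have "((\<lambda>t. exp (- t * lam b) * ip u b - ip u b) \<longlongrightarrow> exp (- 0 * lam b) * ip u b - ip u b) (at_right 0)"
      by (intro tendsto_intros)
    moreover have "\<forall>\<^sub>F t in at_right 0. exp (- t * lam b) * ip u b - ip u b = ip (heat t u - u) b"
      using eventually_at_right_less[of "0::real"]
      by eventually_elim (use u b in \<open>simp add: ip_simps heat basis_mem\<close>)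
    ultimately show "((\<lambda>t. ip (heat t u - u) b) \<longlongrightarrow> 0) (at_right 0)"
      by (simp add: tendsto_cong)
  qed
qed

text \<open>Used in both directions for the generator: with domination it gives strong convergence
  on \<open>D\<close>, and without it it determines every possible generator value.\<close>

lemma difference_quotient_tendsto:
  assumes "u \<in> H" "b \<in> B"
  shows "((\<lambda>t. ip ((1 / t) *\<^sub>R (heat t u - u)) b) \<longlongrightarrow> - lam b * ip u b) (at_right 0)"
proof -
  have "((\<lambda>t. exp (- t * lam b)) has_real_derivative - lam b) (at 0)"
    by (auto intro!: derivative_eq_intros)
  then have "((\<lambda>t. (exp (- t * lam b) - 1) / t) \<longlongrightarrow> - lam b) (at 0)"
    by (simp add: has_field_derivative_iff)
  then have "((\<lambda>t. (exp (- t * lam b) - 1) / t * ip u b) \<longlongrightarrow> - lam b * ip u b) (at_right 0)"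
    by (intro tendsto_mult tendsto_const) (rule tendsto_within_subset[OF _ subset_UNIV])
  moreover have "\<forall>\<^sub>F t in at_right 0.
      (exp (- t * lam b) - 1) / t * ip u b = ip ((1 / t) *\<^sub>R (heat t u - u)) b"
    using eventually_at_right_less[of "0::real"]
    by eventually_elim (use assms in \<open>simp add: ip_simps heat basis_mem field_simps\<close>)
  ultimately show ?thesis by (simp add: tendsto_cong)
qed

text \<open>For \<open>u\<close> in \<open>D\<close>, the error of the difference quotient has
  coefficients bounded by those of \<open>A u\<close>, because
  \<open>0 \<le> exp (- x) - 1 + x \<le> x\<close> for \<open>x \<ge> 0\<close>;
  \<open>hnorm_tendsto_0\<close> applies. Conversely, strong convergence to \<open>v\<close> implies
  convergence of coefficients, so \<open>- v\<close> has the coefficients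
  \<open>lam b * ip u b\<close> and \<open>u\<close> lies in the maximal domain.\<close>

lemma generates_heat: "generates H ip D (\<lambda>u. - A u) heat"
  unfolding generates_def
proof
  have val: "is_generator_value ip heat u (- A u)" if u: "u \<in> D" for u
    unfolding is_generator_value_def
  proof (rule hnorm_tendsto_0[OF A_mem[OF u], where C = 1])
    have uH: "u \<in> H" using u by (rule D_mem_H)
    show "\<forall>\<^sub>F t in at_right 0. (1 / t) *\<^sub>R (heat t u - u) - - A u \<in> H \<and>
        (\<forall>b\<in>B. \<bar>ip ((1 / t) *\<^sub>R (heat t u - u) - - A u) b\<bar> \<le> 1 * \<bar>ip (A u) b\<bar>)"
      using eventually_at_right_less[of "0::real"]
    proof eventually_elim
      case (elim t)
      have "\<bar>ip ((1 / t) *\<^sub>R (heat t u - u) - - A u) b\<bar> \<le> 1 * \<bar>ip (A u) b\<bar>" if b: "b \<in> B" for b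
      proof -
        define x where "x = t * lam b"
        have x: "0 \<le> x" using elim lam_nonneg[OF b] by (simp add: x_def)
        have "ip ((1 / t) *\<^sub>R (heat t u - u) - - A u) b = (1 / t) * (exp (- x) - 1 + x) * ip u b"
          using elim u uH b A_mem by (simp add: ip_simps heat ip_A basis_mem x_def field_simps)
        moreover have "\<bar>exp (- x) - 1 + x\<bar> \<le> x"
          using x exp_ge_add_one_self[of "-x"] by (simp add: abs_if)
        then have "(1 / t) * \<bar>exp (- x) - 1 + x\<bar> \<le> (1 / t) * x"
          using elim by (intro mult_left_mono) auto
        then have "(1 / t) * \<bar>exp (- x) - 1 + x\<bar> * \<bar>ip u b\<bar> \<le> (1 / t) * x * \<bar>ip u b\<bar>"
          by (rule mult_right_mono) simp
        moreover have "(1 / t) * x * \<bar>ip u b\<bar> = \<bar>ip (A u) b\<bar>"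
          using elim u b lam_nonneg[OF b] by (simp add: x_def ip_A abs_mult)
        ultimately show ?thesis using elim by (simp add: abs_mult)
      qed
      then show ?case using elim uH u heat A_mem by auto
    qed
    fix b assume b: "b \<in> B"
    have "((\<lambda>t. ip ((1 / t) *\<^sub>R (heat t u - u)) b + ip (A u) b) \<longlongrightarrow> - lam b * ip u b + ip (A u) b) (at_right 0)"
      by (intro tendsto_add difference_quotient_tendsto uH b tendsto_const)
    moreover have "\<forall>\<^sub>F t in at_right 0. ip ((1 / t) *\<^sub>R (heat t u - u)) b + ip (A u) b =
        ip ((1 / t) *\<^sub>R (heat t u - u) - - A u) b"
      using eventually_at_right_less[of "0::real"]
      by eventually_elim (use u uH b A_mem in \<open>simp add: ip_add_left heat basis_mem\<close>)
    ultimately show "((\<lambda>t. ip ((1 / t) *\<^sub>R (heat t u - u) - - A u) b) \<longlongrightarrow> 0) (at_right 0)"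
      using u b by (simp add: tendsto_cong ip_A)
  qed
  have "u \<in> D" if u: "u \<in> H" and v: "v \<in> H" "is_generator_value ip heat u v" for u v
  proof (rule mem_D[of u "- v"])
    show "ip (- v) b = lam b * ip u b" if b: "b \<in> B" for b
    proof -
      have "((\<lambda>t. ip ((1 / t) *\<^sub>R (heat t u - u)) b) \<longlongrightarrow> ip v b) (at_right 0)"
      proof (rule tendsto_ip)
        show "((\<lambda>t. hnorm ip ((1 / t) *\<^sub>R (heat t u - u) - v)) \<longlongrightarrow> 0) (at_right 0)"
          using v by (simp add: is_generator_value_def)
        show "\<forall>\<^sub>F t in at_right 0. (1 / t) *\<^sub>R (heat t u - u) \<in> H"
          using eventually_at_right_less[of "0::real"]
          by eventually_elim (use u heat in auto)
      qed (use v b basis_mem in auto)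
      from tendsto_unique[OF _ this difference_quotient_tendsto[OF u b]]
      have "ip v b = - lam b * ip u b" by simp
      then show ?thesis using v b by (simp add: ip_simps basis_mem)
    qed
  qed (use u v in auto)
  then show "D = {u \<in> H. \<exists>v\<in>H. is_generator_value ip heat u v}"
    using val D_mem_H A_mem by blast
  show "\<forall>u\<in>D. - A u \<in> H \<and> is_generator_value ip heat u (- A u)"
    using val A_mem by blast
qed

text \<open>The derivative has the symbol \<open>F\<close>. With \<open>w = - h * lam b\<close>, the
  Taylor remainder costs a factor \<open>exp \<bar>Re w\<bar>\<close>, which half of the decay
  \<open>exp (- x * lam b)\<close> absorbs once \<open>norm h \<le> x / 2\<close>. The other half
  bounds the square of \<open>lam b\<close>, uniformly in \<open>b\<close>.\<close>

lemma op_differentiable_complex_heat: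
  assumes z: "0 < Re z"
  shows "op_differentiable_at H ip complex_heat z"
proof -
  define x where "x = Re z"
  have x: "x > 0" using z by (simp add: x_def)
  define F where "F b = - complex_of_real (lam b) * exp (- z * complex_of_real (lam b))" for b
  have "cmod (F b) \<le> 1 / x" if "b \<in> B" for b
    using mult_exp_minus_le(1)[OF x lam_nonneg[OF that]] lam_nonneg[OF that]
    by (simp add: F_def norm_mult x_def)
  then have F: "bounded_symbol F" by (auto simp: bounded_symbol_def)
  have remainder: "cmod (exp (- (z + h) * complex_of_real (lam b)) - exp (- z * complex_of_real (lam b)) - h * F b)
      \<le> (norm h)\<^sup>2 * (8 / x\<^sup>2)" if h: "norm h \<le> x / 2" and b: "b \<in> B" for h b
  proof -
    define l where "l = lam b"
    have l: "0 \<le> l" using lam_nonneg b by (simp add: l_def)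
    define w where "w = - h * complex_of_real l"
    have w: "norm w = norm h * l" using l by (simp add: w_def norm_mult)
    have "cmod (exp w - (\<Sum>i\<le>1. w ^ i / fact i)) \<le> exp \<bar>Re w\<bar> * cmod w ^ Suc 1 / fact 1"
      by (rule Taylor_exp)
    then have "cmod (exp w - 1 - w) \<le> exp \<bar>Re w\<bar> * (cmod w)\<^sup>2"
      by (simp add: diff_diff_eq power2_eq_square)
    also have "\<dots> \<le> exp (x / 2 * l) * (cmod w)\<^sup>2"
    proof (intro mult_right_mono)
      have "\<bar>Re w\<bar> \<le> norm h * l" using abs_Re_le_cmod[of w] w by simp
      also have "\<dots> \<le> x / 2 * l" using h l by (intro mult_right_mono)
      finally show "exp \<bar>Re w\<bar> \<le> exp (x / 2 * l)" by simp
    qed simp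
    finally have taylor: "cmod (exp w - 1 - w) \<le> exp (x / 2 * l) * (cmod w)\<^sup>2" .
    have "exp (- (z + h) * complex_of_real l) - exp (- z * complex_of_real l) - h * F b =
        exp (- z * complex_of_real l) * (exp w - 1 - w)"
      by (simp add: F_def w_def l_def[symmetric] exp_add[symmetric] algebra_simps)
    then have "cmod (exp (- (z + h) * complex_of_real l) - exp (- z * complex_of_real l) - h * F b) =
        exp (- x * l) * cmod (exp w - 1 - w)"
      by (simp add: norm_mult x_def)
    also have "\<dots> \<le> exp (- x * l) * (exp (x / 2 * l) * (cmod w)\<^sup>2)"
      by (intro mult_left_mono taylor) simp
    also have "\<dots> = (norm h)\<^sup>2 * (l\<^sup>2 * exp (- (x / 2) * l))"
    proof -
      have "exp (- x * l) * exp (x / 2 * l) = exp (- (x / 2) * l)"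
        by (subst exp_add[symmetric]) (simp add: algebra_simps)
      then have "exp (- x * l) * (exp (x / 2 * l) * (cmod w)\<^sup>2) = exp (- (x / 2) * l) * (cmod w)\<^sup>2"
        by (simp only: mult.assoc[symmetric])
      then show ?thesis by (simp only: w power_mult_distrib mult_ac)
    qed
    also have "\<dots> \<le> (norm h)\<^sup>2 * (2 / (x / 2)\<^sup>2)"
      using mult_exp_minus_le(2)[of "x / 2" l] x l by (intro mult_left_mono) auto
    also have "\<dots> = (norm h)\<^sup>2 * (8 / x\<^sup>2)" by (simp add: power2_eq_square)
    finally show ?thesis by (simp add: l_def)
  qed
  show ?thesis
    unfolding op_differentiable_at_def
  proof (intro exI[of _ "multiplier F"] conjI allI impI bounded_clinear_multiplier F)
    fix e :: real assume e: "e > 0"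
    \<comment> \<open>The first bound keeps \<open>z + h\<close> in the half-plane and admits
      \<open>remainder\<close>; the second makes \<open>norm h * (8 / x^2)\<close> at most
      \<open>e\<close>.\<close>
    define d where "d = min (x / 2) (e * x\<^sup>2 / 8)"
    have d: "d > 0" using x e by (simp add: d_def)
    show "\<exists>d>0. \<forall>h. norm h < d \<longrightarrow> (\<forall>p\<in>H \<times> H.
        cnorm ip (complex_heat (z + h) p - complex_heat z p - cscale h (multiplier F p)) \<le> e * norm h * cnorm ip p)"
    proof (intro exI[of _ d] conjI allI impI ballI d)
      fix h :: complex and p assume h: "norm h < d" and p: "p \<in> H \<times> H"
      have zh: "0 \<le> Re (z + h)"
        using h abs_Re_le_cmod[of h] x by (auto simp: d_def x_def)
      have z0: "0 \<le> Re z" using z by simp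
      note S = complex_heat[OF zh p] complex_heat[OF z0 p] multiplier[OF F p]
      show "cnorm ip (complex_heat (z + h) p - complex_heat z p - cscale h (multiplier F p)) \<le> e * norm h * cnorm ip p"
      proof (rule cnorm_le[OF p])
        show "complex_heat (z + h) p - complex_heat z p - cscale h (multiplier F p) \<in> H \<times> H"
          by (intro prod_mem cscale_mem S)
        show "0 \<le> e * norm h" using e by simp
        fix b assume b: "b \<in> B"
        have "coeff (complex_heat (z + h) p - complex_heat z p - cscale h (multiplier F p)) b =
            (exp (- (z + h) * complex_of_real (lam b)) - exp (- z * complex_of_real (lam b)) - h * F b) * coeff p b"
          using S b by (simp add: coeff_diff coeff_cscale prod_mem cscale_mem left_diff_distrib del: mem_Times_iff)
        moreover have "cmod (exp (- (z + h) * complex_of_real (lam b)) - exp (- z * complex_of_real (lam b)) - h * F b)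
            \<le> e * norm h"
        proof -
          have "norm h * (norm h * (8 / x\<^sup>2)) \<le> norm h * e"
            using h x by (intro mult_left_mono) (auto simp: d_def field_simps)
          then show ?thesis
            using remainder[OF _ b, of h] h by (simp add: d_def power2_eq_square mult_ac)
        qed
        ultimately show "cmod (coeff (complex_heat (z + h) p - complex_heat z p - cscale h (multiplier F p)) b)
            \<le> e * norm h * cmod (coeff p b)"
          by (simp add: norm_mult mult_right_mono)
      qed
    qed
  qed
qed

text \<open>The symbols have modulus at most 1 on the whole closed half-plane, so for strong
  continuity at 0 the dominating constant 2 serves every smaller sector.\<close>

lemma analytic_semigroup_complex_heat: "analytic_semigroup H ip (pi / 2) complex_heat"
  unfolding analytic_semigroup_def sector_half_pi Ball_def[of "sector (pi / 2)"]
proof (intro conjI allI impI ballI)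
  fix z assume z: "0 < Re z"
  show "bounded_clinear_on H ip (complex_heat z)"
    unfolding complex_heat_def using z by (intro bounded_clinear_multiplier bounded_symbol_exp) simp
  show "op_differentiable_at H ip complex_heat z" by (rule op_differentiable_complex_heat) fact
  fix w p assume w: "0 < Re w" and p: "p \<in> H \<times> H"
  show "complex_heat (z + w) p = complex_heat z (complex_heat w p)"
    using z w p
    by (intro eq_of_coeff) (simp_all add: complex_heat exp_add[symmetric] algebra_simps del: mem_Times_iff)
next
  show "complex_heat 0 p = p" if "p \<in> H \<times> H" for p
    using that by (intro eq_of_coeff) (simp_all add: complex_heat del: mem_Times_iff)
next
  fix \<theta> p assume \<theta>: "0 < \<theta> \<and> \<theta> < pi / 2" and p: "p \<in> H \<times> H"
  have ev: "\<forall>\<^sub>F z in at 0 within sector \<theta>. 0 \<le> Re z"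
  proof -
    have "\<forall>\<^sub>F z in at 0 within sector \<theta>. z \<in> sector \<theta>"
      by (simp add: eventually_at_filter)
    then show ?thesis
    proof eventually_elim
      case (elim z)
      then have "z \<in> sector (pi / 2)" using \<theta> by (auto simp: sector_def)
      then show ?case by (simp add: sector_half_pi)
    qed
  qed
  show "((\<lambda>z. cnorm ip (complex_heat z p - p)) \<longlongrightarrow> 0) (at 0 within sector \<theta>)"
  proof (rule cnorm_tendsto_0[OF p, where C = 2])
    show "\<forall>\<^sub>F z in at 0 within sector \<theta>. complex_heat z p - p \<in> H \<times> H \<and>
        (\<forall>b\<in>B. cmod (coeff (complex_heat z p - p) b) \<le> 2 * cmod (coeff p b))"
      using ev
    proof eventually_elim
      case (elim z)
      have "cmod (coeff (complex_heat z p - p) b) \<le> 2 * cmod (coeff p b)" if b: "b \<in> B" for b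
      proof -
        have "coeff (complex_heat z p - p) b = (exp (- z * complex_of_real (lam b)) - 1) * coeff p b"
          using elim p b by (simp add: coeff_diff complex_heat algebra_simps del: mem_Times_iff)
        moreover have "cmod (exp (- z * complex_of_real (lam b)) - 1) \<le> 2"
          using norm_triangle_ineq4[of "exp (- z * complex_of_real (lam b))" 1] norm_exp_le_1[OF elim b]
          by (simp only: norm_one)
        ultimately show ?thesis by (simp only: norm_mult mult_right_mono norm_ge_zero)
      qed
      then show ?case using elim p complex_heat(1)[of z p] prod_mem by auto
    qed
    fix b assume b: "b \<in> B"
    have "((\<lambda>z. exp (- z * complex_of_real (lam b)) * coeff p b - coeff p b) \<longlongrightarrow>
        exp (- 0 * complex_of_real (lam b)) * coeff p b - coeff p b) (at 0 within sector \<theta>)"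
      by (intro tendsto_intros)
    moreover have "\<forall>\<^sub>F z in at 0 within sector \<theta>.
        exp (- z * complex_of_real (lam b)) * coeff p b - coeff p b = coeff (complex_heat z p - p) b"
      using ev by eventually_elim (use p b in \<open>simp add: coeff_diff complex_heat del: mem_Times_iff\<close>)
    ultimately show "((\<lambda>z. coeff (complex_heat z p - p) b) \<longlongrightarrow> 0) (at 0 within sector \<theta>)"
      by (simp add: tendsto_cong)
  qed
qed

lemma generates_contractive_analytic:
  "generates_contractive_analytic_semigroup H ip (pi / 2) D (\<lambda>u. - A u)"
  unfolding generates_contractive_analytic_semigroup_def
  using contraction_semigroup_heat generates_heat analytic_semigroup_complex_heat complex_heat_of_real
  by blast

end

section \<open>Inverses of compact positive operators\<close>

text \<open>Compactness is the source of boundedness, through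
  \<open>bdd_above_quadratic_form\<close>; injectivity excludes the eigenvalue 0, so that the
  eigenvalues can be inverted.\<close>

locale compact_positive_operator = hilbert_space +
  fixes G :: "'a::real_vector \<Rightarrow> 'a"
  assumes G_mem: "x \<in> H \<Longrightarrow> G x \<in> H"
    and G_add: "x \<in> H \<Longrightarrow> y \<in> H \<Longrightarrow> G (x + y) = G x + G y"
    and G_scaleR: "x \<in> H \<Longrightarrow> G (c *\<^sub>R x) = c *\<^sub>R G x"
    and G_symmetric: "x \<in> H \<Longrightarrow> y \<in> H \<Longrightarrow> ip (G x) y = ip x (G y)"
    and G_nonneg: "x \<in> H \<Longrightarrow> 0 \<le> ip (G x) x"
    and G_injective: "x \<in> H \<Longrightarrow> G x = 0 \<Longrightarrow> x = 0"
    and G_compact: "(\<And>n. X n \<in> H) \<Longrightarrow> (\<And>n. hnorm ip (X n) \<le> 1) \<Longrightarrow>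
      \<exists>r y. strict_mono (r :: nat \<Rightarrow> nat) \<and> y \<in> H \<and> (\<lambda>n. hnorm ip (G (X (r n)) - y)) \<longlonglongrightarrow> 0"
begin

lemma G_diff: "x \<in> H \<Longrightarrow> y \<in> H \<Longrightarrow> G (x - y) = G x - G y"
  using G_add[of x "(-1) *\<^sub>R y"] G_scaleR[of y "-1"] by simp

lemma G_Cauchy_Schwarz:
  assumes "x \<in> H" "y \<in> H"
  shows "(ip (G x) y)\<^sup>2 \<le> ip (G x) x * ip (G y) y"
proof (rule Cauchy_Schwarz_form)
  fix t
  have "ip (G y) x = ip (G x) y"
    using assms G_mem by (metis G_symmetric ip_commute)
  then have "ip (G (x + t *\<^sub>R y)) (x + t *\<^sub>R y) = ip (G x) x + 2 * t * ip (G x) y + t\<^sup>2 * ip (G y) y"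
    using assms G_mem by (simp add: G_add G_scaleR ip_simps power2_eq_square algebra_simps)
  moreover have "0 \<le> ip (G (x + t *\<^sub>R y)) (x + t *\<^sub>R y)" using assms by (intro G_nonneg) auto
  ultimately show "0 \<le> ip (G x) x + 2 * t * ip (G x) y + t\<^sup>2 * ip (G y) y" by simp
qed

lemma G_positive:
  assumes "x \<in> H" "x \<noteq> 0"
  shows "0 < ip (G x) x"
proof (rule ccontr)
  assume "\<not> 0 < ip (G x) x"
  then have "ip (G x) x = 0" using G_nonneg[of x] assms by simp
  \<comment> \<open>Cauchy-Schwarz for the form of \<open>G\<close>, applied to \<open>x\<close> and
    \<open>G x\<close>, bounds the fourth power of the norm of \<open>G x\<close> by zero.\<close>
  then have "ip (G x) (G x) = 0" using G_Cauchy_Schwarz[of x "G x"] assms G_mem by simp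
  then show False using assms G_mem G_injective ip_self_eq_0 by blast
qed

text \<open>Unit vectors with quadratic form above \<open>n\<close> would have images of norm above
  \<open>n\<close>, but along a subsequence these images converge and so stay bounded.\<close>

lemma bdd_above_quadratic_form: "bdd_above ((\<lambda>x. ip (G x) x) ` {x \<in> H. ip x x = 1})"
proof (rule ccontr)
  assume unbounded: "\<not> ?thesis"
  have "\<exists>x. x \<in> H \<and> ip x x = 1 \<and> real n < ip (G x) x" for n
    using unbounded unfolding bdd_above_def by (auto simp: not_le)
  then obtain X where X: "\<And>n. X n \<in> H" "\<And>n. ip (X n) (X n) = 1" "\<And>n. real n < ip (G (X n)) (X n)"
    by metis
  then have "hnorm ip (X n) = 1" for n by (simp add: hnorm_def)
  then obtain r y where r: "strict_mono (r :: nat \<Rightarrow> nat)" and y: "y \<in> H"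
    and lim: "(\<lambda>n. hnorm ip (G (X (r n)) - y)) \<longlonglongrightarrow> 0"
    using G_compact[of X] X by auto
  have "(\<lambda>n. hnorm ip (G (X (r n)))) \<longlonglongrightarrow> hnorm ip y"
    unfolding hnorm_def by (intro tendsto_real_sqrt tendsto_ip_self lim y) (use X G_mem in auto)
  then have "\<forall>\<^sub>F n in sequentially. hnorm ip (G (X (r n))) < hnorm ip y + 1"
    by (rule order_tendstoD) simp
  moreover have "\<forall>\<^sub>F n in sequentially. hnorm ip y + 1 \<le> real n"
    using filterlim_real_sequentially by (simp add: filterlim_at_top)
  ultimately have "\<forall>\<^sub>F n in sequentially. False"
  proof eventually_elim
    case (elim n)
    have "real n \<le> real (r n)" using r by (simp add: seq_suble)
    also have "\<dots> < hnorm ip (G (X (r n))) * hnorm ip (X (r n))"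
      using X(3)[of "r n"] Cauchy_Schwarz[of "G (X (r n))" "X (r n)"] X(1) G_mem
        abs_ge_self[of "ip (G (X (r n))) (X (r n))"] by simp
    finally show ?case using elim \<open>\<And>n. hnorm ip (X n) = 1\<close> by simp
  qed
  then show False by simp
qed

text \<open>A maximiser of the Rayleigh quotient on \<open>V\<close>, found as the limit of a maximising sequence.\<close>

lemma exists_eigenvector:
  assumes V: "V \<subseteq> H" "subspace V" and inv: "\<And>x. x \<in> V \<Longrightarrow> G x \<in> V"
    and closed: "\<And>X x. (\<And>n::nat. X n \<in> V) \<Longrightarrow> x \<in> H \<Longrightarrow> (\<lambda>n. hnorm ip (X n - x)) \<longlonglongrightarrow> 0 \<Longrightarrow> x \<in> V"
    and x0: "x0 \<in> V" "x0 \<noteq> 0"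
  obtains e s where "e \<in> V" "ip e e = 1" "s > 0" "G e = s *\<^sub>R e"
proof -
  define Q where "Q = (\<lambda>x. ip (G x) x) ` {x \<in> V. ip x x = 1}"
  define s where "s = Sup Q"
  have VH: "x \<in> H" if "x \<in> V" for x using that V by auto
  have Q: "bdd_above Q"
    by (rule bdd_above_mono[OF bdd_above_quadratic_form]) (use VH in \<open>auto simp: Q_def\<close>)
  have normalize: "\<exists>x\<in>V. ip x x = 1 \<and> ip (G x) x = ip (G v) v / ip v v" if v: "v \<in> V" "v \<noteq> 0" for v
  proof (intro bexI[of _ "(1 / hnorm ip v) *\<^sub>R v"] conjI)
    have pos: "ip v v > 0" using v VH ip_nonneg[of v] ip_self_eq_0[of v] by fastforce
    have sq: "hnorm ip v * hnorm ip v = ip v v" using hnorm_square[of v] VH v by (simp add: power2_eq_square)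
    show "ip ((1 / hnorm ip v) *\<^sub>R v) ((1 / hnorm ip v) *\<^sub>R v) = 1"
      using pos v VH by (simp add: ip_simps sq)
    show "ip (G ((1 / hnorm ip v) *\<^sub>R v)) ((1 / hnorm ip v) *\<^sub>R v) = ip (G v) v / ip v v"
      using pos v VH G_mem by (simp add: ip_simps sq G_scaleR)
    show "(1 / hnorm ip v) *\<^sub>R v \<in> V" using V v by (simp add: subspace_mul)
  qed
  have Q_le: "ip (G v) v \<le> s * ip v v" if v: "v \<in> V" for v
  proof (cases "v = 0")
    case True
    then show ?thesis using G_mem[of 0] ip_0_left[of "0"] G_scaleR[of 0 0] by simp
  next
    case False
    then obtain x where x: "x \<in> V" "ip x x = 1" "ip (G x) x = ip (G v) v / ip v v"
      using normalize v by blast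
    then have "ip (G x) x \<in> Q" unfolding Q_def by blast
    then have "ip (G x) x \<le> s" unfolding s_def using Q by (rule cSup_upper)
    moreover have "ip v v > 0" using False v VH ip_nonneg[of v] ip_self_eq_0[of v] by fastforce
    ultimately show ?thesis using x by (simp add: field_simps)
  qed
  obtain x1 where x1: "x1 \<in> V" "ip x1 x1 = 1" using normalize[OF x0] by blast
  have "x1 \<noteq> 0" using x1 ip_0_left[of x1] VH by auto
  then have s: "s > 0" using Q_le[OF x1(1)] x1 G_positive[of x1] VH by simp
  \<comment> \<open>Cauchy-Schwarz for the form of \<open>G\<close>, applied to \<open>v\<close> and
    \<open>G v\<close>, and \<open>Q_le\<close> for \<open>G v\<close>, which is again in
    \<open>V\<close>; then the squared norm of \<open>G v\<close> is cancelled. This inequality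
    controls the residual below and, with \<open>Q_le\<close>, gives continuity of \<open>G\<close>
    on \<open>V\<close>.\<close>
  have GG_le: "ip (G v) (G v) \<le> s * ip (G v) v" if v: "v \<in> V" for v
  proof (cases "ip (G v) (G v) = 0")
    case True
    then show ?thesis using s G_nonneg VH v by simp
  next
    case False
    then have pos: "0 < ip (G v) (G v)" using ip_nonneg[of "G v"] G_mem VH v by fastforce
    have "(ip (G v) (G v))\<^sup>2 \<le> ip (G v) v * ip (G (G v)) (G v)"
      using G_Cauchy_Schwarz[of v "G v"] VH v G_mem by auto
    also have "\<dots> \<le> ip (G v) v * (s * ip (G v) (G v))"
      using Q_le[of "G v"] inv v VH G_nonneg by (intro mult_left_mono) auto
    finally have "ip (G v) (G v) * ip (G v) (G v) \<le> (s * ip (G v) v) * ip (G v) (G v)"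
      by (simp add: power2_eq_square algebra_simps)
    then show ?thesis using pos by (rule mult_right_le_imp_le)
  qed
  have "\<exists>x. x \<in> V \<and> ip x x = 1 \<and> s - 1 / real (Suc n) < ip (G x) x" for n
  proof -
    have "\<exists>q\<in>Q. s - 1 / real (Suc n) < q"
      unfolding s_def using x1 by (intro less_cSupD) (auto simp: Q_def)
    then show ?thesis by (auto simp: Q_def)
  qed
  then obtain X where X: "\<And>n. X n \<in> V" "\<And>n. ip (X n) (X n) = 1"
    "\<And>n. s - 1 / real (Suc n) < ip (G (X n)) (X n)" by metis
  then have "hnorm ip (X n) = 1" for n by (simp add: hnorm_def)
  then obtain r y where r: "strict_mono (r :: nat \<Rightarrow> nat)" and y: "y \<in> H"
    and lim: "(\<lambda>n. hnorm ip (G (X (r n)) - y)) \<longlonglongrightarrow> 0"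
    using G_compact[of X] X VH by auto
  \<comment> \<open>If \<open>G (Y n)\<close> tends to \<open>y\<close> and
    \<open>s *\<^sub>R Y n - G (Y n)\<close> tends to 0, the only possible limit of
    \<open>Y n\<close> is \<open>y / s\<close>.\<close>
  define e where "e = (1 / s) *\<^sub>R y"
  define Y where "Y n = X (r n)" for n
  have Y: "Y n \<in> V" "Y n \<in> H" "G (Y n) \<in> H" "ip (Y n) (Y n) = 1" for n
    using X VH G_mem by (auto simp: Y_def)
  have e: "e \<in> H" using y by (auto simp: e_def)
  \<comment> \<open>By \<open>GG_le\<close> the squared residual is at most
    \<open>s * (s - ip (G (Y n)) (Y n))\<close>, which is small because the sequence is
    maximising.\<close>
  have residual: "hnorm ip (s *\<^sub>R Y n - G (Y n)) \<le> sqrt (s * (1 / real (Suc n)))" for n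
    unfolding hnorm_def
  proof (rule real_sqrt_le_mono)
    have "ip (s *\<^sub>R Y n - G (Y n)) (s *\<^sub>R Y n - G (Y n)) =
        s * s - 2 * s * ip (G (Y n)) (Y n) + ip (G (Y n)) (G (Y n))"
      using Y[of n] by (simp add: ip_simps ip_commute[of "Y n" "G (Y n)"] algebra_simps)
    also have "\<dots> \<le> s * (s - ip (G (Y n)) (Y n))"
      using GG_le[OF Y(1), of n] by (simp add: algebra_simps)
    also have "\<dots> \<le> s * (1 / real (Suc n))"
    proof (rule mult_left_mono)
      have "1 / real (Suc (r n)) \<le> 1 / real (Suc n)"
        using seq_suble[OF r, of n] by (intro divide_left_mono) auto
      then show "s - ip (G (Y n)) (Y n) \<le> 1 / real (Suc n)"
        using X(3)[of "r n"] by (simp add: Y_def)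
    qed (use s in simp)
    finally show "ip (s *\<^sub>R Y n - G (Y n)) (s *\<^sub>R Y n - G (Y n)) \<le> s * (1 / real (Suc n))" .
  qed
  have "(\<lambda>n. hnorm ip (Y n - e)) \<longlonglongrightarrow> 0"
  proof (rule Lim_null_comparison)
    show "\<forall>\<^sub>F n in sequentially. norm (hnorm ip (Y n - e))
        \<le> (1 / s) * (sqrt (s * (1 / real (Suc n))) + hnorm ip (G (Y n) - y))"
    proof (intro always_eventually allI)
      fix n
      have scale: "hnorm ip ((1 / s) *\<^sub>R z) = (1 / s) * hnorm ip z" if "z \<in> H" for z
        using that s by (simp add: hnorm_def ip_simps real_sqrt_divide)
      have "Y n - e = (1 / s) *\<^sub>R ((s *\<^sub>R Y n - G (Y n)) + (G (Y n) - y))"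
        using s by (simp add: e_def scaleR_diff_right)
      then have "hnorm ip (Y n - e) = (1 / s) * hnorm ip ((s *\<^sub>R Y n - G (Y n)) + (G (Y n) - y))"
        using Y[of n] y by (simp only: scale mem_H)
      also have "\<dots> \<le> (1 / s) * (hnorm ip (s *\<^sub>R Y n - G (Y n)) + hnorm ip (G (Y n) - y))"
        using Y[of n] y s by (intro mult_left_mono hnorm_triangle) auto
      also have "\<dots> \<le> (1 / s) * (sqrt (s * (1 / real (Suc n))) + hnorm ip (G (Y n) - y))"
        using residual[of n] s by (intro mult_left_mono add_right_mono) auto
      finally show "norm (hnorm ip (Y n - e))
        \<le> (1 / s) * (sqrt (s * (1 / real (Suc n))) + hnorm ip (G (Y n) - y))"
        using hnorm_nonneg[of "Y n - e"] Y e by simp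
    qed
    have "(\<lambda>n. (1 / s) * (sqrt (s * (1 / real (Suc n))) + hnorm ip (G (Y n) - y))) \<longlonglongrightarrow>
        (1 / s) * (sqrt (s * 0) + 0)"
      using lim unfolding Y_def[symmetric] by (intro tendsto_intros LIMSEQ_Suc[OF lim_1_over_n])
    then show "(\<lambda>n. (1 / s) * (sqrt (s * (1 / real (Suc n))) + hnorm ip (G (Y n) - y))) \<longlonglongrightarrow> 0" by simp
  qed
  note Y_lim = this
  \<comment> \<open>\<open>G (Y n)\<close> tends to \<open>y\<close> by compactness and to
    \<open>G e\<close> because \<open>G\<close> is Lipschitz with constant \<open>s\<close> on
    \<open>V\<close>.\<close>
  have "G e = y"
  proof (rule limit_unique)
    show "(\<lambda>n. hnorm ip (G (Y n) - y)) \<longlonglongrightarrow> 0" using lim by (simp add: Y_def)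
    show "(\<lambda>n. hnorm ip (G (Y n) - G e)) \<longlonglongrightarrow> 0"
    proof (rule Lim_null_comparison)
      have eV: "e \<in> V" by (rule closed[OF Y(1) e Y_lim])
      show "\<forall>\<^sub>F n in sequentially. norm (hnorm ip (G (Y n) - G e)) \<le> s * hnorm ip (Y n - e)"
      proof (intro always_eventually allI)
        fix n
        have v: "Y n - e \<in> V" using V Y eV by (simp add: subspace_diff)
        have "ip (G (Y n - e)) (G (Y n - e)) \<le> s * (s * ip (Y n - e) (Y n - e))"
          using GG_le[OF v] mult_left_mono[OF Q_le[OF v], of s] s by linarith
        then have "hnorm ip (G (Y n - e)) \<le> sqrt (s * (s * ip (Y n - e) (Y n - e)))"
          unfolding hnorm_def by (rule real_sqrt_le_mono)
        also have "\<dots> = s * hnorm ip (Y n - e)" using s by (simp add: hnorm_def real_sqrt_mult)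
        finally show "norm (hnorm ip (G (Y n) - G e)) \<le> s * hnorm ip (Y n - e)"
          using Y e G_mem hnorm_nonneg[of "G (Y n) - G e"] by (simp add: G_diff)
      qed
      show "(\<lambda>n. s * hnorm ip (Y n - e)) \<longlonglongrightarrow> 0" using tendsto_mult_right_zero[OF Y_lim] .
    qed
  qed (use Y y e G_mem in auto)
  show ?thesis
  proof
    show "e \<in> V" by (rule closed[OF Y(1) e Y_lim])
    show "ip e e = 1"
      by (rule LIMSEQ_unique[OF tendsto_ip_self[OF Y_lim]]) (use Y e in auto)
    show "G e = s *\<^sub>R e" using \<open>G e = y\<close> s by (simp add: e_def)
  qed (rule s)
qed

text \<open>Take a maximal orthonormal set of eigenvectors. By symmetry its orthogonal complement is
  invariant under \<open>G\<close>, and it is closed; a nonzero vector in it would give a further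
  eigenvector there, contradicting maximality.\<close>

lemma exists_eigenbasis:
  obtains B mu where "hilbert_basis H ip B" "\<And>b. b \<in> B \<Longrightarrow> 0 < mu b" "\<And>b. b \<in> B \<Longrightarrow> G b = mu b *\<^sub>R b"
proof -
  define \<A> where "\<A> = {B. B \<subseteq> H \<and> (\<forall>b\<in>B. ip b b = 1 \<and> (\<exists>s>0. G b = s *\<^sub>R b)) \<and>
    (\<forall>b\<in>B. \<forall>c\<in>B. b \<noteq> c \<longrightarrow> ip b c = 0)}"
  have "\<exists>M\<in>\<A>. \<forall>X\<in>\<A>. M \<subseteq> X \<longrightarrow> X = M"
  proof (rule subset_Zorn')
    fix C assume C: "subset.chain \<A> C"
    have "ip b c = 0" if bc: "b \<in> \<Union> C" "c \<in> \<Union> C" "b \<noteq> c" for b c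
    proof -
      obtain X Y where XY: "X \<in> C" "b \<in> X" "Y \<in> C" "c \<in> Y" using bc by blast
      then have "X \<subseteq> Y \<or> Y \<subseteq> X" "X \<in> \<A>" "Y \<in> \<A>" using C unfolding subset_chain_def by auto
      then show ?thesis using XY bc(3) unfolding \<A>_def by blast
    qed
    moreover have "\<Union> C \<subseteq> H" "\<forall>b\<in>\<Union> C. ip b b = 1 \<and> (\<exists>s>0. G b = s *\<^sub>R b)"
    proof -
      have "X \<in> \<A>" if "X \<in> C" for X using C that by (auto simp: subset_chain_def)
      then have "X \<subseteq> H" "\<forall>b\<in>X. ip b b = 1 \<and> (\<exists>s>0. G b = s *\<^sub>R b)" if "X \<in> C" for X
        using that by (auto simp: \<A>_def)
      then show "\<Union> C \<subseteq> H" "\<forall>b\<in>\<Union> C. ip b b = 1 \<and> (\<exists>s>0. G b = s *\<^sub>R b)"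
        by blast+
    qed
    ultimately show "\<Union> C \<in> \<A>" unfolding \<A>_def by simp
  qed
  then obtain B where B: "B \<in> \<A>" and max: "\<And>X. X \<in> \<A> \<Longrightarrow> B \<subseteq> X \<Longrightarrow> X = B" by blast
  have BH: "b \<in> H" if "b \<in> B" for b using B that by (auto simp: \<A>_def)
  have total: "x = 0" if x: "x \<in> H" "\<And>b. b \<in> B \<Longrightarrow> ip x b = 0" for x
  proof (rule ccontr)
    assume "x \<noteq> 0"
    define V where "V = {v \<in> H. \<forall>b\<in>B. ip v b = 0}"
    obtain e s where e: "e \<in> V" "ip e e = 1" "s > 0" "G e = s *\<^sub>R e"
    proof (rule exists_eigenvector[of V x])
      show "V \<subseteq> H" "x \<in> V" "x \<noteq> 0" using x \<open>x \<noteq> 0\<close> by (auto simp: V_def)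
      show "subspace V"
        by (rule subspaceI) (auto simp: V_def ip_simps ip_0_left BH)
      show "G v \<in> V" if v: "v \<in> V" for v
      proof -
        have "ip (G v) b = 0" if b: "b \<in> B" for b
        proof -
          obtain t where "G b = t *\<^sub>R b" using B b unfolding \<A>_def by blast
          then show ?thesis using v b BH by (simp add: G_symmetric V_def ip_simps)
        qed
        then show ?thesis using v G_mem by (auto simp: V_def)
      qed
      show "v \<in> V" if X: "\<And>n::nat. X n \<in> V" and v: "v \<in> H" "(\<lambda>n. hnorm ip (X n - v)) \<longlonglongrightarrow> 0" for X v
      proof -
        have "ip v b = 0" if b: "b \<in> B" for b
        proof (rule LIMSEQ_unique)
          show "(\<lambda>n. ip (X n) b) \<longlonglongrightarrow> ip v b"
            by (rule tendsto_ip) (use X v b BH in \<open>auto simp: V_def\<close>)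
          show "(\<lambda>n. ip (X n) b) \<longlonglongrightarrow> 0" using X b by (simp add: V_def)
        qed
        then show ?thesis using v by (auto simp: V_def)
      qed
    qed
    have "insert e B \<in> \<A>"
    proof -
      have "B \<subseteq> H" "\<forall>b\<in>B. ip b b = 1 \<and> (\<exists>s>0. G b = s *\<^sub>R b)"
        "\<forall>b\<in>B. \<forall>c\<in>B. b \<noteq> c \<longrightarrow> ip b c = 0"
        using B by (simp_all add: \<A>_def)
      moreover have "e \<in> H" "\<forall>b\<in>B. ip e b = 0 \<and> ip b e = 0"
        using e(1) BH by (simp_all add: V_def ip_commute[of _ e])
      moreover have "\<exists>s>0. G e = s *\<^sub>R e" using e by blast
      ultimately show ?thesis using e(2) by (simp add: \<A>_def)
    qed
    then have "insert e B = B" by (rule max) auto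
    then have "e \<in> B" by blast
    then have "ip e e = 0" using e by (simp add: V_def)
    then show False using e by simp
  qed
  have "hilbert_basis H ip B"
    using B total by unfold_locales (auto simp: \<A>_def)
  moreover obtain mu where "\<And>b. b \<in> B \<Longrightarrow> 0 < mu b" "\<And>b. b \<in> B \<Longrightarrow> G b = mu b *\<^sub>R b"
  proof -
    have "\<forall>b\<in>B. \<exists>s. 0 < s \<and> G b = s *\<^sub>R b" using B by (auto simp: \<A>_def)
    then show ?thesis using that by metis
  qed
  ultimately show ?thesis using that by blast
qed

text \<open>With \<open>lam = 1 / mu\<close> the maximal domain is exactly the range of
  \<open>G\<close>: if the coefficients of \<open>f\<close> are \<open>lam\<close> times those of
  \<open>u\<close>, then \<open>u\<close> and \<open>G f\<close> have the same coefficients.\<close>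

lemma diagonal_inverse:
  assumes "\<And>f. f \<in> H \<Longrightarrow> A (G f) = f"
  obtains B lam where "diagonal_operator H ip B lam (G ` H) A"
proof -
  obtain B mu where "hilbert_basis H ip B" and mu: "\<And>b. b \<in> B \<Longrightarrow> 0 < mu b" "\<And>b. b \<in> B \<Longrightarrow> G b = mu b *\<^sub>R b"
    by (rule exists_eigenbasis) blast
  interpret hilbert_basis H ip B by fact
  have coeff_G: "ip (G f) b = mu b * ip f b" if "f \<in> H" "b \<in> B" for f b
    using that mu basis_mem by (simp add: G_symmetric ip_simps)
  have mu_nonzero: "mu b \<noteq> 0" if "b \<in> B" for b using mu(1)[OF that] by simp
  have "diagonal_operator H ip B (\<lambda>b. 1 / mu b) (G ` H) A"
  proof
    show "G ` H = {u \<in> H. \<exists>f\<in>H. \<forall>b\<in>B. ip f b = 1 / mu b * ip u b}"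
    proof (intro equalityI subsetI)
      fix u assume "u \<in> G ` H"
      then obtain f where "f \<in> H" "u = G f" by blast
      then show "u \<in> {u \<in> H. \<exists>f\<in>H. \<forall>b\<in>B. ip f b = 1 / mu b * ip u b}"
        using G_mem coeff_G mu_nonzero by (auto intro!: bexI[of _ f])
    next
      fix u assume "u \<in> {u \<in> H. \<exists>f\<in>H. \<forall>b\<in>B. ip f b = 1 / mu b * ip u b}"
      then obtain f where u: "u \<in> H" and f: "f \<in> H" "\<And>b. b \<in> B \<Longrightarrow> ip f b = 1 / mu b * ip u b" by blast
      have "u = G f"
        using u f G_mem by (intro eq_of_coefficients) (auto simp: coeff_G mu_nonzero)
      then show "u \<in> G ` H" using f by blast
    qed
  qed (use mu assms coeff_G mu_nonzero in \<open>auto simp: less_imp_le\<close>)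
  then show ?thesis by (rule that)
qed

lemma inverse_self_adjoint_generates:
  assumes "\<And>f. f \<in> H \<Longrightarrow> A (G f) = f"
  shows "self_adjoint H ip (G ` H) A" "non_negative ip (G ` H) A"
    "generates_contractive_analytic_semigroup H ip (pi / 2) (G ` H) (\<lambda>u. - A u)"
proof -
  obtain B lam where "diagonal_operator H ip B lam (G ` H) A"
    using diagonal_inverse[OF assms] by blast
  then show "self_adjoint H ip (G ` H) A" "non_negative ip (G ` H) A"
    "generates_contractive_analytic_semigroup H ip (pi / 2) (G ` H) (\<lambda>u. - A u)"
    by (rule diagonal_operator.self_adjoint_A diagonal_operator.non_negative_A
        diagonal_operator.generates_contractive_analytic)+
qed

end

section \<open>Test functions\<close>

definition smooth :: "(real \<Rightarrow> real) \<Rightarrow> bool" where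
  "smooth f \<longleftrightarrow> (\<forall>k x. (deriv ^^ k) f field_differentiable at x)"

text \<open>A set of differentiable functions closed under \<open>deriv\<close> consists of smooth
  functions. Exhibiting such a set replaces explicit formulas for higher derivatives of products and
  compositions.\<close>

lemma smooth_coinduct:
  assumes "f \<in> S" "\<And>g. g \<in> S \<Longrightarrow> (\<forall>x. g field_differentiable at x) \<and> deriv g \<in> S"
  shows "smooth f"
proof -
  have "(deriv ^^ k) f \<in> S" for k
    by (induction k) (use assms in auto)
  then show ?thesis using assms(2) by (auto simp: smooth_def)
qed

lemma smooth_field_differentiable: "smooth f \<Longrightarrow> f field_differentiable at x"
  unfolding smooth_def by (metis funpow_0)

lemma smooth_DERIV: "smooth f \<Longrightarrow> (f has_real_derivative deriv f x) (at x)"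
  using smooth_field_differentiable field_differentiable_derivI by blast

lemma smooth_deriv: "smooth f \<Longrightarrow> smooth (deriv f)"
  unfolding smooth_def by (metis funpow_swap1 funpow.simps(2) comp_apply)

lemma smooth_funpow_deriv: "smooth f \<Longrightarrow> smooth ((deriv ^^ k) f)"
  by (induction k) (auto simp: smooth_deriv)

lemma smooth_continuous: "smooth f \<Longrightarrow> continuous_on S f"
  by (meson smooth_DERIV DERIV_continuous continuous_at_imp_continuous_on)

lemma deriv_of_DERIV: "(\<And>x. (f has_real_derivative g x) (at x)) \<Longrightarrow> deriv f = g"
  by (intro ext DERIV_imp_deriv)

lemma smooth_lincomb:
  assumes "smooth f" "smooth g"
  shows "smooth (\<lambda>x. a * f x + b * g x)"
    and "(deriv ^^ k) (\<lambda>x. a * f x + b * g x) = (\<lambda>x. a * (deriv ^^ k) f x + b * (deriv ^^ k) g x)"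
proof -
  have D: "((\<lambda>x. a * f x + b * g x) has_real_derivative a * deriv f x + b * deriv g x) (at x)"
    if "smooth f" "smooth g" for f g x
    by (auto intro!: derivative_eq_intros smooth_DERIV that)
  show "smooth (\<lambda>x. a * f x + b * g x)"
  proof (rule smooth_coinduct[where S = "{\<lambda>x. a * f x + b * g x | f g. smooth f \<and> smooth g}"])
    fix h assume "h \<in> {\<lambda>x. a * f x + b * g x | f g. smooth f \<and> smooth g}"
    then obtain f g where h: "h = (\<lambda>x. a * f x + b * g x)" "smooth f" "smooth g" by blast
    then show "(\<forall>x. h field_differentiable at x) \<and>
        deriv h \<in> {\<lambda>x. a * f x + b * g x | f g. smooth f \<and> smooth g}"
      using D[OF h(2,3)] deriv_of_DERIV[OF D[OF h(2,3)]] smooth_deriv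
      unfolding field_differentiable_def by blast
  qed (use assms in blast)
  show "(deriv ^^ k) (\<lambda>x. a * f x + b * g x) = (\<lambda>x. a * (deriv ^^ k) f x + b * (deriv ^^ k) g x)"
    by (induction k) (use assms in \<open>auto simp: deriv_of_DERIV[OF D] smooth_funpow_deriv\<close>)
qed

text \<open>The derivative of a product is a sum of two products, so closing the products under
  addition gives a set that is stable under differentiation.\<close>

inductive_set product_span :: "(real \<Rightarrow> real) set" where
  product: "smooth f \<Longrightarrow> smooth g \<Longrightarrow> (\<lambda>x. f x * g x) \<in> product_span"
| plus: "u \<in> product_span \<Longrightarrow> v \<in> product_span \<Longrightarrow> (\<lambda>x. u x + v x) \<in> product_span"

lemma smooth_mult:
  assumes "smooth f" "smooth g"
  shows "smooth (\<lambda>x. f x * g x)"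
proof (rule smooth_coinduct)
  show "(\<lambda>x. f x * g x) \<in> product_span" using assms by (rule product)
  fix h assume "h \<in> product_span"
  then have "\<exists>h'\<in>product_span. \<forall>x. (h has_real_derivative h' x) (at x)"
  proof induction
    case (product f g)
    show ?case
    proof (intro bexI allI)
      show "((\<lambda>x. f x * g x) has_real_derivative deriv f x * g x + f x * deriv g x) (at x)" for x
        using product by (auto intro!: derivative_eq_intros smooth_DERIV)
      show "(\<lambda>x. deriv f x * g x + f x * deriv g x) \<in> product_span"
        using product by (intro product_span.intros smooth_deriv)
    qed
  next
    case (plus u v)
    then obtain u' v' where "u' \<in> product_span" "\<forall>x. (u has_real_derivative u' x) (at x)"
      "v' \<in> product_span" "\<forall>x. (v has_real_derivative v' x) (at x)" by blast
    then show ?case by (intro bexI[of _ "\<lambda>x. u' x + v' x"]) (auto intro: derivative_intros product_span.plus)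
  qed
  then show "(\<forall>x. h field_differentiable at x) \<and> deriv h \<in> product_span"
    unfolding field_differentiable_def using deriv_of_DERIV by blast
qed

lemma smooth_affine:
  assumes "smooth f"
  shows "smooth (\<lambda>x. f (m * x + c))"
\<comment> \<open>The free factor \<open>C\<close> absorbs the powers of \<open>m\<close> that the
  chain rule produces.\<close>
proof (rule smooth_coinduct[where S = "{\<lambda>x. C * f (m * x + c) | C f. smooth f}"])
  show "(\<lambda>x. f (m * x + c)) \<in> {\<lambda>x. C * f (m * x + c) | C f. smooth f}"
    using assms by (auto intro!: exI[of _ 1] exI[of _ f])
  fix h assume "h \<in> {\<lambda>x. C * f (m * x + c) | C f. smooth f}"
  then obtain C f where h: "h = (\<lambda>x. C * f (m * x + c))" and f: "smooth f" by blast
  have D: "(h has_real_derivative (C * m) * deriv f (m * x + c)) (at x)" for x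
    unfolding h by (auto intro!: derivative_eq_intros DERIV_chain2[OF smooth_DERIV[OF f]])
  show "(\<forall>x. h field_differentiable at x) \<and> deriv h \<in> {\<lambda>x. C * f (m * x + c) | C f. smooth f}"
    using D deriv_of_DERIV[OF D] smooth_deriv[OF f] unfolding field_differentiable_def by blast
qed

text \<open>The classical function that is flat at 0. The polynomial factor makes the family for
  fixed \<open>e\<close> closed under differentiation.\<close>

definition exp_tail :: "real \<Rightarrow> real poly \<Rightarrow> real \<Rightarrow> real" where
  "exp_tail e p x = (if 0 < x then poly p (1 / x) * exp (- e / x) else 0)"

lemma poly_exp_tendsto_0:
  fixes p :: "real poly"
  assumes "e > 0"
  shows "((\<lambda>t. poly p t * exp (- e * t)) \<longlongrightarrow> 0) at_top"
proof -
  have "((\<lambda>t. t ^ k * exp (- e * t)) \<longlongrightarrow> 0) at_top" for k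
  proof -
    have "filterlim (\<lambda>t. e * t) at_top at_top"
      using assms by (rule filterlim_tendsto_pos_mult_at_top[OF tendsto_const _ filterlim_ident])
    from filterlim_compose[OF tendsto_power_div_exp_0 this]
    have "((\<lambda>t. (1 / e) ^ k * ((e * t) ^ k / exp (e * t))) \<longlongrightarrow> (1 / e) ^ k * 0) at_top"
      by (intro tendsto_mult tendsto_const)
    then show ?thesis
      using assms by (simp add: exp_minus field_simps)
  qed
  then have "((\<lambda>t. \<Sum>k\<le>degree p. coeff p k * (t ^ k * exp (- e * t))) \<longlongrightarrow> (\<Sum>k\<le>degree p. coeff p k * 0)) at_top"
    by (intro tendsto_intros)
  then show ?thesis by (simp add: poly_altdef sum_distrib_right mult.assoc)
qed

text \<open>With \<open>t = 1 / x\<close>, differentiation in \<open>x\<close> is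
  \<open>- t^2\<close> times differentiation in \<open>t\<close>, which explains the new polynomial.
  At 0 the difference quotient from the right is again a polynomial in \<open>t\<close> times
  \<open>exp (- e * t)\<close> and tends to 0.\<close>

lemma exp_tail_DERIV:
  assumes e: "e > 0"
  shows "(exp_tail e p has_real_derivative exp_tail e ([:0, 0, 1:] * (smult e p - pderiv p)) x) (at x)"
proof -
  consider "x < 0" | "x = 0" | "x > 0" by linarith
  then show ?thesis
  proof cases
    case 1
    have "((\<lambda>x. 0) has_real_derivative 0) (at x)" by simp
    moreover have "\<forall>\<^sub>F y in nhds x. exp_tail e p y = 0"
      using eventually_nhds_in_open[of "{..<0}" x] 1
      by (auto simp: exp_tail_def elim!: eventually_mono)
    ultimately have "(exp_tail e p has_real_derivative 0) (at x)"
      by (subst DERIV_cong_ev[OF refl _ refl])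
    then show ?thesis using 1 by (simp add: exp_tail_def)
  next
    case 3
    have "((\<lambda>x. poly p (1 / x) * exp (- e / x)) has_real_derivative
        poly ([:0, 0, 1:] * (smult e p - pderiv p)) (1 / x) * exp (- e / x)) (at x)"
      using 3 by (auto intro!: derivative_eq_intros poly_DERIV[THEN DERIV_chain2] simp: field_simps power2_eq_square)
    moreover have "\<forall>\<^sub>F y in nhds x. exp_tail e p y = poly p (1 / y) * exp (- e / y)"
      using eventually_nhds_in_open[of "{0<..}" x] 3
      by (auto simp: exp_tail_def elim!: eventually_mono)
    ultimately have "(exp_tail e p has_real_derivative
        poly ([:0, 0, 1:] * (smult e p - pderiv p)) (1 / x) * exp (- e / x)) (at x)"
      by (subst DERIV_cong_ev[OF refl _ refl])
    then show ?thesis using 3 by (simp add: exp_tail_def)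
  next
    case 2
    have "((\<lambda>x. exp_tail e p x / x) \<longlongrightarrow> 0) (at 0)"
    proof (rule filterlim_split_at)
      show "((\<lambda>x. exp_tail e p x / x) \<longlongrightarrow> 0) (at_left 0)"
        by (rule tendsto_eventually) (auto simp: eventually_at_filter exp_tail_def)
      have "((\<lambda>x. poly (pCons 0 p) (inverse x) * exp (- e * inverse x)) \<longlongrightarrow> 0) (at_right 0)"
        by (rule filterlim_compose[OF poly_exp_tendsto_0[OF e] filterlim_inverse_at_top_right])
      moreover have "\<forall>\<^sub>F x in at_right 0. poly (pCons 0 p) (inverse x) * exp (- e * inverse x) = exp_tail e p x / x"
        by (auto simp: eventually_at_filter exp_tail_def field_simps)
      ultimately show "((\<lambda>x. exp_tail e p x / x) \<longlongrightarrow> 0) (at_right 0)" by (rule Lim_transform_eventually)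
    qed
    then show ?thesis using 2 by (simp add: has_field_derivative_iff exp_tail_def)
  qed
qed

lemma smooth_exp_tail: "e > 0 \<Longrightarrow> smooth (exp_tail e p)"
  by (rule smooth_coinduct[where S = "range (exp_tail e)"])
    (auto simp: deriv_of_DERIV[OF exp_tail_DERIV] field_differentiable_def intro: exp_tail_DERIV)

text \<open>As \<open>e\<close> tends to 0 from above, this tends pointwise to the indicator of the
  open interval from \<open>c\<close> to \<open>d\<close> while staying between 0 and 1. The
  arguments are written in the shape expected by \<open>smooth_affine\<close>.\<close>

definition bump :: "real \<Rightarrow> real \<Rightarrow> real \<Rightarrow> real \<Rightarrow> real" where
  "bump e c d x = exp_tail e 1 (1 * x + - c) * exp_tail e 1 (- 1 * x + d)"

lemma bump_eq: "bump e c d x = (if c < x \<and> x < d then exp (- e / (x - c)) * exp (- e / (d - x)) else 0)"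
  by (simp add: bump_def exp_tail_def)

lemma bump_bounds:
  assumes "e > 0"
  shows "0 \<le> bump e c d x" "bump e c d x \<le> 1"
proof -
  show "0 \<le> bump e c d x" by (simp add: bump_eq)
  have "exp (- e / (x - c)) * exp (- e / (d - x)) \<le> 1 * 1" if "c < x" "x < d"
    using assms that by (intro mult_mono) (auto simp: divide_nonpos_pos)
  then show "bump e c d x \<le> 1" by (simp add: bump_eq)
qed

section \<open>Supports and antiderivatives of test functions\<close>

lemma smooth_test_fun: "test_fun \<phi> \<Longrightarrow> smooth \<phi>"
  by (simp add: test_fun_def smooth_def)

lemma test_funI:
  "smooth \<phi> \<Longrightarrow> 0 < c \<Longrightarrow> d < 1 \<Longrightarrow> (\<And>x. x < c \<or> d < x \<Longrightarrow> \<phi> x = 0) \<Longrightarrow> test_fun \<phi>"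
  unfolding test_fun_def smooth_def by (intro conjI exI[of _ "{c..d}"]) auto

lemma test_fun_support:
  assumes "test_fun \<phi>"
  obtains c d where "0 < c" "c < d" "d < 1" "\<And>x. x \<le> c \<or> d \<le> x \<Longrightarrow> \<phi> x = 0"
proof -
  obtain K where K: "compact K" "K \<subseteq> {0<..<1}" "\<And>x. x \<notin> K \<Longrightarrow> \<phi> x = 0"
    using assms by (auto simp: test_fun_def)
  show ?thesis
  proof (cases "K = {}")
    case True
    then show ?thesis using K that[of "1/3" "2/3"] by auto
  next
    case False
    obtain l u where l: "l \<in> K" "\<And>x. x \<in> K \<Longrightarrow> l \<le> x" and u: "u \<in> K" "\<And>x. x \<in> K \<Longrightarrow> x \<le> u"
      using compact_attains_inf[OF K(1) False] compact_attains_sup[OF K(1) False] by blast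
    have lu: "0 < l" "l \<le> u" "u < 1" using K l u by auto
    \<comment> \<open>Going half way from the extreme points of \<open>K\<close> towards 0 and 1
      ensures \<open>c < d\<close> even if \<open>K\<close> is a single point, and makes the
      function vanish at \<open>c\<close> and \<open>d\<close> themselves.\<close>
    show ?thesis
      by (rule that[of "l / 2" "(u + 1) / 2"]) (use lu K(3) l(2) u(2) in \<open>auto, force+\<close>)
  qed
qed

lemma test_fun_bump: "0 < c \<Longrightarrow> d < 1 \<Longrightarrow> e > 0 \<Longrightarrow> test_fun (bump e c d)"
proof (rule test_funI[of _ c d])
  show "smooth (bump e c d)" if "e > 0"
    unfolding bump_def[abs_def] by (intro smooth_mult smooth_affine smooth_exp_tail that)
qed (auto simp: bump_eq)

lemma test_fun_lincomb:
  assumes "test_fun f" "test_fun g"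
  shows "test_fun (\<lambda>x. a * f x + b * g x)"
proof -
  obtain c d c' d' where "0 < c" "d < 1" "\<And>x. x \<le> c \<or> d \<le> x \<Longrightarrow> f x = 0"
    "0 < c'" "d' < 1" "\<And>x. x \<le> c' \<or> d' \<le> x \<Longrightarrow> g x = 0"
    using assms by (metis test_fun_support)
  note cd = this
  show ?thesis
  proof (rule test_funI[of _ "min c c'" "max d d'"])
    show "smooth (\<lambda>x. a * f x + b * g x)" by (intro smooth_lincomb smooth_test_fun assms)
    fix x assume "x < min c c' \<or> max d d' < x"
    then have "f x = 0" "g x = 0" using cd(3,6) by fastforce+
    then show "a * f x + b * g x = 0" by simp
  qed (use cd in auto)
qed

lemma test_fun_deriv:
  assumes "test_fun f"
  shows "test_fun (deriv f)"
proof -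
  obtain c d where cd: "0 < c" "d < 1" "\<And>x. x \<le> c \<or> d \<le> x \<Longrightarrow> f x = 0"
    using assms by (metis test_fun_support)
  show ?thesis
  proof (rule test_funI[OF smooth_deriv[OF smooth_test_fun[OF assms]] cd(1,2)])
    fix x assume x: "x < c \<or> d < x"
    have "\<forall>\<^sub>F y in nhds x. f y = 0"
      using eventually_nhds_in_open[OF open_Un[OF open_lessThan open_greaterThan], of x c d] x
      by (auto elim!: eventually_mono intro!: cd(3))
    then have "(f has_real_derivative 0) (at x)"
      using DERIV_cong_ev[of x x f "\<lambda>_. 0" 0 0] by simp
    then show "deriv f x = 0" by (rule DERIV_imp_deriv)
  qed
qed

lemma test_fun_funpow_deriv: "test_fun f \<Longrightarrow> test_fun ((deriv ^^ k) f)"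
  by (induction k) (auto simp: test_fun_deriv)

text \<open>The primitive vanishing on the left of the support is constant on its right, and the
  constant is the integral of \<open>f\<close>.\<close>

lemma test_fun_antiderivative:
  assumes f: "test_fun f" and int_0: "integral {0..1} f = 0"
  obtains g where "test_fun g" "deriv g = f"
proof -
  obtain c d where cd: "0 < c" "c < d" "d < 1" "\<And>x. x \<le> c \<or> d \<le> x \<Longrightarrow> f x = 0"
    using f by (rule test_fun_support) blast
  have cont: "continuous_on S f" for S using f by (intro smooth_continuous smooth_test_fun)
  have int: "f integrable_on {a..b}" for a b using cont by (rule integrable_continuous_real)
  \<comment> \<open>Starting at -1 makes all points of the support interior to the interval from -1
    to 2, so the derivative obtained there is two-sided.\<close>
  define g where "g x = integral {-1..x} f" for x
  have g0: "g x = 0" if "x < c" for x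
    unfolding g_def using cd that by (intro integral_unique has_integral_is_0) auto
  have "integral {-1..0} f = 0" "integral {d..1} f = 0"
    using cd by (intro integral_unique has_integral_is_0; auto)+
  moreover have "integral {-1..0} f + integral {0..1} f = integral {-1..1} f"
    by (rule Henstock_Kurzweil_Integration.integral_combine) (use int in auto)
  moreover have "integral {-1..d} f + integral {d..1} f = integral {-1..1} f"
    by (rule Henstock_Kurzweil_Integration.integral_combine) (use int cd in auto)
  ultimately have "integral {-1..d} f = 0" using int_0 by simp
  moreover have "integral {-1..d} f + integral {d..x} f = g x" if "d < x" for x
    unfolding g_def by (rule Henstock_Kurzweil_Integration.integral_combine) (use int cd that in auto)
  moreover have "integral {d..x} f = 0" for x
    using cd by (intro integral_unique has_integral_is_0) auto
  ultimately have g1: "g x = 0" if "d < x" for x using that by fastforce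
  have D: "(g has_real_derivative f x) (at x)" for x
  proof (cases "x < c \<or> d < x")
    case True
    have "\<forall>\<^sub>F y in nhds x. g y = 0"
      using eventually_nhds_in_open[OF open_Un[OF open_lessThan open_greaterThan], of x c d] True
      by (auto elim!: eventually_mono intro: g0 g1)
    then have "(g has_real_derivative 0) (at x)"
      using DERIV_cong_ev[of x x g "\<lambda>_. 0" 0 0] by simp
    then show ?thesis using True cd by auto
  next
    case False
    then have "x \<in> {-1<..<2}" using cd by auto
    moreover have "(g has_real_derivative f x) (at x within {-1..2})"
      unfolding g_def using False cd by (intro integral_has_real_derivative cont) auto
    ultimately show ?thesis by (metis at_within_Icc_at greaterThanLessThan_iff)
  qed
  have "smooth g"
    by (rule smooth_coinduct[where S = "insert g {f. smooth f}"])
      (use D deriv_of_DERIV[OF D] smooth_test_fun[OF f] smooth_deriv smooth_field_differentiable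
        in \<open>auto simp: field_differentiable_def\<close>)
  then have "test_fun g" using cd g0 g1 by (intro test_funI[of _ c d]) auto
  then show ?thesis using that deriv_of_DERIV[OF D] by blast
qed

section \<open>The fundamental lemma of the calculus of variations\<close>

lemma integrable_lebesgue_on_iff:
  fixes f :: "real \<Rightarrow> real"
  assumes "S \<in> sets lebesgue"
  shows "integrable (lebesgue_on S) f \<longleftrightarrow> integrable lebesgue (\<lambda>x. indicator S x * f x)"
  using assms by (simp add: integrable_restrict_space)

lemma integral_lebesgue_on_eq:
  fixes f :: "real \<Rightarrow> real"
  assumes "S \<in> sets lebesgue"
  shows "integral\<^sup>L (lebesgue_on S) f = (LINT x|lebesgue. indicator S x * f x)"
  using assms by (simp add: integral_restrict_space)

lemma integrable_lebesgue_on_subset: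
  fixes f :: "real \<Rightarrow> real"
  assumes "integrable (lebesgue_on S) f" "S \<in> sets lebesgue" "T \<in> sets lebesgue" "T \<subseteq> S"
  shows "integrable (lebesgue_on T) f"
proof -
  have "integrable lebesgue (\<lambda>x. indicator T x *\<^sub>R (indicator S x * f x))"
    using assms by (intro integrable_mult_indicator) (auto simp: integrable_lebesgue_on_iff)
  moreover have "(\<lambda>x. indicator T x *\<^sub>R (indicator S x * f x)) = (\<lambda>x. indicator T x * f x)"
    using assms(4) by (auto simp: indicator_def fun_eq_iff)
  ultimately show ?thesis using assms by (simp add: integrable_lebesgue_on_iff)
qed

lemma continuous_on_unit_ivl:
  fixes f :: "real \<Rightarrow> real"
  assumes "continuous_on {0..1} f"
  shows "integrable unit_ivl f" "(LINT x|unit_ivl. f x) = integral {0..1} f"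
proof -
  show int: "integrable unit_ivl f"
    by (rule integrable_lebesgue_on_subset[OF continuous_imp_integrable_real[OF assms]]) auto
  show "(LINT x|unit_ivl. f x) = integral {0..1} f"
    using lebesgue_integral_eq_integral[OF int] by (simp add: integral_open_interval_real)
qed

definition locally_integrable :: "(real \<Rightarrow> real) \<Rightarrow> bool" where
  "locally_integrable w \<longleftrightarrow> (\<forall>K. compact K \<and> K \<subseteq> {0<..<1} \<longrightarrow> integrable (lebesgue_on K) w)"

lemma locally_integrable_of_integrable:
  "integrable unit_ivl w \<Longrightarrow> locally_integrable w"
  unfolding locally_integrable_def
  by (auto intro!: integrable_lebesgue_on_subset[of "{0<..<1}"] fmeasurableD lmeasurable_compact)

lemma locally_integrable_diff:
  "locally_integrable v \<Longrightarrow> locally_integrable w \<Longrightarrow> locally_integrable (\<lambda>x. v x - w x)"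
  unfolding locally_integrable_def by auto

lemma test_fun_continuous: "test_fun \<phi> \<Longrightarrow> continuous_on S \<phi>"
  by (intro smooth_continuous smooth_test_fun)

lemma integrable_mult_test_fun:
  assumes w: "locally_integrable w" and \<phi>: "test_fun \<phi>"
  shows "integrable unit_ivl (\<lambda>x. w x * \<phi> x)"
proof -
  obtain c d where cd: "0 < c" "c < d" "d < 1" "\<And>x. x \<le> c \<or> d \<le> x \<Longrightarrow> \<phi> x = 0"
    using \<phi> by (rule test_fun_support) blast
  have "compact (\<phi> ` {c..d})" using test_fun_continuous[OF \<phi>] by (intro compact_continuous_image) auto
  then obtain M where M: "\<And>x. x \<in> {c..d} \<Longrightarrow> \<bar>\<phi> x\<bar> \<le> M"
    using compact_imp_bounded[THEN bounded_iff[THEN iffD1]] by fastforce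
  have int: "integrable (lebesgue_on {c..d}) w"
    using w[unfolded locally_integrable_def, rule_format, of "{c..d}"] cd
    by (simp add: subset_iff)
  have "integrable (lebesgue_on {c..d}) (\<lambda>x. w x * \<phi> x)"
  proof (rule Bochner_Integration.integrable_bound)
    show "integrable (lebesgue_on {c..d}) (\<lambda>x. M * w x)" using int by simp
    show "(\<lambda>x. w x * \<phi> x) \<in> borel_measurable (lebesgue_on {c..d})"
      using int
      by (intro borel_measurable_times borel_measurable_integrable
          continuous_imp_measurable_on_sets_lebesgue test_fun_continuous[OF \<phi>]) auto
    show "AE x in lebesgue_on {c..d}. norm (w x * \<phi> x) \<le> norm (M * w x)"
    proof (rule AE_I2)
      fix x assume "x \<in> space (lebesgue_on {c..d})"
      then have "\<bar>\<phi> x\<bar> \<le> \<bar>M\<bar>" using M[of x] by simp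
      then show "norm (w x * \<phi> x) \<le> norm (M * w x)"
        by (simp add: abs_mult mult.commute[of "\<bar>w x\<bar>"] mult_right_mono)
    qed
  qed
  moreover have "indicator {c..d} x * (w x * \<phi> x) = indicator {0<..<1} x * (w x * \<phi> x)" for x
    using cd(1-3) cd(4)[of x] by (cases "c < x \<and> x < d") (auto simp: indicator_def)
  ultimately show ?thesis by (simp add: integrable_lebesgue_on_iff)
qed

text \<open>The positive and negative parts of \<open>f\<close> are densities of two finite measures
  that agree on half-lines and hence on all Borel sets; equal measures have densities equal almost
  everywhere.\<close>

lemma AE_eq_0_of_half_lines:
  fixes f :: "real \<Rightarrow> real"
  assumes f: "integrable lborel f" and zero: "\<And>x. (LINT y|lborel. indicator {x<..} y * f y) = 0"
  shows "AE y in lborel. f y = 0"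
proof -
  have [measurable]: "f \<in> borel_measurable borel" using f by auto
  define M where "M g = density lborel (\<lambda>y. ennreal (g y))" for g :: "real \<Rightarrow> real"
  have emeasure_M: "emeasure (M g) {x<..} = ennreal (LINT y|lborel. indicator {x<..} y * g y)"
    if g: "integrable lborel g" "\<And>y. 0 \<le> g y" for g x
  proof -
    have [measurable]: "g \<in> borel_measurable borel" using g by auto
    have "integrable lborel (\<lambda>y. indicator {x<..} y *\<^sub>R g y)"
      using g by (intro integrable_mult_indicator) auto
    then have "ennreal (LINT y|lborel. indicator {x<..} y * g y) =
        (\<integral>\<^sup>+y. ennreal (indicator {x<..} y * g y) \<partial>lborel)"
      using g by (intro nn_integral_eq_integral[symmetric]) auto
    also have "\<dots> = (\<integral>\<^sup>+y. ennreal (g y) * indicator {x<..} y \<partial>lborel)"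
      by (intro nn_integral_cong) (auto simp: indicator_def)
    finally show ?thesis by (simp add: M_def emeasure_density)
  qed
  define p where "p y = max 0 (f y)" for y
  define n where "n y = max 0 (- f y)" for y
  have pn: "integrable lborel p" "integrable lborel n" "\<And>y. 0 \<le> p y" "\<And>y. 0 \<le> n y"
    unfolding p_def n_def using f by auto
  have meas [measurable]: "p \<in> borel_measurable borel" "n \<in> borel_measurable borel"
    unfolding p_def n_def by auto
  have "M p = M n"
  proof (rule measure_eqI_lessThan)
    fix x
    show "emeasure (M p) {x<..} < \<infinity>" using pn by (simp add: emeasure_M)
    have "integrable lborel (\<lambda>y. indicator {x<..} y *\<^sub>R p y)" "integrable lborel (\<lambda>y. indicator {x<..} y *\<^sub>R n y)"
      using pn by (intro integrable_mult_indicator; simp)+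
    then have "(LINT y|lborel. indicator {x<..} y * p y) - (LINT y|lborel. indicator {x<..} y * n y) =
        (LINT y|lborel. indicator {x<..} y * p y - indicator {x<..} y * n y)"
      by (intro Bochner_Integration.integral_diff[symmetric]) auto
    also have "\<dots> = (LINT y|lborel. indicator {x<..} y * f y)"
      by (intro Bochner_Integration.integral_cong) (auto simp: p_def n_def indicator_def)
    finally show "emeasure (M p) {x<..} = emeasure (M n) {x<..}"
      using pn zero by (simp add: emeasure_M)
  qed (auto simp: M_def)
  then have "AE y in lborel. ennreal (p y) = ennreal (n y)"
    unfolding M_def
    by (subst (asm) sigma_finite_measure.density_unique_iff[OF sigma_finite_lborel]) auto
  then show ?thesis
    by eventually_elim (use pn in \<open>auto simp: p_def n_def max_def split: if_splits\<close>)
qed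

text \<open>A Borel representative of \<open>f\<close> carries the previous lemma over to the
  completed measure.\<close>

lemma AE_lebesgue_eq_0_of_half_lines:
  fixes f :: "real \<Rightarrow> real"
  assumes f: "integrable lebesgue f" and zero: "\<And>x. (LINT y|lebesgue. indicator {x<..} y * f y) = 0"
  shows "AE y in lebesgue. f y = 0"
proof -
  obtain g where g: "g \<in> borel_measurable lborel" "AE x in lborel. f x = g x"
    using completion_ex_borel_measurable_real[of f lborel] f by auto
  have ae: "AE x in lebesgue. f x = g x" using g(2) by (rule AE_completion)
  have [measurable]: "g \<in> borel_measurable borel" using g by simp
  have g_leb: "g \<in> borel_measurable lebesgue" using g(1) by (rule measurable_completion)
  have "AE y in lborel. g y = 0"
  proof (rule AE_eq_0_of_half_lines)
    have "integrable lebesgue g" using f g_leb ae by (rule integrable_cong_AE_imp)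
    then show "integrable lborel g" using g(1) by (simp add: integrable_completion)
    fix x :: real
    have ind: "(\<lambda>y. indicator {x<..} y :: real) \<in> borel_measurable lebesgue"
      by (intro borel_measurable_indicator sets_completionI_sets) simp
    have "(LINT y|lborel. indicator {x<..} y * g y) = (LINT y|lebesgue. indicator {x<..} y * g y)"
      by (intro integral_completion[symmetric]) measurable
    also have "\<dots> = (LINT y|lebesgue. indicator {x<..} y * f y)"
      by (rule integral_cong_AE) (use f g_leb ae ind in \<open>auto elim!: eventually_mono\<close>)
    finally show "(LINT y|lborel. indicator {x<..} y * g y) = 0" using zero by simp
  qed
  then have "AE y in lebesgue. g y = 0" by (rule AE_completion)
  with ae show ?thesis by eventually_elim simp
qed

text \<open>Bumps with parameter tending to 0 converge boundedly to the indicator of an interval, so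
  \<open>w\<close> has integral 0 over every interval strictly inside. A half-line cuts such an
  interval in another one, so \<open>w\<close> vanishes almost everywhere there, and countably many
  of them exhaust the unit interval.\<close>

lemma fundamental_lemma:
  assumes w: "locally_integrable w"
    and zero: "\<And>\<phi>. test_fun \<phi> \<Longrightarrow> (LINT x|unit_ivl. w x * \<phi> x) = 0"
  shows "AE x in unit_ivl. w x = 0"
proof -
  have int: "integrable lebesgue (\<lambda>x. indicator {c<..<d} x * w x)" if "0 < c" "d < 1" for c d
  proof -
    have "integrable (lebesgue_on {c..d}) w"
      using w[unfolded locally_integrable_def, rule_format, of "{c..d}"] that
      by (simp add: subset_iff)
    then have "integrable (lebesgue_on {c<..<d}) w"
      by (rule integrable_lebesgue_on_subset) auto
    then show ?thesis by (simp add: integrable_lebesgue_on_iff)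
  qed
  have interval: "(LINT x|lebesgue. indicator {c<..<d} x * w x) = 0" if cd: "0 < c" "d < 1" for c d
  proof (rule LIMSEQ_unique)
    define s where "s n x = indicator {0<..<1} x * (w x * bump (1 / real (Suc n)) c d x)" for n x
    have test: "test_fun (bump (1 / real (Suc n)) c d)" for n using cd by (intro test_fun_bump) auto
    show "(\<lambda>n. LINT x|lebesgue. s n x) \<longlonglongrightarrow> (LINT x|lebesgue. indicator {c<..<d} x * w x)"
    proof (rule integral_dominated_convergence)
      have "integrable lebesgue (\<lambda>x. indicator {c<..<d} x * w x)" by (rule int[OF cd])
      then show "integrable lebesgue (\<lambda>x. norm (indicator {c<..<d} x * w x))" by (rule integrable_norm)
      show "(\<lambda>x. indicator {c<..<d} x * w x) \<in> borel_measurable lebesgue" using int[OF cd] by auto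
      show "s n \<in> borel_measurable lebesgue" for n
        using integrable_mult_test_fun[OF w test] unfolding s_def
        by (simp add: integrable_lebesgue_on_iff borel_measurable_integrable)
      show "AE x in lebesgue. norm (s n x) \<le> norm (indicator {c<..<d} x * w x)" for n
      proof (rule AE_I2)
        fix x
        show "norm (s n x) \<le> norm (indicator {c<..<d} x * w x)"
          using bump_bounds[of "1 / real (Suc n)" c d x] cd
            mult_left_mono[of "bump (1 / real (Suc n)) c d x" 1 "\<bar>w x\<bar>"]
          by (auto simp: s_def abs_mult indicator_def bump_eq)
      qed
      show "AE x in lebesgue. (\<lambda>n. s n x) \<longlonglongrightarrow> indicator {c<..<d} x * w x"
      proof (rule AE_I2)
        fix x
        show "(\<lambda>n. s n x) \<longlonglongrightarrow> indicator {c<..<d} x * w x"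
        proof (cases "x \<in> {c<..<d}")
          case True
          have "(\<lambda>n. w x * (exp (- (1 / real (Suc n)) / (x - c)) * exp (- (1 / real (Suc n)) / (d - x))))
              \<longlonglongrightarrow> w x * (exp (- 0 / (x - c)) * exp (- 0 / (d - x)))"
            using True by (intro tendsto_intros LIMSEQ_Suc[OF lim_1_over_n]) auto
          then show ?thesis using True cd by (simp add: s_def bump_eq)
        next
          case False
          then show ?thesis by (auto simp: s_def bump_eq)
        qed
      qed
    qed
    have "(LINT x|lebesgue. s n x) = 0" for n
      using zero[OF test, of n] by (simp add: s_def integral_lebesgue_on_eq)
    then show "(\<lambda>n. LINT x|lebesgue. s n x) \<longlonglongrightarrow> 0" by simp
  qed
  have "AE x in lebesgue. indicator {c<..<d} x * w x = 0" if cd: "0 < c" "d < 1" for c d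
  proof (rule AE_lebesgue_eq_0_of_half_lines[OF int[OF cd]])
    fix x
    have "(\<lambda>y. indicator {x<..} y * (indicator {c<..<d} y * w y)) = (\<lambda>y. indicator {max x c<..<d} y * w y)"
      by (auto simp: indicator_def)
    then show "(LINT y|lebesgue. indicator {x<..} y * (indicator {c<..<d} y * w y)) = 0"
      using interval[of "max x c" d] cd by simp
  qed
  then have "AE x in lebesgue. indicator {1 / real (n + 2)<..<1 - 1 / real (n + 2)} x * w x = 0" for n
    by simp
  then have "AE x in lebesgue. \<forall>n. indicator {1 / real (n + 2)<..<1 - 1 / real (n + 2)} x * w x = 0"
    by (intro AE_all_countable[THEN iffD2] allI)
  then have "AE x in lebesgue. x \<in> {0<..<1} \<longrightarrow> w x = 0"
  proof eventually_elim
    case (elim x)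
    show ?case
    proof
      assume x: "x \<in> {0<..<1}"
      obtain n where "1 / real (Suc n) < min x (1 - x)"
        using nat_approx_posE[of "min x (1 - x)"] x by auto
      moreover have "1 / real (n + 2) \<le> 1 / real (Suc n)" by (simp add: field_simps)
      ultimately have "x \<in> {1 / real (n + 2)<..<1 - 1 / real (n + 2)}" by auto
      then show "w x = 0" using elim[rule_format, of n] by simp
    qed
  qed
  then show ?thesis by (subst AE_restrict_space_iff) auto
qed

section \<open>Integration by parts and the lemma of du Bois-Reymond\<close>

lemma integral_by_parts_test_fun:
  assumes w: "\<And>x. x \<in> {0..1} \<Longrightarrow> (w has_real_derivative w' x) (at x within {0..1})"
    and cont: "continuous_on {0..1} w'" and \<phi>: "test_fun \<phi>"
  shows "(LINT x|unit_ivl. w x * deriv \<phi> x) = - (LINT x|unit_ivl. w' x * \<phi> x)"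
proof -
  have cont_w: "continuous_on {0..1} w" using w by (rule DERIV_continuous_on)
  note c = cont cont_w test_fun_continuous[OF \<phi>] test_fun_continuous[OF test_fun_deriv[OF \<phi>]]
  have cont_products: "continuous_on {0..1} (\<lambda>x. w x * deriv \<phi> x)" "continuous_on {0..1} (\<lambda>x. w' x * \<phi> x)"
    by (intro continuous_intros c)+
  have "((\<lambda>x. w x * deriv \<phi> x + w' x * \<phi> x) has_integral (w 1 * \<phi> 1 - w 0 * \<phi> 0)) {0..1}"
  proof (rule fundamental_theorem_of_calculus)
    fix x :: real assume "x \<in> {0..1}"
    then show "((\<lambda>x. w x * \<phi> x) has_vector_derivative w x * deriv \<phi> x + w' x * \<phi> x) (at x within {0..1})"
      unfolding has_real_derivative_iff_has_vector_derivative[symmetric]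
      by (auto intro!: derivative_eq_intros w has_field_derivative_at_within[OF smooth_DERIV[OF smooth_test_fun[OF \<phi>]]])
  qed simp
  moreover have "\<phi> 0 = 0" "\<phi> 1 = 0" using test_fun_support[OF \<phi>] by (metis less_eq_real_def)+
  moreover have "integral {0..1} (\<lambda>x. w x * deriv \<phi> x + w' x * \<phi> x) =
      integral {0..1} (\<lambda>x. w x * deriv \<phi> x) + integral {0..1} (\<lambda>x. w' x * \<phi> x)"
    by (intro Henstock_Kurzweil_Integration.integral_add integrable_continuous_real cont_products)
  ultimately show ?thesis
    using cont_products by (simp add: continuous_on_unit_ivl integral_unique)
qed

text \<open>Repeated integration by parts; it shows which multiple of \<open>x ^ k\<close> cancels a
  constant in the \<open>k\<close>-th derivative.\<close>

lemma integral_power_test_fun: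
  assumes "test_fun \<phi>"
  shows "(LINT x|unit_ivl. x ^ k * (deriv ^^ k) \<phi> x) = (-1) ^ k * fact k * (LINT x|unit_ivl. \<phi> x)"
  using assms
proof (induction k)
  case (Suc k)
  have "(LINT x|unit_ivl. x ^ Suc k * deriv ((deriv ^^ k) \<phi>) x) =
      - (LINT x|unit_ivl. (real (Suc k) * x ^ k) * (deriv ^^ k) \<phi> x)"
    by (rule integral_by_parts_test_fun)
      (use DERIV_pow[of "Suc k"] in \<open>auto intro!: continuous_intros test_fun_funpow_deriv Suc\<close>)
  also have "(LINT x|unit_ivl. (real (Suc k) * x ^ k) * (deriv ^^ k) \<phi> x) =
      real (Suc k) * (LINT x|unit_ivl. x ^ k * (deriv ^^ k) \<phi> x)"
    by (simp only: mult.assoc Bochner_Integration.integral_mult_right_zero)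
  finally show ?case using Suc by (simp add: algebra_simps)
qed simp

text \<open>A test function minus its integral times a fixed \<open>\<theta>\<close> of integral 1
  has mean 0, hence is the derivative of a test function. The hypothesis for \<open>Suc k\<close>
  thus says that the \<open>k\<close>-th derivative is a constant, and subtracting the matching
  monomial leads back to the case \<open>k\<close>.\<close>

lemma polynomial_of_vanishing_derivative:
  assumes "locally_integrable w"
    and "\<And>\<phi>. test_fun \<phi> \<Longrightarrow> (LINT x|unit_ivl. w x * (deriv ^^ k) \<phi> x) = 0"
  shows "\<exists>c. AE x in unit_ivl. w x = (\<Sum>i<k. c i * x ^ i)"
  using assms
proof (induction k arbitrary: w)
  case 0
  then show ?case using fundamental_lemma[of w] by simp
next
  case (Suc k)
  define \<theta>0 where "\<theta>0 = bump 1 (1/4) (3/4)"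
  have \<theta>0: "test_fun \<theta>0" unfolding \<theta>0_def by (rule test_fun_bump) auto
  have "integral ({0..1}) \<theta>0 \<noteq> 0"
  proof
    assume "integral ({0..1}) \<theta>0 = 0"
    then have "\<forall>x\<in>{0..1}. \<theta>0 x = 0"
      by (subst (asm) integral_eq_0_iff) (use test_fun_continuous[OF \<theta>0] bump_bounds in \<open>auto simp: \<theta>0_def\<close>)
    then show False by (auto simp: \<theta>0_def bump_eq dest!: bspec[of _ _ "1/2"])
  qed
  then have I0: "integral {0..1} \<theta>0 \<noteq> 0" by simp
  \<comment> \<open>Normalised to integral 1; the summand with factor 0 only brings it into the
    shape of \<open>test_fun_lincomb\<close>.\<close>
  define \<theta> where "\<theta> x = (1 / integral {0..1} \<theta>0) * \<theta>0 x + 0 * \<theta>0 x" for x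
  have \<theta>: "test_fun \<theta>" unfolding \<theta>_def by (intro test_fun_lincomb \<theta>0)
  have int_\<theta>: "integral {0..1} \<theta> = 1" using I0 by (simp add: \<theta>_def[abs_def])
  define c where "c = (LINT x|unit_ivl. w x * (deriv ^^ k) \<theta> x)"
  have w_\<psi>: "(LINT x|unit_ivl. w x * (deriv ^^ k) \<psi> x) = c * (LINT x|unit_ivl. \<psi> x)" if \<psi>: "test_fun \<psi>" for \<psi>
  proof -
    define I where "I = integral {0..1} \<psi>"
    have eq: "(LINT x|unit_ivl. \<psi> x) = I"
      using continuous_on_unit_ivl[OF test_fun_continuous[OF \<psi>]] by (simp add: I_def)
    have "integral {0..1} (\<lambda>x. 1 * \<psi> x + - I * \<theta> x) = integral {0..1} (\<lambda>x. 1 * \<psi> x) + integral {0..1} (\<lambda>x. - I * \<theta> x)"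
      by (intro Henstock_Kurzweil_Integration.integral_add integrable_continuous_real continuous_intros
          test_fun_continuous \<psi> \<theta>)
    also have "\<dots> = 0" using int_\<theta> by (simp add: I_def)
    \<comment> \<open>Inserting this \<open>g\<close> into the hypothesis expresses the pairing with
      \<open>\<psi>\<close> through the one with \<open>\<theta>\<close>, which is the constant
      \<open>c\<close>.\<close>
    finally obtain g where g: "test_fun g" "deriv g = (\<lambda>x. 1 * \<psi> x + - I * \<theta> x)"
      using test_fun_antiderivative[OF test_fun_lincomb[OF \<psi> \<theta>]] by metis
    have "(deriv ^^ Suc k) g = (\<lambda>x. 1 * (deriv ^^ k) \<psi> x + - I * (deriv ^^ k) \<theta> x)"
      unfolding funpow_Suc_right comp_apply g(2) by (rule smooth_lincomb) (intro smooth_test_fun \<psi> \<theta>)+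
    then have "0 = (LINT x|unit_ivl. w x * (deriv ^^ k) \<psi> x - I * (w x * (deriv ^^ k) \<theta> x))"
      using Suc.prems(2)[OF g(1)] by (simp add: algebra_simps del: funpow.simps)
    also have "\<dots> = (LINT x|unit_ivl. w x * (deriv ^^ k) \<psi> x) - (LINT x|unit_ivl. I * (w x * (deriv ^^ k) \<theta> x))"
      by (intro Bochner_Integration.integral_diff integrable_mult_right integrable_mult_test_fun
          test_fun_funpow_deriv \<psi> \<theta> Suc.prems)
    finally show ?thesis by (simp add: c_def eq)
  qed
  \<comment> \<open>By \<open>integral_power_test_fun\<close>, the \<open>k\<close>-th
    distributional derivative of \<open>C * x ^ k\<close> pairs with test functions exactly as that
    of \<open>w\<close> does.\<close>
  define C where "C = c / ((-1) ^ k * fact k)"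
  define v where "v x = w x - C * x ^ k" for x
  have v1: "integrable unit_ivl (\<lambda>x. C * x ^ k)"
    by (intro continuous_on_unit_ivl continuous_intros)
  have v: "locally_integrable v"
    unfolding v_def by (intro locally_integrable_diff locally_integrable_of_integrable v1 Suc.prems)
  have "(LINT x|unit_ivl. v x * (deriv ^^ k) \<psi> x) = 0" if \<psi>: "test_fun \<psi>" for \<psi>
  proof -
    have "(LINT x|unit_ivl. v x * (deriv ^^ k) \<psi> x) =
        (LINT x|unit_ivl. w x * (deriv ^^ k) \<psi> x - (C * x ^ k) * (deriv ^^ k) \<psi> x)"
      by (simp add: v_def algebra_simps)
    also have "\<dots> = (LINT x|unit_ivl. w x * (deriv ^^ k) \<psi> x) - (LINT x|unit_ivl. (C * x ^ k) * (deriv ^^ k) \<psi> x)"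
      by (intro Bochner_Integration.integral_diff integrable_mult_test_fun
          test_fun_funpow_deriv \<psi> locally_integrable_of_integrable v1 Suc.prems)
    also have "(LINT x|unit_ivl. (C * x ^ k) * (deriv ^^ k) \<psi> x) = C * (LINT x|unit_ivl. x ^ k * (deriv ^^ k) \<psi> x)"
      by (simp only: mult.assoc Bochner_Integration.integral_mult_right_zero)
    finally show ?thesis by (simp add: integral_power_test_fun[OF \<psi>] w_\<psi>[OF \<psi>] C_def)
  qed
  from Suc.IH[OF v this] obtain b where "AE x in unit_ivl. v x = (\<Sum>i<k. b i * x ^ i)" by blast
  then have "AE x in unit_ivl. w x = (\<Sum>i<Suc k. (b(k := C)) i * x ^ i)"
    by eventually_elim (simp add: v_def algebra_simps)
  then show ?case by blast
qed

section \<open>The clamped beam\<close>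

text \<open>The second derivative in \<open>s\<close> of the Green function of \<open>u'''' = v\<close>,
  \<open>u(0) = u'(0) = u(1) = u'(1) = 0\<close>, with pole \<open>y\<close>; the affine part makes it orthogonal to
  the affine functions.\<close>

definition beam_kernel :: "real \<Rightarrow> real \<Rightarrow> real" where
  "beam_kernel s y = max 0 (s - y) + (1 - y)\<^sup>2 * y - (1 - y)\<^sup>2 * (1 + 2 * y) * s"

definition bending :: "(real \<Rightarrow> real) \<Rightarrow> real \<Rightarrow> real" where
  "bending v s = (LINT y|unit_ivl. v y * beam_kernel s y)"

text \<open>\<open>bending\<close>, \<open>slope\<close> and \<open>deflection\<close> are
  \<open>u''\<close>, \<open>u'\<close> and \<open>u\<close>. Integrating from 0 builds in the
  conditions at 0; those at 1 have to come from the kernel.\<close>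

definition slope :: "(real \<Rightarrow> real) \<Rightarrow> real \<Rightarrow> real" where
  "slope v x = integral {0..x} (bending v)"

definition deflection :: "(real \<Rightarrow> real) \<Rightarrow> real \<Rightarrow> real" where
  "deflection v x = integral {0..x} (slope v)"

text \<open>The positive part contributes 1 and the linear term at most 3. Together with the bound 1
  at \<open>s = 0\<close> this also explains the constant 5 in \<open>beam_kernel_bound\<close>. The
  constants are crude; what matters is their uniformity in the pole \<open>y\<close>.\<close>

lemma beam_kernel_Lipschitz:
  assumes "y \<in> {0..1}"
  shows "\<bar>beam_kernel s y - beam_kernel t y\<bar> \<le> 4 * \<bar>s - t\<bar>"
proof -
  define d where "d = (1 - y)\<^sup>2 * (1 + 2 * y)"
  have "0 \<le> d" using assms by (simp add: d_def)
  moreover have "d \<le> 1 * 3" unfolding d_def using assms by (intro mult_mono) (auto intro: power_le_one)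
  ultimately have d: "\<bar>d * (s - t)\<bar> \<le> 3 * \<bar>s - t\<bar>"
    unfolding abs_mult by (intro mult_right_mono) auto
  define r where "r = d * (s - t)"
  have "beam_kernel s y - beam_kernel t y = (max 0 (s - y) - max 0 (t - y)) - r"
    by (simp add: beam_kernel_def r_def d_def algebra_simps)
  also have "\<bar>\<dots>\<bar> \<le> \<bar>max 0 (s - y) - max 0 (t - y)\<bar> + \<bar>r\<bar>" by (rule abs_triangle_ineq4)
  also have "\<bar>max 0 (s - y) - max 0 (t - y)\<bar> \<le> \<bar>s - t\<bar>" by linarith
  also have "\<bar>s - t\<bar> + \<bar>r\<bar> \<le> 4 * \<bar>s - t\<bar>" using d by (simp add: r_def)
  finally show ?thesis by simp
qed

lemma beam_kernel_bound:
  assumes "s \<in> {0..1}" "y \<in> {0..1}"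
  shows "\<bar>beam_kernel s y\<bar> \<le> 5"
proof -
  have "\<bar>(1 - y)\<^sup>2 * y\<bar> \<le> 1 * 1" unfolding abs_mult using assms by (intro mult_mono) (auto intro: power_le_one)
  then have "\<bar>beam_kernel 0 y\<bar> \<le> 1" using assms by (simp add: beam_kernel_def max_def)
  then show ?thesis using beam_kernel_Lipschitz[OF assms(2), of s 0] assms by (simp add: abs_le_iff)
qed

lemma continuous_beam_kernel:
  "continuous_on S (\<lambda>s. beam_kernel s y)" "continuous_on S (\<lambda>y. beam_kernel s y)"
  unfolding beam_kernel_def by (intro continuous_intros)+

lemma integrable_mult_bounded:
  fixes v f :: "real \<Rightarrow> real"
  assumes v: "integrable unit_ivl v" and f: "f \<in> borel_measurable unit_ivl"
    and bound: "\<And>x. x \<in> {0<..<1} \<Longrightarrow> \<bar>f x\<bar> \<le> C"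
  shows "integrable unit_ivl (\<lambda>x. v x * f x)"
    and "\<bar>LINT x|unit_ivl. v x * f x\<bar> \<le> C * (LINT x|unit_ivl. \<bar>v x\<bar>)"
proof -
  have le: "\<bar>v x * f x\<bar> \<le> C * \<bar>v x\<bar>" if "x \<in> space unit_ivl" for x
    using mult_left_mono[of "\<bar>f x\<bar>" C "\<bar>v x\<bar>"] bound[of x] that by (simp add: abs_mult mult.commute)
  show int: "integrable unit_ivl (\<lambda>x. v x * f x)"
  proof (rule Bochner_Integration.integrable_bound)
    show "integrable unit_ivl (\<lambda>x. C * \<bar>v x\<bar>)" using v by auto
    show "(\<lambda>x. v x * f x) \<in> borel_measurable unit_ivl" using v f by auto
    show "AE x in unit_ivl. norm (v x * f x) \<le> norm (C * \<bar>v x\<bar>)"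
      using le by (intro AE_I2) fastforce
  qed
  have "\<bar>LINT x|unit_ivl. v x * f x\<bar> \<le> (LINT x|unit_ivl. \<bar>v x * f x\<bar>)" by (rule integral_abs_bound)
  also have "\<dots> \<le> (LINT x|unit_ivl. C * \<bar>v x\<bar>)"
    using int v le by (intro integral_mono) auto
  finally show "\<bar>LINT x|unit_ivl. v x * f x\<bar> \<le> C * (LINT x|unit_ivl. \<bar>v x\<bar>)" by simp
qed

lemma measurable_beam_kernel: "beam_kernel s \<in> borel_measurable unit_ivl"
  by (rule continuous_imp_measurable_on_sets_lebesgue[OF continuous_beam_kernel(2)]) simp

lemma integrable_mult_beam_kernel:
  assumes "integrable unit_ivl v" "s \<in> {0..1}"
  shows "integrable unit_ivl (\<lambda>y. v y * beam_kernel s y)"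
  using assms measurable_beam_kernel beam_kernel_bound by (intro integrable_mult_bounded(1)[where C = 5]) auto

lemma bending_bound:
  assumes "integrable unit_ivl v" "s \<in> {0..1}"
  shows "\<bar>bending v s\<bar> \<le> 5 * (LINT x|unit_ivl. \<bar>v x\<bar>)"
  unfolding bending_def
  using assms measurable_beam_kernel beam_kernel_bound by (intro integrable_mult_bounded(2)) auto

lemma bending_Lipschitz:
  assumes v: "integrable unit_ivl v" and "s \<in> {0..1}" "t \<in> {0..1}"
  shows "\<bar>bending v s - bending v t\<bar> \<le> 4 * (LINT x|unit_ivl. \<bar>v x\<bar>) * \<bar>s - t\<bar>"
proof -
  have "bending v s - bending v t = (LINT y|unit_ivl. v y * (beam_kernel s y - beam_kernel t y))"
    unfolding bending_def using assms
    by (simp add: right_diff_distrib integrable_mult_beam_kernel flip: Bochner_Integration.integral_diff)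
  also have "\<bar>\<dots>\<bar> \<le> (4 * \<bar>s - t\<bar>) * (LINT x|unit_ivl. \<bar>v x\<bar>)"
    using v measurable_beam_kernel beam_kernel_Lipschitz by (intro integrable_mult_bounded(2)) auto
  finally show ?thesis by (simp add: mult_ac)
qed

lemma continuous_bending:
  assumes "integrable unit_ivl v"
  shows "continuous_on {0..1} (bending v)"
proof -
  define L where "L = 4 * (LINT x|unit_ivl. \<bar>v x\<bar>)"
  have "0 \<le> L" by (simp add: L_def)
  then have "L-lipschitz_on {0..1} (bending v)"
    using bending_Lipschitz[OF assms] by (intro lipschitz_onI) (auto simp: dist_real_def L_def)
  then show ?thesis by (rule lipschitz_on_continuous_on)
qed

text \<open>One computation with two uses: for clamped \<open>F\<close> only \<open>F y\<close>
  survives, and for the second antiderivatives of 1 and \<open>s\<close> the value is 0. The latter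
  two conditions are what fixes the affine part of the kernel.\<close>

lemma beam_kernel_moments:
  assumes y: "y \<in> {0..1}"
    and f: "\<And>x. x \<in> {0..1} \<Longrightarrow> (F has_real_derivative F' x) (at x within {0..1})"
      "\<And>x. x \<in> {0..1} \<Longrightarrow> (F' has_real_derivative F'' x) (at x within {0..1})"
  shows "((\<lambda>s. F'' s * beam_kernel s y) has_integral
    ((1 - y) * F' 1 - F 1 + F y + (1 - y)\<^sup>2 * y * (F' 1 - F' 0)
      - (1 - y)\<^sup>2 * (1 + 2 * y) * (F' 1 - F 1 + F 0))) {0..1}"
proof -
  \<comment> \<open>The primitive \<open>(s - c) * F' s - F s\<close> integrates \<open>F''\<close>
    against every affine factor of slope 1, and so handles both the positive part on the right of
    \<open>y\<close> and the linear term.\<close>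
  have D: "((\<lambda>s. F'' s * (s - c)) has_integral (((b - c) * F' b - F b) - ((a - c) * F' a - F a))) {a..b}"
    if "0 \<le> a" "a \<le> b" "b \<le> 1" for a b c
  proof (rule fundamental_theorem_of_calculus)
    fix x assume x: "x \<in> {a..b}"
    have "((\<lambda>s. (s - c) * F' s - F s) has_real_derivative F'' x * (x - c)) (at x within {0..1})"
      using x that by (auto intro!: derivative_eq_intros f simp: algebra_simps)
    then show "((\<lambda>s. (s - c) * F' s - F s) has_vector_derivative F'' x * (x - c)) (at x within {a..b})"
      unfolding has_real_derivative_iff_has_vector_derivative[symmetric]
      by (rule DERIV_subset) (use that in auto)
  qed (use that in simp)
  have "((\<lambda>s. F'' s * max 0 (s - y)) has_integral 0) {0..y}"
    by (rule has_integral_is_0) (auto simp: max_def)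
  moreover have "((\<lambda>s. F'' s * max 0 (s - y)) has_integral (((1 - y) * F' 1 - F 1) - ((y - y) * F' y - F y))) {y..1}"
    by (rule has_integral_eq[OF _ D]) (use y in \<open>auto simp: max_def\<close>)
  ultimately have i1: "((\<lambda>s. F'' s * max 0 (s - y)) has_integral
      (0 + (((1 - y) * F' 1 - F 1) - ((y - y) * F' y - F y)))) {0..1}"
    by (rule has_integral_combine[rotated 2]) (use y in auto)
  have i2: "((\<lambda>s. (1 - y)\<^sup>2 * y * F'' s) has_integral ((1 - y)\<^sup>2 * y * (F' 1 - F' 0))) {0..1}"
    by (intro has_integral_mult_right fundamental_theorem_of_calculus)
      (use f in \<open>auto simp flip: has_real_derivative_iff_has_vector_derivative\<close>)
  have i3: "((\<lambda>s. (1 - y)\<^sup>2 * (1 + 2 * y) * (F'' s * (s - 0))) has_integral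
      ((1 - y)\<^sup>2 * (1 + 2 * y) * (((1 - 0) * F' 1 - F 1) - ((0 - 0) * F' 0 - F 0)))) {0..1}"
    by (intro has_integral_mult_right D) auto
  from has_integral_diff[OF has_integral_add[OF i1 i2] i3]
  show ?thesis
    by (rule has_integral_eq_rhs[OF has_integral_eq[rotated]]) (auto simp: beam_kernel_def algebra_simps)
qed

text \<open>The reproducing property of the kernel. It is applied to deflections, where it gives
  symmetry, and to test functions, where it gives the weak equation.\<close>

lemma clamped_eq_integral:
  assumes "\<And>x. x \<in> {0..1} \<Longrightarrow> (F has_real_derivative F' x) (at x within {0..1})"
    "\<And>x. x \<in> {0..1} \<Longrightarrow> (F' has_real_derivative F'' x) (at x within {0..1})"
    and "F 0 = 0" "F 1 = 0" "F' 0 = 0" "F' 1 = 0" and "y \<in> {0..1}"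
  shows "integral {0..1} (\<lambda>s. F'' s * beam_kernel s y) = F y"
  using integral_unique[OF beam_kernel_moments[OF assms(7,1,2)]] assms(3-6) by simp

lemma beam_kernel_orthogonal_affine:
  assumes "y \<in> {0..1}"
  shows "integral {0..1} (\<lambda>s. beam_kernel s y) = 0" "integral {0..1} (\<lambda>s. s * beam_kernel s y) = 0"
proof -
  have "((\<lambda>s. 1 * beam_kernel s y) has_integral 0) {0..1}"
    by (rule has_integral_eq_rhs[OF beam_kernel_moments[OF assms, of "\<lambda>s. s\<^sup>2 / 2" "\<lambda>s. s"]])
      (auto intro!: derivative_eq_intros simp: power2_eq_square field_simps)
  then show "integral {0..1} (\<lambda>s. beam_kernel s y) = 0" by (simp add: integral_unique)
  have "((\<lambda>s. s * beam_kernel s y) has_integral 0) {0..1}"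
    by (rule has_integral_eq_rhs[OF beam_kernel_moments[OF assms, of "\<lambda>s. s ^ 3 / 6" "\<lambda>s. s\<^sup>2 / 2"]])
      (auto intro!: derivative_eq_intros simp: power2_eq_square power3_eq_cube field_simps)
  then show "integral {0..1} (\<lambda>s. s * beam_kernel s y) = 0" by (simp add: integral_unique)
qed

lemma finite_measure_unit_ivl: "finite_measure unit_ivl"
  by (rule finite_measureI) (simp add: emeasure_restrict_space space_restrict_space)

text \<open>Fubini applies with \<open>v\<close> merely in \<open>L^1\<close>, because
  \<open>q\<close> and the kernel are bounded. Taking \<open>q\<close> to be 1, \<open>s\<close>, a
  bending or the second derivative of a test function yields respectively the two conditions at 1,
  the symmetric form and the weak equation.\<close>

lemma integral_mult_bending:
  assumes v: "integrable unit_ivl v" and q: "continuous_on {0..1} q"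
  shows "integral {0..1} (\<lambda>s. q s * bending v s) =
    (LINT y|unit_ivl. v y * integral {0..1} (\<lambda>s. q s * beam_kernel s y))"
proof -
  interpret U: finite_measure unit_ivl by (rule finite_measure_unit_ivl)
  interpret pair_sigma_finite unit_ivl unit_ivl ..
  have [measurable]: "v \<in> borel_measurable unit_ivl" using v by auto
  have [measurable]: "q \<in> borel_measurable unit_ivl"
    by (rule continuous_imp_measurable_on_sets_lebesgue[OF continuous_on_subset[OF q]]) auto
  have id: "(\<lambda>x. x) \<in> borel_measurable unit_ivl"
    by (rule continuous_imp_measurable_on_sets_lebesgue) auto
  \<comment> \<open>The projections are measurable into \<open>unit_ivl\<close>; composing with the
    identity makes them Borel functions, as the measurability of the kernel on the square
    requires.\<close>
  have [measurable]: "fst \<in> borel_measurable (unit_ivl \<Otimes>\<^sub>M unit_ivl)" "snd \<in> borel_measurable (unit_ivl \<Otimes>\<^sub>M unit_ivl)"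
    by (rule measurable_compose[OF measurable_fst id] measurable_compose[OF measurable_snd id])+
  define f where "f p = q (fst p) * (v (snd p) * beam_kernel (fst p) (snd p))" for p
  have kernel: "(\<lambda>p. beam_kernel (fst p) (snd p)) \<in> borel_measurable (unit_ivl \<Otimes>\<^sub>M unit_ivl)"
    unfolding beam_kernel_def by measurable
  have [measurable]: "f \<in> borel_measurable (unit_ivl \<Otimes>\<^sub>M unit_ivl)"
    unfolding f_def using kernel by measurable
  have "compact (q ` {0..1})" using q by (intro compact_continuous_image) auto
  then obtain Q where Q: "\<And>x. x \<in> {0..1} \<Longrightarrow> \<bar>q x\<bar> \<le> Q"
    using compact_imp_bounded[THEN bounded_iff[THEN iffD1]] by fastforce
  have int: "integrable (unit_ivl \<Otimes>\<^sub>M unit_ivl) f"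
  proof (rule Fubini_integrable)
    show "AE x in unit_ivl. integrable unit_ivl (\<lambda>y. f (x, y))"
      unfolding f_def using v by (intro AE_I2) (auto intro!: integrable_mult_beam_kernel)
    show "integrable unit_ivl (\<lambda>x. LINT y|unit_ivl. norm (f (x, y)))"
    proof (rule U.integrable_const_bound)
      show "(\<lambda>x. LINT y|unit_ivl. norm (f (x, y))) \<in> borel_measurable unit_ivl" by measurable
      show "AE x in unit_ivl. norm (LINT y|unit_ivl. norm (f (x, y))) \<le> Q * (5 * (LINT y|unit_ivl. \<bar>v y\<bar>))"
      proof (rule AE_I2)
        fix x assume "x \<in> space unit_ivl"
        then have x: "x \<in> {0..1}" by simp
        have "(LINT y|unit_ivl. norm (f (x, y))) = \<bar>q x\<bar> * (LINT y|unit_ivl. \<bar>v y * beam_kernel x y\<bar>)"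
          by (simp add: f_def abs_mult)
        also have "\<dots> \<le> Q * (5 * (LINT y|unit_ivl. \<bar>v y\<bar>))"
        proof (rule mult_mono)
          have "(LINT y|unit_ivl. \<bar>v y * beam_kernel x y\<bar>) = \<bar>LINT y|unit_ivl. \<bar>v y\<bar> * \<bar>beam_kernel x y\<bar>\<bar>"
            by (simp add: abs_mult)
          also have "\<dots> \<le> 5 * (LINT y|unit_ivl. \<bar>\<bar>v y\<bar>\<bar>)"
            using v x measurable_beam_kernel beam_kernel_bound by (intro integrable_mult_bounded(2)) auto
          finally show "(LINT y|unit_ivl. \<bar>v y * beam_kernel x y\<bar>) \<le> 5 * (LINT y|unit_ivl. \<bar>v y\<bar>)" by simp
        qed (use Q[OF x] Q[of 0] in \<open>auto intro: integral_nonneg_AE\<close>)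
        finally show "norm (LINT y|unit_ivl. norm (f (x, y))) \<le> Q * (5 * (LINT y|unit_ivl. \<bar>v y\<bar>))" by simp
      qed
    qed
  qed measurable
  have "integral {0..1} (\<lambda>s. q s * bending v s) = (LINT s|unit_ivl. q s * bending v s)"
    by (intro continuous_on_unit_ivl(2)[symmetric] continuous_intros q continuous_bending v)
  also have "\<dots> = (LINT s|unit_ivl. LINT y|unit_ivl. f (s, y))"
    by (simp add: f_def bending_def)
  also have "\<dots> = (LINT y|unit_ivl. LINT s|unit_ivl. f (s, y))"
    using int by (intro Fubini_integral[symmetric]) (simp add: case_prod_unfold)
  also have "\<dots> = (LINT y|unit_ivl. v y * (LINT s|unit_ivl. q s * beam_kernel s y))"
    by (simp add: f_def mult_ac flip: Bochner_Integration.integral_mult_right_zero)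
  also have "\<dots> = (LINT y|unit_ivl. v y * integral {0..1} (\<lambda>s. q s * beam_kernel s y))"
    by (intro Bochner_Integration.integral_cong refl arg_cong2[where f = times] continuous_on_unit_ivl(2)
        continuous_intros q continuous_beam_kernel)
  finally show ?thesis .
qed

section \<open>Boundary conditions, symmetry and weak derivatives of the deflection\<close>

lemma slope_DERIV:
  assumes "integrable unit_ivl v" "x \<in> {0..1}"
  shows "(slope v has_real_derivative bending v x) (at x within {0..1})"
  unfolding slope_def[abs_def] using assms by (intro integral_has_real_derivative continuous_bending)

lemma continuous_slope:
  "integrable unit_ivl v \<Longrightarrow> continuous_on {0..1} (slope v)"
  using slope_DERIV by (rule DERIV_continuous_on)

lemma deflection_DERIV:
  assumes "integrable unit_ivl v" "x \<in> {0..1}"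
  shows "(deflection v has_real_derivative slope v x) (at x within {0..1})"
  unfolding deflection_def[abs_def] using assms by (intro integral_has_real_derivative continuous_slope)

lemma continuous_deflection:
  "integrable unit_ivl v \<Longrightarrow> continuous_on {0..1} (deflection v)"
  using deflection_DERIV by (rule DERIV_continuous_on)

text \<open>The integral of \<open>u''\<close> is \<open>u'(1)\<close> and that of
  \<open>s * u''\<close> is \<open>u'(1) - u(1)\<close>, given the conditions at 0. Both vanish
  since the kernel is orthogonal to affine functions.\<close>

lemma deflection_clamped:
  assumes v: "integrable unit_ivl v"
  shows "deflection v 0 = 0" "slope v 0 = 0" "slope v 1 = 0" "deflection v 1 = 0"
proof -
  show "deflection v 0 = 0" "slope v 0 = 0" by (simp_all add: deflection_def slope_def)
  have zero: "(LINT y|unit_ivl. v y * integral {0..1} (\<lambda>s. q s * beam_kernel s y)) = 0"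
    if "\<And>y. y \<in> {0..1} \<Longrightarrow> integral {0..1} (\<lambda>s. q s * beam_kernel s y) = 0" for q
    using that by (intro integral_eq_zero_AE AE_I2) auto
  show slope1: "slope v 1 = 0"
    using integral_mult_bending[OF v continuous_on_const[of _ 1]] zero[of "\<lambda>_. 1"]
    by (simp add: slope_def beam_kernel_orthogonal_affine)
  have "((\<lambda>s. s * bending v s) has_integral ((1 * slope v 1 - deflection v 1) - (0 * slope v 0 - deflection v 0))) {0..1}"
  proof (rule fundamental_theorem_of_calculus)
    fix x :: real assume "x \<in> {0..1}"
    then show "((\<lambda>s. s * slope v s - deflection v s) has_vector_derivative x * bending v x) (at x within {0..1})"
      unfolding has_real_derivative_iff_has_vector_derivative[symmetric]
      by (auto intro!: derivative_eq_intros slope_DERIV deflection_DERIV v)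
  qed simp
  moreover have "integral {0..1} (\<lambda>s. s * bending v s) = 0"
    using integral_mult_bending[OF v continuous_on_id] zero[of "\<lambda>s. s"]
    by (simp add: beam_kernel_orthogonal_affine)
  ultimately show "deflection v 1 = 0"
    using slope1 by (simp add: deflection_def integral_unique)
qed

lemma deflection_eq_integral:
  assumes "integrable unit_ivl v" "y \<in> {0..1}"
  shows "integral {0..1} (\<lambda>s. bending v s * beam_kernel s y) = deflection v y"
  using assms deflection_clamped[OF assms(1)]
  by (intro clamped_eq_integral[of _ "slope v"] deflection_DERIV slope_DERIV) auto

lemma integral_mult_deflection:
  assumes "integrable unit_ivl v" "integrable unit_ivl w"
  shows "(LINT y|unit_ivl. w y * deflection v y) = integral {0..1} (\<lambda>s. bending v s * bending w s)"
proof -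
  have "integral {0..1} (\<lambda>s. bending v s * bending w s) =
      (LINT y|unit_ivl. w y * integral {0..1} (\<lambda>s. bending v s * beam_kernel s y))"
    using assms by (intro integral_mult_bending continuous_bending)
  also have "\<dots> = (LINT y|unit_ivl. w y * deflection v y)"
    using assms by (intro Bochner_Integration.integral_cong) (auto simp: deflection_eq_integral)
  finally show ?thesis by simp
qed

text \<open>For the fourth derivative, two integrations by parts lead to \<open>u''\<close> against
  the second derivative of the test function. Fubini then moves the kernel onto the latter, where
  the reproducing property returns the test function itself.\<close>

lemma deflection_weak_derivatives:
  assumes v: "integrable unit_ivl v" and \<phi>: "test_fun \<phi>"
  shows "(LINT x|unit_ivl. deflection v x * deriv \<phi> x) = - (LINT x|unit_ivl. slope v x * \<phi> x)"
    and "(LINT x|unit_ivl. deflection v x * (deriv ^^ 2) \<phi> x) = (LINT x|unit_ivl. bending v x * \<phi> x)"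
    and "(LINT x|unit_ivl. deflection v x * (deriv ^^ 4) \<phi> x) = (LINT x|unit_ivl. v x * \<phi> x)"
proof -
  have d: "test_fun ((deriv ^^ k) \<phi>)" for k using \<phi> by (rule test_fun_funpow_deriv)
  have D1: "(LINT x|unit_ivl. deflection v x * deriv \<psi> x) = - (LINT x|unit_ivl. slope v x * \<psi> x)"
    if "test_fun \<psi>" for \<psi>
    using v that by (intro integral_by_parts_test_fun deflection_DERIV continuous_slope)
  have D2: "(LINT x|unit_ivl. slope v x * deriv \<psi> x) = - (LINT x|unit_ivl. bending v x * \<psi> x)"
    if "test_fun \<psi>" for \<psi>
    using v that by (intro integral_by_parts_test_fun slope_DERIV continuous_bending)
  have D: "(LINT x|unit_ivl. deflection v x * deriv (deriv \<psi>) x) = (LINT x|unit_ivl. bending v x * \<psi> x)"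
    if "test_fun \<psi>" for \<psi>
    using D1[OF test_fun_deriv[OF that]] D2[OF that] by simp
  show "(LINT x|unit_ivl. deflection v x * deriv \<phi> x) = - (LINT x|unit_ivl. slope v x * \<phi> x)"
    by (rule D1[OF \<phi>])
  show "(LINT x|unit_ivl. deflection v x * (deriv ^^ 2) \<phi> x) = (LINT x|unit_ivl. bending v x * \<phi> x)"
    using D[OF \<phi>] by (simp add: numeral_2_eq_2)
  have cont: "continuous_on {0..1} ((deriv ^^ 2) \<phi>)" by (rule test_fun_continuous[OF d])
  have \<phi>_DERIV: "((deriv ^^ k) \<phi> has_real_derivative (deriv ^^ Suc k) \<phi> x) (at x within {0..1})" for k x
    using has_field_derivative_at_within[OF smooth_DERIV[OF smooth_test_fun[OF d]]] by simp
  have "(LINT x|unit_ivl. deflection v x * (deriv ^^ 4) \<phi> x) =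
      (LINT x|unit_ivl. bending v x * (deriv ^^ 2) \<phi> x)"
    using D[OF d, of 2] by (simp add: numeral_eq_Suc)
  also have "\<dots> = integral {0..1} (\<lambda>x. (deriv ^^ 2) \<phi> x * bending v x)"
    by (subst continuous_on_unit_ivl(2)) (auto intro!: continuous_intros continuous_bending v cont simp: mult.commute)
  also have "\<dots> = (LINT y|unit_ivl. v y * integral {0..1} (\<lambda>s. (deriv ^^ 2) \<phi> s * beam_kernel s y))"
    by (rule integral_mult_bending[OF v cont])
  also have "\<dots> = (LINT y|unit_ivl. v y * \<phi> y)"
  proof (intro Bochner_Integration.integral_cong refl arg_cong2[where f = times])
    fix y assume "y \<in> space unit_ivl"
    then have y: "y \<in> {0..1}" by simp
    have zero: "(deriv ^^ k) \<phi> 0 = 0 \<and> (deriv ^^ k) \<phi> 1 = 0" for k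
      using test_fun_support[OF d] by (metis less_eq_real_def)
    show "integral {0..1} (\<lambda>s. (deriv ^^ 2) \<phi> s * beam_kernel s y) = \<phi> y"
      using \<phi>_DERIV[of 0] \<phi>_DERIV[of 1] zero[of 0] zero[of 1] y
      by (intro clamped_eq_integral[of _ "deriv \<phi>"]) (auto simp: numeral_2_eq_2)
  qed
  finally show "(LINT x|unit_ivl. deflection v x * (deriv ^^ 4) \<phi> x) = (LINT x|unit_ivl. v x * \<phi> x)" .
qed

section \<open>Bounds by the \<open>L^1\<close> norm of the load, and linearity\<close>

lemma slope_bound:
  assumes v: "integrable unit_ivl v" and x: "x \<in> {0..1}"
  shows "\<bar>slope v x\<bar> \<le> 5 * (LINT x|unit_ivl. \<bar>v x\<bar>)"
proof -
  have "\<bar>slope v x - slope v 0\<bar> \<le> 5 * (LINT x|unit_ivl. \<bar>v x\<bar>) * \<bar>x - 0\<bar>"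
    using field_differentiable_bound[of "{0..1}" "slope v" "bending v" "5 * (LINT x|unit_ivl. \<bar>v x\<bar>)" x 0]
      slope_DERIV[OF v] bending_bound[OF v] x by simp
  also have "\<dots> \<le> 5 * (LINT x|unit_ivl. \<bar>v x\<bar>) * 1"
    using x by (intro mult_left_mono) auto
  finally show ?thesis by (simp add: deflection_clamped[OF v])
qed

lemma deflection_Lipschitz:
  assumes v: "integrable unit_ivl v" and x: "x \<in> {0..1}" "y \<in> {0..1}"
  shows "\<bar>deflection v x - deflection v y\<bar> \<le> 5 * (LINT x|unit_ivl. \<bar>v x\<bar>) * \<bar>x - y\<bar>"
  using field_differentiable_bound[of "{0..1}" "deflection v" "slope v" "5 * (LINT x|unit_ivl. \<bar>v x\<bar>)" x y]
    deflection_DERIV[OF v] slope_bound[OF v] x by simp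

lemma deflection_bound:
  assumes v: "integrable unit_ivl v" and x: "x \<in> {0..1}"
  shows "\<bar>deflection v x\<bar> \<le> 5 * (LINT x|unit_ivl. \<bar>v x\<bar>)"
proof -
  have "\<bar>deflection v x - deflection v 0\<bar> \<le> 5 * (LINT x|unit_ivl. \<bar>v x\<bar>) * \<bar>x - 0\<bar>"
    using deflection_Lipschitz[OF v x, of 0] by simp
  also have "\<dots> \<le> 5 * (LINT x|unit_ivl. \<bar>v x\<bar>) * 1"
    using x by (intro mult_left_mono) auto
  finally show ?thesis by (simp add: deflection_clamped[OF v])
qed

lemma deflection_cong_AE:
  assumes "integrable unit_ivl v" "integrable unit_ivl w" "AE x in unit_ivl. v x = w x"
  shows "deflection v = deflection w"
proof -
  have "bending v = bending w"
    unfolding bending_def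
    by (intro ext integral_cong_AE) (use assms measurable_beam_kernel in \<open>auto elim!: eventually_mono\<close>)
  then show ?thesis by (simp add: deflection_def[abs_def] slope_def[abs_def])
qed

lemma deflection_lincomb:
  assumes v: "integrable unit_ivl v" and w: "integrable unit_ivl w" and x: "x \<in> {0..1}"
  shows "deflection (\<lambda>y. a * v y + b * w y) x = a * deflection v x + b * deflection w x"
proof -
  define h where "h y = a * v y + b * w y" for y
  have h: "integrable unit_ivl h" unfolding h_def using v w by auto
  have bend: "bending h s = a * bending v s + b * bending w s" if "s \<in> {0..1}" for s
  proof -
    have "bending h s = (LINT y|unit_ivl. a * (v y * beam_kernel s y) + b * (w y * beam_kernel s y))"
      by (simp add: bending_def h_def algebra_simps)
    also have "\<dots> = a * bending v s + b * bending w s"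
      using integrable_mult_beam_kernel[OF v that] integrable_mult_beam_kernel[OF w that]
      by (simp add: bending_def)
    finally show ?thesis .
  qed
  have "deflection h x = integral {0..1} (\<lambda>s. bending h s * beam_kernel s x)"
    using deflection_eq_integral[OF h x] by simp
  also have "\<dots> = integral {0..1} (\<lambda>s. a * (bending v s * beam_kernel s x) + b * (bending w s * beam_kernel s x))"
    by (intro Henstock_Kurzweil_Integration.integral_cong) (simp add: bend algebra_simps)
  also have "\<dots> = integral {0..1} (\<lambda>s. a * (bending v s * beam_kernel s x)) +
      integral {0..1} (\<lambda>s. b * (bending w s * beam_kernel s x))"
    by (intro Henstock_Kurzweil_Integration.integral_add integrable_continuous_real continuous_intros
        continuous_bending continuous_beam_kernel v w)
  finally show ?thesis using deflection_eq_integral[OF v x] deflection_eq_integral[OF w x] by (simp add: h_def[abs_def])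
qed

section \<open>Classes of functions\<close>

lemma fn_measurable [measurable]: "fn u \<in> borel_measurable unit_ivl"
  using ae_eq_fn[of u] by (simp add: ae_eq_def)

lemma ae_eq_refl: "f \<in> borel_measurable unit_ivl \<Longrightarrow> ae_eq f f"
  by (simp add: ae_eq_def)

lemma fn_cls: "f \<in> borel_measurable unit_ivl \<Longrightarrow> AE x in unit_ivl. fn (cls f) x = f x"
  using cls_eq_iff[OF ae_eq_fn[of "cls f"] ae_eq_refl[of f]] cls_fn[of "cls f"] by (simp add: ae_eq_def)

lemma ae_fun_eq_iff: "u = v \<longleftrightarrow> (AE x in unit_ivl. fn u x = fn v x)"
  using cls_eq_iff[OF ae_eq_fn[of u] ae_eq_fn[of v]] by (simp add: cls_fn ae_eq_def)

lemma fn_add: "AE x in unit_ivl. fn (u + v) x = fn u x + fn v x"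
  using plus_ae_fun.abs_eq[OF ae_eq_fn[of u] ae_eq_fn[of v]] fn_cls[of "\<lambda>x. fn u x + fn v x"]
  by (simp add: cls_fn)

lemma fn_diff: "AE x in unit_ivl. fn (u - v) x = fn u x - fn v x"
  using minus_ae_fun.abs_eq[OF ae_eq_fn[of u] ae_eq_fn[of v]] fn_cls[of "\<lambda>x. fn u x - fn v x"]
  by (simp add: cls_fn)

lemma fn_scaleR: "AE x in unit_ivl. fn (c *\<^sub>R u) x = c * fn u x"
  using scaleR_ae_fun.abs_eq[OF ae_eq_fn[of u], of c] fn_cls[of "\<lambda>x. c * fn u x"]
  by (simp add: cls_fn)

lemma fn_zero: "AE x in unit_ivl. fn 0 x = 0"
  using fn_cls[of "\<lambda>x. 0"] by (simp add: zero_ae_fun_def)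

lemma measurable_unit_ivl_of_continuous:
  fixes f :: "real \<Rightarrow> real"
  shows "continuous_on {0..1} f \<Longrightarrow> f \<in> borel_measurable unit_ivl"
  by (rule continuous_imp_measurable_on_sets_lebesgue[OF continuous_on_subset]) auto

lemma L1_loc_iff: "u \<in> L1_loc \<longleftrightarrow> locally_integrable (fn u)"
  by (simp add: L1_loc_def locally_integrable_def)

lemma integrable_imp_L1_loc: "integrable unit_ivl (fn u) \<Longrightarrow> u \<in> L1_loc"
  by (simp add: L1_loc_iff locally_integrable_of_integrable)

lemma integrable_cls:
  "integrable unit_ivl f \<Longrightarrow> integrable unit_ivl (fn (cls f))"
  by (rule integrable_cong_AE_imp[where g = f]) (use fn_cls[of f] in \<open>auto elim!: eventually_mono\<close>)

lemma integral_fn_cls_mult: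
  assumes "f \<in> borel_measurable unit_ivl" "g \<in> borel_measurable unit_ivl"
  shows "(LINT x|unit_ivl. fn (cls f) x * g x) = (LINT x|unit_ivl. f x * g x)"
  by (rule integral_cong_AE) (use assms fn_cls[OF assms(1)] in \<open>auto elim!: eventually_mono\<close>)

lemma test_fun_measurable: "test_fun \<phi> \<Longrightarrow> \<phi> \<in> borel_measurable unit_ivl"
  by (intro measurable_unit_ivl_of_continuous test_fun_continuous)

lemma weak_deriv_unique:
  assumes "weak_deriv k u v" "weak_deriv k u w"
  shows "v = w"
proof -
  have li: "locally_integrable (fn v)" "locally_integrable (fn w)"
    using assms by (auto simp: weak_deriv_def L1_loc_iff)
  have "AE x in unit_ivl. fn v x - fn w x = 0"
  proof (rule fundamental_lemma)
    show "locally_integrable (\<lambda>x. fn v x - fn w x)" by (intro locally_integrable_diff li)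
    fix \<phi> assume \<phi>: "test_fun \<phi>"
    have "(-1) ^ k * (LINT x|unit_ivl. fn v x * \<phi> x) = (-1) ^ k * (LINT x|unit_ivl. fn w x * \<phi> x)"
      using assms \<phi> by (auto simp: weak_deriv_def)
    then have "(LINT x|unit_ivl. fn v x * \<phi> x) = (LINT x|unit_ivl. fn w x * \<phi> x)" by simp
    then show "(LINT x|unit_ivl. (fn v x - fn w x) * \<phi> x) = 0"
      using li \<phi> by (simp add: left_diff_distrib integrable_mult_test_fun)
  qed
  then show ?thesis by (simp add: ae_fun_eq_iff)
qed

text \<open>The conclusion includes 0 and 1, so boundary values can be compared although classes of
  functions on the open interval do not see them.\<close>

lemma continuous_AE_eq_0:
  assumes h: "continuous_on {0..1} h" and ae: "AE x in unit_ivl. h x = 0" and x: "x \<in> {0..1}"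
  shows "h x = (0 :: real)"
proof -
  have "(LINT x|unit_ivl. (h x)\<^sup>2) = 0"
    by (rule integral_eq_zero_AE) (use ae in \<open>auto elim!: eventually_mono\<close>)
  then have "integral {0..1} (\<lambda>x. (h x)\<^sup>2) = 0"
    using continuous_on_unit_ivl(2)[of "\<lambda>x. (h x)\<^sup>2"] h by (simp add: continuous_on_power)
  then have "\<forall>x\<in>{0..1}. (h x)\<^sup>2 = 0"
    by (subst (asm) integral_eq_0_iff) (use h in \<open>auto intro: continuous_on_power\<close>)
  then show ?thesis using x by simp
qed

lemma clamped_eq_deflection:
  assumes v: "integrable unit_ivl v"
    and u: "locally_integrable u" "u \<in> borel_measurable unit_ivl"
    and weak: "\<And>\<phi>. test_fun \<phi> \<Longrightarrow>
      (LINT x|unit_ivl. u x * (deriv ^^ 4) \<phi> x) = (LINT x|unit_ivl. v x * \<phi> x)"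
    and w: "AE x in unit_ivl. u x = w x"
      "\<And>x. x \<in> {0..1} \<Longrightarrow> (w has_real_derivative w' x) (at x within {0..1})"
      "w 0 = 0" "w 1 = 0" "w' 0 = 0" "w' 1 = 0"
  shows "AE x in unit_ivl. u x = deflection v x"
proof -
  have int_d: "integrable unit_ivl (deflection v)"
    by (intro continuous_on_unit_ivl continuous_deflection v)
  note li_d = locally_integrable_of_integrable[OF int_d]
  define z where "z x = u x - deflection v x" for x
  have "\<exists>c. AE x in unit_ivl. z x = (\<Sum>i<4. c i * x ^ i)"
  proof (rule polynomial_of_vanishing_derivative)
    show "locally_integrable z" unfolding z_def by (intro locally_integrable_diff u li_d)
    fix \<phi> assume \<phi>: "test_fun \<phi>"
    have "(LINT x|unit_ivl. z x * (deriv ^^ 4) \<phi> x) =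
        (LINT x|unit_ivl. u x * (deriv ^^ 4) \<phi> x) - (LINT x|unit_ivl. deflection v x * (deriv ^^ 4) \<phi> x)"
      unfolding z_def left_diff_distrib
      by (intro Bochner_Integration.integral_diff integrable_mult_test_fun u li_d test_fun_funpow_deriv \<phi>)
    then show "(LINT x|unit_ivl. z x * (deriv ^^ 4) \<phi> x) = 0"
      by (simp add: weak[OF \<phi>] deflection_weak_derivatives(3)[OF v \<phi>])
  qed
  then obtain c where c: "AE x in unit_ivl. z x = (\<Sum>i<4. c i * x ^ i)" by blast
  define p where "p x = c 0 + c 1 * x + c 2 * x ^ 2 + c 3 * x ^ 3" for x
  define p' where "p' x = c 1 + 2 * c 2 * x + 3 * c 3 * x ^ 2" for x
  have sum_p: "(\<Sum>i<4. c i * x ^ i) = p x" for x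
    by (simp add: p_def eval_nat_numeral)
  have D_p: "(p has_real_derivative p' x) (at x within {0..1})" for x
    unfolding p_def[abs_def] p'_def by (auto intro!: derivative_eq_intros simp: power2_eq_square)
  have D_w: "((\<lambda>x. w x - deflection v x) has_real_derivative w' x - slope v x) (at x within {0..1})"
    if "x \<in> {0..1}" for x
    using w(2)[OF that] deflection_DERIV[OF v that] by (rule DERIV_diff)
  \<comment> \<open>Continuity upgrades the identity to all of the closed interval, so that the
    values at 0 and 1 can be inserted.\<close>
  have eq: "w x - deflection v x = p x" if x: "x \<in> {0..1}" for x
  proof -
    have "w x - deflection v x - p x = 0"
    proof (rule continuous_AE_eq_0[OF _ _ x])
      show "continuous_on {0..1} (\<lambda>x. w x - deflection v x - p x)"
        by (intro continuous_on_diff DERIV_continuous_on[OF w(2)] continuous_deflection v DERIV_continuous_on[OF D_p])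
      show "AE x in unit_ivl. w x - deflection v x - p x = 0"
        using c w(1) by eventually_elim (simp add: z_def sum_p)
    qed
    then show ?thesis by simp
  qed
  \<comment> \<open>One-sided derivatives at the end points are unique as well, which gives the two
    remaining conditions on the four coefficients.\<close>
  have eq': "w' x - slope v x = p' x" if x: "x \<in> {0..1}" for x
  proof (rule vector_derivative_unique_within_closed_interval[of 0 1 x])
    show "(p has_vector_derivative p' x) (at x within cbox 0 1)"
      using D_p[of x] by (simp add: has_real_derivative_iff_has_vector_derivative)
    have "(p has_real_derivative w' x - slope v x) (at x within {0..1})"
      by (rule has_field_derivative_transform_within[OF D_w[OF x] zero_less_one x]) (simp add: eq)
    then show "(p has_vector_derivative w' x - slope v x) (at x within cbox 0 1)"
      by (simp add: has_real_derivative_iff_has_vector_derivative)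
  qed (use x in auto)
  have "p 0 = 0" "p 1 = 0" "p' 0 = 0" "p' 1 = 0"
    using eq[of 0] eq[of 1] eq'[of 0] eq'[of 1] w(3-6) deflection_clamped[OF v] by simp_all
  then have "c 0 = 0" "c 1 = 0" "c 2 = 0" "c 3 = 0" by (simp_all add: p_def p'_def)
  then have "p x = 0" for x by (simp add: p_def)
  with c show ?thesis
    by (auto simp: sum_p z_def elim!: eventually_mono)
qed

section \<open>The weighted space\<close>

locale degenerate_weight =
  fixes a :: "real \<Rightarrow> real" and x0 :: real
  assumes a_continuous: "continuous_on {0..1} a"
    and a_nonneg: "\<forall>x\<in>{0..1}. a x \<ge> 0"
    and a_positive: "\<forall>x\<in>{0..1} - {x0}. a x > 0"
    and integrable_inverse_a: "integrable unit_ivl (\<lambda>x. 1 / a x)"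
begin

lemma a_measurable [measurable]: "a \<in> borel_measurable unit_ivl"
  using a_continuous by (rule measurable_unit_ivl_of_continuous)

lemma AE_a_positive: "AE x in unit_ivl. 0 < a x"
proof -
  have "AE x in lebesgue. x \<noteq> x0"
    by (rule AE_I'[of "{x0}"]) auto
  then have "AE x in unit_ivl. x \<noteq> x0"
    by (subst AE_restrict_space_iff) (auto elim!: eventually_mono)
  with AE_space show ?thesis
    by eventually_elim (use a_positive in auto)
qed

lemma square_div_nonneg: "x \<in> {0<..<1} \<Longrightarrow> 0 \<le> (f x)\<^sup>2 / a x"
  using a_nonneg by auto

text \<open>If \<open>M\<close> bounds \<open>a\<close> on the closed interval, then
  \<open>u^2 \<le> M * (u^2 / a)\<close> almost everywhere.\<close>

lemma L2w_iff: "u \<in> L2w a \<longleftrightarrow> integrable unit_ivl (\<lambda>x. (fn u x)\<^sup>2 / a x)"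
proof
  assume int: "integrable unit_ivl (\<lambda>x. (fn u x)\<^sup>2 / a x)"
  have "bounded (a ` {0..1})"
    using a_continuous by (intro compact_imp_bounded compact_continuous_image) auto
  then obtain M where M: "\<And>x. x \<in> {0..1} \<Longrightarrow> \<bar>a x\<bar> \<le> M"
    unfolding bounded_iff by fastforce
  have "integrable unit_ivl (\<lambda>x. (fn u x)\<^sup>2)"
  proof (rule Bochner_Integration.integrable_bound)
    show "integrable unit_ivl (\<lambda>x. M * ((fn u x)\<^sup>2 / a x))" using int by (rule integrable_mult_right)
    show "AE x in unit_ivl. norm ((fn u x)\<^sup>2) \<le> norm (M * ((fn u x)\<^sup>2 / a x))"
      using AE_a_positive AE_space
    proof eventually_elim
      case (elim x)
      then have "(fn u x)\<^sup>2 * a x \<le> (fn u x)\<^sup>2 * M" using M[of x] by (intro mult_left_mono) auto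
      then have "(fn u x)\<^sup>2 \<le> M * ((fn u x)\<^sup>2 / a x)" using elim by (simp add: field_simps)
      then show ?case using order_trans[OF _ abs_ge_self[of "M * ((fn u x)\<^sup>2 / a x)"]]
        by (simp del: abs_mult abs_divide)
    qed
  qed measurable
  then show "u \<in> L2w a" using int by (simp add: L2w_def L2_def)
qed (simp add: L2w_def)

lemma cls_mem_L2w:
  assumes "f \<in> borel_measurable unit_ivl" "integrable unit_ivl (\<lambda>x. (f x)\<^sup>2 / a x)"
  shows "cls f \<in> L2w a"
  unfolding L2w_iff
  by (rule integrable_cong_AE_imp[OF assms(2)]) (use fn_cls[OF assms(1)] in \<open>auto elim!: eventually_mono\<close>)

lemma ipw_cong:
  assumes "AE x in unit_ivl. fn u x = f x" "AE x in unit_ivl. fn v x = g x"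
    and [measurable]: "f \<in> borel_measurable unit_ivl" "g \<in> borel_measurable unit_ivl"
  shows "ipw a u v = (LINT x|unit_ivl. f x * g x / a x)"
  unfolding ipw_def by (rule integral_cong_AE) (use assms(1,2) in \<open>auto elim!: eventually_elim2\<close>)

lemma integrable_ipw:
  assumes "u \<in> L2w a" "v \<in> L2w a"
  shows "integrable unit_ivl (\<lambda>x. fn u x * fn v x / a x)"
proof (rule Bochner_Integration.integrable_bound)
  show "integrable unit_ivl (\<lambda>x. (fn u x)\<^sup>2 / a x + (fn v x)\<^sup>2 / a x)" using assms by (simp add: L2w_iff)
  show "AE x in unit_ivl. norm (fn u x * fn v x / a x) \<le> norm ((fn u x)\<^sup>2 / a x + (fn v x)\<^sup>2 / a x)"
    using AE_a_positive
  proof eventually_elim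
    case (elim x)
    have "2 * \<bar>fn u x * fn v x\<bar> \<le> (fn u x)\<^sup>2 + (fn v x)\<^sup>2"
      using sum_squares_bound[of "\<bar>fn u x\<bar>" "\<bar>fn v x\<bar>"] by (simp add: abs_mult)
    then have "\<bar>fn u x * fn v x\<bar> \<le> (fn u x)\<^sup>2 + (fn v x)\<^sup>2" by linarith
    then have "\<bar>fn u x * fn v x\<bar> / a x \<le> ((fn u x)\<^sup>2 + (fn v x)\<^sup>2) / a x"
      using elim by (intro divide_right_mono) auto
    then show ?case using elim by (simp add: abs_mult add_divide_distrib)
  qed
qed measurable

lemma subspace_L2w: "subspace (L2w a)"
proof (rule subspaceI)
  show "0 \<in> L2w a"
    using cls_mem_L2w[of "\<lambda>_. 0"] by (simp add: zero_ae_fun_def)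
  show "u + v \<in> L2w a" if "u \<in> L2w a" "v \<in> L2w a" for u v
    unfolding L2w_iff
  proof (rule integrable_cong_AE_imp)
    show "integrable unit_ivl (\<lambda>x. (fn u x)\<^sup>2 / a x + 2 * (fn u x * fn v x / a x) + (fn v x)\<^sup>2 / a x)"
      using that integrable_ipw[OF that]
      by (intro Bochner_Integration.integrable_add integrable_mult_right) (simp_all add: L2w_iff)
    show "AE x in unit_ivl. (fn u x)\<^sup>2 / a x + 2 * (fn u x * fn v x / a x) + (fn v x)\<^sup>2 / a x =
        (fn (u + v) x)\<^sup>2 / a x"
      using fn_add[of u v] by eventually_elim (simp add: power2_sum add_divide_distrib algebra_simps)
  qed measurable
  show "c *\<^sub>R u \<in> L2w a" if "u \<in> L2w a" for c u
    unfolding L2w_iff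
  proof (rule integrable_cong_AE_imp)
    show "integrable unit_ivl (\<lambda>x. c\<^sup>2 * ((fn u x)\<^sup>2 / a x))"
      using that unfolding L2w_iff by (rule integrable_mult_right)
    show "AE x in unit_ivl. c\<^sup>2 * ((fn u x)\<^sup>2 / a x) = (fn (c *\<^sub>R u) x)\<^sup>2 / a x"
      using fn_scaleR[of c u] by eventually_elim (simp add: power_mult_distrib)
  qed measurable
qed

lemma ipw_self: "ipw a u u = (LINT x|unit_ivl. (fn u x)\<^sup>2 / a x)"
  by (simp add: ipw_def power2_eq_square)

lemma ipw_self_nonneg: "0 \<le> ipw a u u"
  unfolding ipw_self by (rule integral_nonneg_AE) (auto intro!: AE_I2 square_div_nonneg)

text \<open>The arithmetic-geometric mean inequality with a free parameter replaces the Cauchy-Schwarz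
  inequality here.\<close>

lemma integral_abs_div_le:
  assumes u: "u \<in> L2w a" and d: "d > 0"
  shows "integrable unit_ivl (\<lambda>x. fn u x / a x)"
    and "(LINT x|unit_ivl. \<bar>fn u x / a x\<bar>) \<le> d * (LINT x|unit_ivl. 1 / a x) + ipw a u u / d"
proof -
  have int: "integrable unit_ivl (\<lambda>x. d * (1 / a x) + (1 / d) * ((fn u x)\<^sup>2 / a x))"
    using u integrable_inverse_a by (intro Bochner_Integration.integrable_add integrable_mult_right) (auto simp: L2w_iff)
  have le: "AE x in unit_ivl. \<bar>fn u x / a x\<bar> \<le> d * (1 / a x) + (1 / d) * ((fn u x)\<^sup>2 / a x)"
    using AE_a_positive
  proof eventually_elim
    case (elim x)
    have "2 * d * \<bar>fn u x\<bar> \<le> d\<^sup>2 + (fn u x)\<^sup>2" using sum_squares_bound[of d "\<bar>fn u x\<bar>"] by simp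
    moreover have "0 \<le> d * \<bar>fn u x\<bar>" using d by simp
    ultimately have "d * \<bar>fn u x\<bar> \<le> d\<^sup>2 + (fn u x)\<^sup>2" by linarith
    then have "\<bar>fn u x\<bar> \<le> d + (fn u x)\<^sup>2 / d" using d by (simp add: field_simps power2_eq_square)
    then have "\<bar>fn u x\<bar> / a x \<le> (d + (fn u x)\<^sup>2 / d) / a x" using elim by (intro divide_right_mono) auto
    then show ?case using elim by (simp add: add_divide_distrib)
  qed
  show int': "integrable unit_ivl (\<lambda>x. fn u x / a x)"
  proof (rule Bochner_Integration.integrable_bound[OF int])
    show "AE x in unit_ivl. norm (fn u x / a x) \<le> norm (d * (1 / a x) + (1 / d) * ((fn u x)\<^sup>2 / a x))"
      using le by eventually_elim (simp add: abs_of_nonneg order_trans[OF abs_ge_zero])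
  qed measurable
  have "(LINT x|unit_ivl. \<bar>fn u x / a x\<bar>) \<le> (LINT x|unit_ivl. d * (1 / a x) + (1 / d) * ((fn u x)\<^sup>2 / a x))"
    by (intro integral_mono_AE integrable_abs int int' le)
  also have "\<dots> = (LINT x|unit_ivl. d * (1 / a x)) + (LINT x|unit_ivl. (1 / d) * ((fn u x)\<^sup>2 / a x))"
    using u integrable_inverse_a
    by (intro Bochner_Integration.integral_add integrable_mult_right) (auto simp: L2w_iff)
  also have "\<dots> = d * (LINT x|unit_ivl. 1 / a x) + ipw a u u / d"
    unfolding ipw_self Bochner_Integration.integral_mult_right_zero by simp
  finally show "(LINT x|unit_ivl. \<bar>fn u x / a x\<bar>) \<le> d * (LINT x|unit_ivl. 1 / a x) + ipw a u u / d" .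
qed

lemma L2w_diff: "u \<in> L2w a \<Longrightarrow> v \<in> L2w a \<Longrightarrow> u - v \<in> L2w a"
  using subspace_L2w by (rule subspace_diff)

lemma nn_integral_square_div:
  assumes "u \<in> L2w a"
  shows "(\<integral>\<^sup>+x. ennreal ((fn u x)\<^sup>2 / a x) \<partial>unit_ivl) = ennreal (ipw a u u)"
  unfolding ipw_self
  by (rule nn_integral_eq_integral) (use assms in \<open>auto simp: L2w_iff intro!: AE_I2 square_div_nonneg\<close>)

text \<open>By \<open>integral_abs_div_le\<close> the functions \<open>X n / a\<close> are Cauchy in
  \<open>L^1\<close>, so a subsequence of \<open>X n\<close> converges almost everywhere. Fatou's
  lemma then bounds the weighted distance of \<open>X n\<close> from this limit by the Cauchy bound,
  and in particular puts the limit into the space.\<close>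

lemma complete_L2w:
  assumes X: "\<And>n::nat. X n \<in> L2w a"
    and Cauchy: "\<And>e. e > 0 \<Longrightarrow> \<exists>N. \<forall>m\<ge>N. \<forall>n\<ge>N. hnorm (ipw a) (X m - X n) < e"
  shows "\<exists>u\<in>L2w a. (\<lambda>n. hnorm (ipw a) (X n - u)) \<longlonglongrightarrow> 0"
proof -
  have Cauchy': "\<exists>N. \<forall>m\<ge>N. \<forall>n\<ge>N. ipw a (X m - X n) (X m - X n) < e" if e: "e > 0" for e
  proof -
    obtain N where "\<forall>m\<ge>N. \<forall>n\<ge>N. hnorm (ipw a) (X m - X n) < sqrt e"
      using Cauchy[of "sqrt e"] e by auto
    then show ?thesis by (auto simp: hnorm_def)
  qed
  define I where "I = (LINT x|unit_ivl. 1 / a x)"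
  have I: "0 \<le> I" unfolding I_def using a_nonneg by (intro integral_nonneg_AE AE_I2) auto
  define s where "s n x = fn (X n) x / a x" for n x
  have s: "integrable unit_ivl (s n)" for n
    unfolding s_def by (rule integral_abs_div_le[OF X zero_less_one])
  obtain r where r: "strict_mono r" "AE x in unit_ivl. Cauchy (\<lambda>i. s (r i) x)"
  proof (rule cauchy_L1_AE_cauchy_subseq[OF s])
    fix e :: real assume e: "e > 0"
    \<comment> \<open>Makes \<open>d * (I + 1)\<close> equal to \<open>e / 2\<close>. Only after
      \<open>d\<close> is fixed is \<open>N\<close> chosen so that the term divided by
      \<open>d\<close> is below \<open>e / 2\<close> too.\<close>
    define d where "d = e / (2 * (I + 1))"
    have d: "d > 0" using e I by (simp add: d_def)
    obtain N where N: "\<And>m n. N \<le> m \<Longrightarrow> N \<le> n \<Longrightarrow> ipw a (X m - X n) (X m - X n) < d * (e / 2)"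
      using Cauchy'[of "d * (e / 2)"] d e by auto
    show "\<exists>N. \<forall>i\<ge>N. \<forall>j\<ge>N. (LINT x|unit_ivl. norm (s i x - s j x)) < e"
    proof (intro exI[of _ N] allI impI)
      fix i j assume ij: "N \<le> i" "N \<le> j"
      have "(LINT x|unit_ivl. norm (s i x - s j x)) = (LINT x|unit_ivl. \<bar>fn (X i - X j) x / a x\<bar>)"
        by (rule integral_cong_AE)
          (use s fn_diff[of "X i" "X j"] in
            \<open>auto simp: s_def simp flip: abs_divide diff_divide_distrib elim!: eventually_mono\<close>)
      also have "\<dots> \<le> d * I + ipw a (X i - X j) (X i - X j) / d"
        unfolding I_def by (rule integral_abs_div_le) (use X L2w_diff d in auto)
      also have "\<dots> < d * (I + 1) + e / 2"
      proof -
        have "ipw a (X i - X j) (X i - X j) / d < e / 2" using N[OF ij] d by (simp add: field_simps)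
        then show ?thesis using d by (simp add: algebra_simps)
      qed
      also have "\<dots> = e" using I by (simp add: d_def field_simps)
      finally show "(LINT x|unit_ivl. norm (s i x - s j x)) < e" .
    qed
  qed
  define F where "F x = lim (\<lambda>i. fn (X (r i)) x)" for x
  have [measurable]: "F \<in> borel_measurable unit_ivl" unfolding F_def by measurable
  have lim: "AE x in unit_ivl. (\<lambda>i. fn (X (r i)) x) \<longlonglongrightarrow> F x"
    using r(2) AE_a_positive
  proof eventually_elim
    case (elim x)
    then have "convergent (\<lambda>i. s (r i) x)" by (simp add: Cauchy_convergent_iff)
    then have "convergent (\<lambda>i. a x * s (r i) x)" by (intro convergent_mult convergent_const)
    then have "convergent (\<lambda>i. fn (X (r i)) x)" using elim by (simp add: s_def)
    then show ?case unfolding F_def by (simp add: convergent_LIMSEQ_iff)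
  qed
  have Fatou: "(\<integral>\<^sup>+x. ennreal ((fn (X n) x - F x)\<^sup>2 / a x) \<partial>unit_ivl) \<le> ennreal e"
    if N: "\<And>m. N \<le> m \<Longrightarrow> ipw a (X n - X m) (X n - X m) \<le> e" for e n N
  proof -
    define h where "h i x = ennreal ((fn (X n) x - fn (X (r i)) x)\<^sup>2 / a x)" for i x
    have "(\<integral>\<^sup>+x. ennreal ((fn (X n) x - F x)\<^sup>2 / a x) \<partial>unit_ivl) = (\<integral>\<^sup>+x. liminf (\<lambda>i. h i x) \<partial>unit_ivl)"
    proof (rule nn_integral_cong_AE)
      show "AE x in unit_ivl. ennreal ((fn (X n) x - F x)\<^sup>2 / a x) = liminf (\<lambda>i. h i x)"
        using lim AE_a_positive
      proof eventually_elim
        case (elim x)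
        have "(\<lambda>i. h i x) \<longlonglongrightarrow> ennreal ((fn (X n) x - F x)\<^sup>2 / a x)"
          unfolding h_def using elim by (intro tendsto_intros) auto
        then show ?case by (intro lim_imp_Liminf[symmetric]) auto
      qed
    qed
    also have "\<dots> \<le> liminf (\<lambda>i. \<integral>\<^sup>+x. h i x \<partial>unit_ivl)"
      by (rule nn_integral_liminf) (simp add: h_def)
    also have "\<dots> \<le> liminf (\<lambda>i. ennreal e)"
    proof (rule Liminf_mono)
      show "\<forall>\<^sub>F i in sequentially. (\<integral>\<^sup>+x. h i x \<partial>unit_ivl) \<le> ennreal e"
        using eventually_ge_at_top[of N]
      proof eventually_elim
        case (elim i)
        have "(\<integral>\<^sup>+x. h i x \<partial>unit_ivl) = (\<integral>\<^sup>+x. ennreal ((fn (X n - X (r i)) x)\<^sup>2 / a x) \<partial>unit_ivl)"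
          unfolding h_def
          by (rule nn_integral_cong_AE) (use fn_diff[of "X n" "X (r i)"] in \<open>auto elim!: eventually_mono\<close>)
        also have "\<dots> = ennreal (ipw a (X n - X (r i)) (X n - X (r i)))"
          by (intro nn_integral_square_div L2w_diff X)
        also have "\<dots> \<le> ennreal e"
          using N[of "r i"] seq_suble[OF r(1), of i] elim by (intro ennreal_leI) auto
        finally show ?case .
      qed
    qed
    also have "\<dots> = ennreal e" by (rule Liminf_const) simp
    finally show ?thesis .
  qed
  define u where "u = cls F"
  have u_F: "AE x in unit_ivl. fn u x = F x" unfolding u_def by (rule fn_cls) measurable
  have close: "X n - u \<in> L2w a \<and> ipw a (X n - u) (X n - u) \<le> e"
    if N: "\<And>m. N \<le> m \<Longrightarrow> ipw a (X n - X m) (X n - X m) \<le> e" for e n N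
  proof -
    have e: "0 \<le> e" using N[of N] ipw_self_nonneg[of "X n - X N"] by simp
    have "(\<integral>\<^sup>+x. ennreal ((fn (X n - u) x)\<^sup>2 / a x) \<partial>unit_ivl) =
        (\<integral>\<^sup>+x. ennreal ((fn (X n) x - F x)\<^sup>2 / a x) \<partial>unit_ivl)"
      by (rule nn_integral_cong_AE) (use fn_diff[of "X n" u] u_F in \<open>auto elim!: eventually_elim2\<close>)
    also have "\<dots> \<le> ennreal e" using N by (rule Fatou)
    finally have le: "(\<integral>\<^sup>+x. ennreal ((fn (X n - u) x)\<^sup>2 / a x) \<partial>unit_ivl) \<le> ennreal e" .
    have "integrable unit_ivl (\<lambda>x. (fn (X n - u) x)\<^sup>2 / a x)"
    proof (rule integrableI_nonneg)
      show "(\<integral>\<^sup>+x. ennreal ((fn (X n - u) x)\<^sup>2 / a x) \<partial>unit_ivl) < \<infinity>"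
        using le by (rule le_less_trans) simp
    qed (auto intro!: AE_I2 square_div_nonneg)
    then have mem: "X n - u \<in> L2w a" by (simp add: L2w_iff)
    then show ?thesis using le nn_integral_square_div[OF mem] e by simp
  qed
  have "\<exists>N. \<forall>n\<ge>N. X n - u \<in> L2w a \<and> ipw a (X n - u) (X n - u) \<le> e" if "e > 0" for e
    using Cauchy'[OF that] close less_imp_le by metis
  note close' = this
  obtain N where "X N - u \<in> L2w a" using close'[of 1] by auto
  from L2w_diff[OF X[of N] this] have "u \<in> L2w a" by simp
  moreover have "(\<lambda>n. ipw a (X n - u) (X n - u)) \<longlonglongrightarrow> 0"
  proof (rule tendstoI)
    fix e :: real assume "e > 0"
    then obtain N where N: "\<forall>n\<ge>N. ipw a (X n - u) (X n - u) \<le> e / 2" using close'[of "e / 2"] by auto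
    show "\<forall>\<^sub>F n in sequentially. dist (ipw a (X n - u) (X n - u)) 0 < e"
      using eventually_ge_at_top[of N]
    proof eventually_elim
      case (elim n)
      then show ?case using N \<open>e > 0\<close> ipw_self_nonneg[of "X n - u"] by fastforce
    qed
  qed
  then have "(\<lambda>n. hnorm (ipw a) (X n - u)) \<longlonglongrightarrow> 0"
    unfolding hnorm_def using tendsto_real_sqrt by fastforce
  ultimately show ?thesis by blast
qed

sublocale hilbert_space "L2w a" "ipw a"
proof
  show "subspace (L2w a)" by (rule subspace_L2w)
  show "ipw a (u + v) w = ipw a u w + ipw a v w" if "u \<in> L2w a" "v \<in> L2w a" "w \<in> L2w a" for u v w
  proof -
    have "ipw a (u + v) w = (LINT x|unit_ivl. fn u x * fn w x / a x + fn v x * fn w x / a x)"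
      unfolding ipw_def
      by (rule integral_cong_AE) (use fn_add[of u v] in \<open>auto simp: algebra_simps add_divide_distrib elim!: eventually_mono\<close>)
    then show ?thesis using that by (simp add: integrable_ipw ipw_def)
  qed
  show "ipw a (c *\<^sub>R u) v = c * ipw a u v" if "u \<in> L2w a" "v \<in> L2w a" for c u v
  proof -
    have "ipw a (c *\<^sub>R u) v = (LINT x|unit_ivl. c * (fn u x * fn v x / a x))"
      unfolding ipw_def
      by (rule integral_cong_AE) (use fn_scaleR[of c u] in \<open>auto elim!: eventually_mono\<close>)
    then show ?thesis by (simp only: ipw_def Bochner_Integration.integral_mult_right_zero)
  qed
  show "ipw a u v = ipw a v u" for u v by (simp add: ipw_def mult.commute)
  show "0 \<le> ipw a u u" for u by (rule ipw_self_nonneg)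
  show "u = 0" if "u \<in> L2w a" "ipw a u u = 0" for u
  proof -
    have "AE x in unit_ivl. 0 \<le> (fn u x)\<^sup>2 / a x" by (intro AE_I2 square_div_nonneg) simp
    from integral_nonneg_eq_0_iff_AE[OF _ this] have "AE x in unit_ivl. (fn u x)\<^sup>2 / a x = 0"
      using that unfolding L2w_iff ipw_self by blast
    with AE_a_positive fn_zero have "AE x in unit_ivl. fn u x = fn 0 x"
      by eventually_elim auto
    then show ?thesis by (simp add: ae_fun_eq_iff)
  qed
qed (rule complete_L2w)

end

section \<open>The operator and its inverse\<close>

context degenerate_weight
begin

abbreviation load :: "ae_fun \<Rightarrow> real \<Rightarrow> real" where
  "load f x \<equiv> fn f x / a x"

definition inverse_A :: "ae_fun \<Rightarrow> ae_fun" where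
  "inverse_A f = cls (deflection (load f))"

lemma integrable_load: "f \<in> L2w a \<Longrightarrow> integrable unit_ivl (load f)"
  by (rule integral_abs_div_le[OF _ zero_less_one])

lemma deflection_measurable: "integrable unit_ivl v \<Longrightarrow> deflection v \<in> borel_measurable unit_ivl"
  by (intro measurable_unit_ivl_of_continuous continuous_deflection)

lemma fn_inverse_A: "f \<in> L2w a \<Longrightarrow> AE x in unit_ivl. fn (inverse_A f) x = deflection (load f) x"
  unfolding inverse_A_def by (intro fn_cls deflection_measurable integrable_load)

text \<open>A bounded square is integrable against \<open>1 / a\<close>. This covers the deflections
  and also their uniform limits in the compactness argument.\<close>

lemma continuous_cls_mem_L2w:
  assumes f: "continuous_on {0..1} f"
  shows "cls f \<in> L2w a"
proof (rule cls_mem_L2w)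
  show f_meas: "f \<in> borel_measurable unit_ivl" by (rule measurable_unit_ivl_of_continuous[OF f])
  have "bounded (f ` {0..1})"
    using f by (intro compact_imp_bounded compact_continuous_image) auto
  then obtain M where M: "\<And>x. x \<in> {0..1} \<Longrightarrow> \<bar>f x\<bar> \<le> M"
    unfolding bounded_iff by fastforce
  have "integrable unit_ivl (\<lambda>x. 1 / a x * (f x)\<^sup>2)"
  proof (rule integrable_mult_bounded[OF integrable_inverse_a])
    show "\<bar>(f x)\<^sup>2\<bar> \<le> M\<^sup>2" if "x \<in> {0<..<1}" for x
      using power_mono[OF M[of x], of 2] that by simp
  qed (use f_meas in measurable)
  then show "integrable unit_ivl (\<lambda>x. (f x)\<^sup>2 / a x)" by simp
qed

lemma inverse_A_mem: "f \<in> L2w a \<Longrightarrow> inverse_A f \<in> L2w a"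
  unfolding inverse_A_def by (intro continuous_cls_mem_L2w continuous_deflection integrable_load)

lemma ipw_inverse_A:
  assumes "f \<in> L2w a" "g \<in> L2w a"
  shows "ipw a (inverse_A f) g = integral {0..1} (\<lambda>s. bending (load f) s * bending (load g) s)"
proof -
  have "ipw a (inverse_A f) g = (LINT x|unit_ivl. deflection (load f) x * fn g x / a x)"
    using assms by (intro ipw_cong fn_inverse_A deflection_measurable integrable_load) auto
  also have "\<dots> = (LINT x|unit_ivl. load g x * deflection (load f) x)"
    by (simp add: mult.commute)
  also have "\<dots> = integral {0..1} (\<lambda>s. bending (load f) s * bending (load g) s)"
    using assms by (intro integral_mult_deflection integrable_load)
  finally show ?thesis .
qed

text \<open>Because \<open>h\<close> is described through its representative only, additivity and
  homogeneity are both instances.\<close>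

lemma inverse_A_lincomb:
  assumes "f \<in> L2w a" "g \<in> L2w a" "h \<in> L2w a"
    and "AE x in unit_ivl. fn h x = c * fn f x + d * fn g x"
  shows "AE x in unit_ivl. fn (inverse_A h) x = c * fn (inverse_A f) x + d * fn (inverse_A g) x"
proof -
  have int: "integrable unit_ivl (\<lambda>x. c * load f x + d * load g x)"
    using assms by (intro Bochner_Integration.integrable_add integrable_mult_right integrable_load)
  have "deflection (load h) = deflection (\<lambda>x. c * load f x + d * load g x)"
    by (rule deflection_cong_AE[OF integrable_load int])
      (use assms in \<open>auto simp: add_divide_distrib elim!: eventually_mono\<close>)
  then have eq: "deflection (load h) x = c * deflection (load f) x + d * deflection (load g) x"
    if "x \<in> {0..1}" for x
    using deflection_lincomb[OF integrable_load integrable_load that] assms by simp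
  show ?thesis
    using fn_inverse_A[OF assms(1)] fn_inverse_A[OF assms(2)] fn_inverse_A[OF assms(3)] AE_space
    by eventually_elim (simp add: eq)
qed

text \<open>If the deflection vanishes, its fourth weak derivative does too, and this is the load;
  the fundamental lemma concludes.\<close>

lemma inverse_A_injective:
  assumes f: "f \<in> L2w a" and zero: "inverse_A f = 0"
  shows "f = 0"
proof -
  have "AE x in unit_ivl. deflection (load f) x = 0"
    using fn_inverse_A[OF f] fn_zero unfolding zero by eventually_elim simp
  then have "deflection (load f) x = 0" if "x \<in> {0..1}" for x
    using continuous_AE_eq_0[OF continuous_deflection[OF integrable_load[OF f]]] that by blast
  then have "(LINT x|unit_ivl. deflection (load f) x * (deriv ^^ 4) \<phi> x) = 0" for \<phi>
    by (intro integral_eq_zero_AE AE_I2) auto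
  then have "AE x in unit_ivl. load f x = 0"
    using deflection_weak_derivatives(3)[OF integrable_load[OF f]]
    by (intro fundamental_lemma locally_integrable_of_integrable integrable_load f) simp
  with AE_a_positive fn_zero have "AE x in unit_ivl. fn f x = fn 0 x" by eventually_elim auto
  then show ?thesis by (simp add: ae_fun_eq_iff)
qed

text \<open>Weighted norm at most 1 bounds the load in \<open>L^1\<close>, and hence the deflections
  uniformly in size and Lipschitz constant. A uniform limit is also a limit in the weighted space,
  since a uniform error \<open>e\<close> has squared norm at most \<open>e^2 * I\<close>.\<close>

lemma inverse_A_compact:
  assumes X: "\<And>n. X n \<in> L2w a" and bound: "\<And>n. hnorm (ipw a) (X n) \<le> 1"
  shows "\<exists>r y. strict_mono (r :: nat \<Rightarrow> nat) \<and> y \<in> L2w a \<and>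
    (\<lambda>n. hnorm (ipw a) (inverse_A (X (r n)) - y)) \<longlonglongrightarrow> 0"
proof -
  define I where "I = (LINT x|unit_ivl. 1 / a x)"
  have I: "0 \<le> I" unfolding I_def using a_nonneg by (intro integral_nonneg_AE AE_I2) auto
  \<comment> \<open>\<open>integral_abs_div_le\<close> with parameter 1 bounds the
    \<open>L^1\<close> norm of a load by \<open>I + 1\<close>; the factor 5 is the one of
    \<open>deflection_bound\<close> and \<open>deflection_Lipschitz\<close>.\<close>
  define L where "L = 5 * (I + 1)"
  have L: "L > 0" using I by (simp add: L_def)
  define w where "w n = deflection (load (X n))" for n
  have load_bound: "5 * (LINT x|unit_ivl. \<bar>load (X n) x\<bar>) \<le> L" for n
  proof -
    have "ipw a (X n) (X n) \<le> 1"
      using power_mono[OF bound hnorm_nonneg, of n 2] X hnorm_square[of "X n"] by simp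
    then show ?thesis
      using integral_abs_div_le(2)[OF X[of n] zero_less_one] by (simp add: L_def I_def)
  qed
  have w_bound: "\<bar>w n x\<bar> \<le> L" if "x \<in> {0..1}" for n x
    using deflection_bound[OF integrable_load[OF X[of n]] that] load_bound[of n] by (simp add: w_def)
  have w_Lipschitz: "\<bar>w n x - w n y\<bar> \<le> L * \<bar>x - y\<bar>" if "x \<in> {0..1}" "y \<in> {0..1}" for n x y
    using deflection_Lipschitz[OF integrable_load[OF X[of n]] that]
      mult_right_mono[OF load_bound[of n], of "\<bar>x - y\<bar>"] by (simp add: w_def)
  obtain g r where g: "continuous_on {0..1} g" and r: "strict_mono (r :: nat \<Rightarrow> nat)"
    and lim: "\<And>e. 0 < e \<Longrightarrow> \<exists>N. \<forall>n x. n \<ge> N \<and> x \<in> {0..1} \<longrightarrow> norm (w (r n) x - g x) < e"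
  proof (rule Arzela_Ascoli[of "{0..1}" w L])
    fix x e :: real assume x: "x \<in> {0..1}" and e: "0 < e"
    show "\<exists>d>0. \<forall>n y. y \<in> {0..1} \<and> norm (x - y) < d \<longrightarrow> norm (w n x - w n y) < e"
    proof (intro exI[of _ "e / L"] conjI allI impI)
      fix n y assume y: "y \<in> {0..1} \<and> norm (x - y) < e / L"
      then have "L * \<bar>x - y\<bar> < e" using L by (simp add: field_simps)
      then show "norm (w n x - w n y) < e" using w_Lipschitz[OF x, of y n] y by simp
    qed (use e L in simp)
  qed (use w_bound in auto)
  have g_meas [measurable]: "g \<in> borel_measurable unit_ivl" by (rule measurable_unit_ivl_of_continuous[OF g])
  have y: "cls g \<in> L2w a" by (rule continuous_cls_mem_L2w[OF g])
  have le: "ipw a (inverse_A (X (r n)) - cls g) (inverse_A (X (r n)) - cls g) \<le> e\<^sup>2 * I"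
    if e: "\<And>x. x \<in> {0..1} \<Longrightarrow> \<bar>w (r n) x - g x\<bar> \<le> e" for n e
  proof -
    have mem: "inverse_A (X (r n)) - cls g \<in> L2w a" by (intro L2w_diff inverse_A_mem X y)
    have "ipw a (inverse_A (X (r n)) - cls g) (inverse_A (X (r n)) - cls g) \<le> (LINT x|unit_ivl. e\<^sup>2 * (1 / a x))"
      unfolding ipw_self
    proof (rule integral_mono_AE)
      show "integrable unit_ivl (\<lambda>x. (fn (inverse_A (X (r n)) - cls g) x)\<^sup>2 / a x)" using mem by (simp add: L2w_iff)
      show "integrable unit_ivl (\<lambda>x. e\<^sup>2 * (1 / a x))" by (intro integrable_mult_right integrable_inverse_a)
      show "AE x in unit_ivl. (fn (inverse_A (X (r n)) - cls g) x)\<^sup>2 / a x \<le> e\<^sup>2 * (1 / a x)"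
        using fn_diff[of "inverse_A (X (r n))" "cls g"] fn_inverse_A[OF X[of "r n"]] fn_cls[OF g_meas] AE_space AE_a_positive
      proof eventually_elim
        case (elim x)
        then have "(w (r n) x - g x)\<^sup>2 \<le> e\<^sup>2"
          using power_mono[OF e[of x], of 2] by simp
        then show ?case using elim by (simp add: w_def divide_right_mono)
      qed
    qed
    then show ?thesis by (simp only: Bochner_Integration.integral_mult_right_zero I_def)
  qed
  have "(\<lambda>n. ipw a (inverse_A (X (r n)) - cls g) (inverse_A (X (r n)) - cls g)) \<longlonglongrightarrow> 0"
  proof (rule tendstoI)
    fix e :: real assume e: "e > 0"
    \<comment> \<open>Then \<open>d^2 * I = e * I / (I + 1)\<close>, which is strictly below
      \<open>e\<close> even if \<open>I\<close> is large.\<close>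
    define d where "d = sqrt (e / (I + 1))"
    have d: "0 < d" "d\<^sup>2 * I < e" using e I by (simp_all add: d_def field_simps)
    obtain N where N: "\<And>n x. N \<le> n \<Longrightarrow> x \<in> {0..1} \<Longrightarrow> \<bar>w (r n) x - g x\<bar> < d"
      using lim[OF d(1)] by auto
    show "\<forall>\<^sub>F n in sequentially. dist (ipw a (inverse_A (X (r n)) - cls g) (inverse_A (X (r n)) - cls g)) 0 < e"
      using eventually_ge_at_top[of N]
    proof eventually_elim
      case (elim n)
      then have "ipw a (inverse_A (X (r n)) - cls g) (inverse_A (X (r n)) - cls g) \<le> d\<^sup>2 * I"
        using N by (intro le) (simp add: less_imp_le)
      then show ?case using d ipw_self_nonneg[of "inverse_A (X (r n)) - cls g"] by simp
    qed
  qed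
  then have "(\<lambda>n. hnorm (ipw a) (inverse_A (X (r n)) - cls g)) \<longlonglongrightarrow> 0"
    unfolding hnorm_def using tendsto_real_sqrt by fastforce
  then show ?thesis using r y by blast
qed

sublocale compact_positive_operator "L2w a" "ipw a" inverse_A
proof
  show "inverse_A (f + g) = inverse_A f + inverse_A g" if "f \<in> L2w a" "g \<in> L2w a" for f g
  proof -
    have "AE x in unit_ivl. fn (inverse_A (f + g)) x = 1 * fn (inverse_A f) x + 1 * fn (inverse_A g) x"
      using that fn_add[of f g] by (intro inverse_A_lincomb) auto
    with fn_add[of "inverse_A f" "inverse_A g"] show ?thesis
      unfolding ae_fun_eq_iff by eventually_elim simp
  qed
  show "inverse_A (c *\<^sub>R f) = c *\<^sub>R inverse_A f" if "f \<in> L2w a" for c f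
  proof -
    have "AE x in unit_ivl. fn (inverse_A (c *\<^sub>R f)) x = c * fn (inverse_A f) x + 0 * fn (inverse_A f) x"
      using that fn_scaleR[of c f] by (intro inverse_A_lincomb) auto
    with fn_scaleR[of c "inverse_A f"] show ?thesis
      unfolding ae_fun_eq_iff by eventually_elim simp
  qed
  show "ipw a (inverse_A f) g = ipw a f (inverse_A g)" if "f \<in> L2w a" "g \<in> L2w a" for f g
    using ipw_inverse_A[OF that] ipw_inverse_A[OF that(2,1)] ip_commute[OF that(1) inverse_A_mem[OF that(2)]]
    by (simp add: mult.commute)
  show "0 \<le> ipw a (inverse_A f) f" if "f \<in> L2w a" for f
    unfolding ipw_inverse_A[OF that that]
    by (rule Henstock_Kurzweil_Integration.integral_nonneg)
      (auto intro!: integrable_continuous_real continuous_intros continuous_bending integrable_load that)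
qed (fact inverse_A_mem inverse_A_injective inverse_A_compact)+

lemma inverse_A_weak_deriv:
  assumes f: "f \<in> L2w a"
  shows "weak_deriv 4 (inverse_A f) (cls (load f))"
    and "mult_fun a (cls (load f)) = f"
proof -
  note v = integrable_load[OF f]
  have u: "integrable unit_ivl (deflection (load f))" by (intro continuous_on_unit_ivl continuous_deflection v)
  show "weak_deriv 4 (inverse_A f) (cls (load f))"
    unfolding weak_deriv_def
  proof (intro conjI allI impI)
    show "inverse_A f \<in> L1_loc" "cls (load f) \<in> L1_loc"
      unfolding inverse_A_def by (intro integrable_imp_L1_loc integrable_cls u v)+
    fix \<phi> assume \<phi>: "test_fun \<phi>"
    have "(LINT x|unit_ivl. fn (inverse_A f) x * (deriv ^^ 4) \<phi> x) = (LINT x|unit_ivl. deflection (load f) x * (deriv ^^ 4) \<phi> x)"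
      unfolding inverse_A_def
      by (intro integral_fn_cls_mult borel_measurable_integrable u test_fun_measurable test_fun_funpow_deriv \<phi>)
    also have "\<dots> = (LINT x|unit_ivl. load f x * \<phi> x)"
      by (rule deflection_weak_derivatives(3)[OF v \<phi>])
    also have "\<dots> = (LINT x|unit_ivl. fn (cls (load f)) x * \<phi> x)"
      by (intro integral_fn_cls_mult[symmetric] borel_measurable_integrable v test_fun_measurable \<phi>)
    finally show "(LINT x|unit_ivl. fn (inverse_A f) x * (deriv ^^ 4) \<phi> x) =
        (-1) ^ 4 * (LINT x|unit_ivl. fn (cls (load f)) x * \<phi> x)" by simp
  qed
  have "AE x in unit_ivl. fn (mult_fun a (cls (load f))) x = a x * fn (cls (load f)) x"
    unfolding mult_fun_def by (rule fn_cls) measurable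
  with fn_cls[OF borel_measurable_integrable[OF v]] AE_a_positive
  have "AE x in unit_ivl. fn (mult_fun a (cls (load f))) x = fn f x"
    by eventually_elim simp
  then show "mult_fun a (cls (load f)) = f" by (simp add: ae_fun_eq_iff)
qed

lemma continuous_cls_L2: "continuous_on {0..1} f \<Longrightarrow> cls f \<in> L2"
  using continuous_cls_mem_L2w by (simp add: L2w_def)

lemma inverse_A_mem_dom:
  assumes f: "f \<in> L2w a"
  shows "inverse_A f \<in> dom_A a"
proof -
  note v = integrable_load[OF f]
  note cont = continuous_deflection[OF v] continuous_slope[OF v] continuous_bending[OF v]
  have weak: "weak_deriv k (inverse_A f) (cls g)"
    if g: "continuous_on {0..1} g" and
      eq: "\<And>\<phi>. test_fun \<phi> \<Longrightarrow> (LINT x|unit_ivl. deflection (load f) x * (deriv ^^ k) \<phi> x) =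
        (-1) ^ k * (LINT x|unit_ivl. g x * \<phi> x)" for k g
    unfolding weak_deriv_def
  proof (intro conjI allI impI)
    show "inverse_A f \<in> L1_loc" "cls g \<in> L1_loc"
      unfolding inverse_A_def by (intro integrable_imp_L1_loc integrable_cls continuous_on_unit_ivl cont g)+
    fix \<phi> assume \<phi>: "test_fun \<phi>"
    show "(LINT x|unit_ivl. fn (inverse_A f) x * (deriv ^^ k) \<phi> x) =
        (-1) ^ k * (LINT x|unit_ivl. fn (cls g) x * \<phi> x)"
      using eq[OF \<phi>] cont(1) g \<phi> unfolding inverse_A_def
      by (simp add: integral_fn_cls_mult measurable_unit_ivl_of_continuous test_fun_measurable test_fun_funpow_deriv)
  qed
  have "weak_deriv 1 (inverse_A f) (cls (slope (load f)))"
    using deflection_weak_derivatives(1)[OF v] by (intro weak cont) auto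
  moreover have "weak_deriv 2 (inverse_A f) (cls (bending (load f)))"
    using deflection_weak_derivatives(2)[OF v] by (intro weak cont) auto
  moreover have "inverse_A f \<in> L2" unfolding inverse_A_def by (intro continuous_cls_L2 cont)
  ultimately have "inverse_A f \<in> H2"
    unfolding H2_def using continuous_cls_L2[OF cont(2)] continuous_cls_L2[OF cont(3)] by auto
  moreover have "\<exists>w w'. (AE x in unit_ivl. fn (inverse_A f) x = w x) \<and>
     (\<forall>x\<in>{0..1}. (w has_real_derivative w' x) (at x within {0..1})) \<and>
     continuous_on {0..1} w' \<and> w 0 = 0 \<and> w 1 = 0 \<and> w' 0 = 0 \<and> w' 1 = 0"
    using fn_inverse_A[OF f] deflection_DERIV[OF v] cont(2) deflection_clamped[OF v] by blast
  ultimately have "inverse_A f \<in> H2w a"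
    using inverse_A_mem[OF f] by (simp add: H2w_def H2_0_def)
  then show ?thesis
    unfolding dom_A_def using inverse_A_weak_deriv[OF f] f by auto
qed

lemma op_A_inverse_A:
  assumes "f \<in> L2w a"
  shows "op_A a (inverse_A f) = f"
proof -
  have "(THE v. weak_deriv 4 (inverse_A f) v) = cls (load f)"
    using inverse_A_weak_deriv(1)[OF assms] weak_deriv_unique by (intro the_equality)
  then show ?thesis by (simp add: op_A_def inverse_A_weak_deriv(2)[OF assms])
qed

text \<open>For \<open>u\<close> in the domain, put \<open>f = a * u''''\<close>. Then
  \<open>u\<close> and the deflection under the load \<open>f / a\<close> satisfy the same weak
  equation and the same boundary conditions, so \<open>clamped_eq_deflection\<close> identifies
  them.\<close>

lemma dom_A_eq: "dom_A a = inverse_A ` L2w a"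
proof
  show "inverse_A ` L2w a \<subseteq> dom_A a" using inverse_A_mem_dom by blast
  show "dom_A a \<subseteq> inverse_A ` L2w a"
  proof
    fix u assume "u \<in> dom_A a"
    then obtain v w w' where v: "weak_deriv 4 u v" and f: "mult_fun a v \<in> L2w a"
      and w: "AE x in unit_ivl. fn u x = w x"
        "\<And>x. x \<in> {0..1} \<Longrightarrow> (w has_real_derivative w' x) (at x within {0..1})"
        "w 0 = 0" "w 1 = 0" "w' 0 = 0" "w' 1 = 0"
      unfolding dom_A_def H2w_def H2_0_def by blast
    define f where "f = mult_fun a v"
    have f: "f \<in> L2w a" using f by (simp add: f_def)
    have "AE x in unit_ivl. fn f x = a x * fn v x"
      unfolding f_def mult_fun_def by (rule fn_cls) measurable
    \<comment> \<open>The fourth derivative \<open>v\<close> is a priori only locally integrable.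
      Its equality with \<open>load f\<close> shows that it is integrable up to the end points, as
      the Green function representation requires.\<close>
    with AE_a_positive have load_eq: "AE x in unit_ivl. load f x = fn v x"
      by eventually_elim simp
    have "AE x in unit_ivl. fn u x = deflection (load f) x"
    proof (rule clamped_eq_deflection[OF integrable_load[OF f] _ fn_measurable _ w])
      show "locally_integrable (fn u)" using v by (simp add: weak_deriv_def L1_loc_iff)
      fix \<phi> assume \<phi>: "test_fun \<phi>"
      have "(LINT x|unit_ivl. fn u x * (deriv ^^ 4) \<phi> x) = (LINT x|unit_ivl. fn v x * \<phi> x)"
        using v \<phi> by (simp add: weak_deriv_def)
      also have "\<dots> = (LINT x|unit_ivl. load f x * \<phi> x)"
      proof (rule integral_cong_AE)
        show "AE x in unit_ivl. fn v x * \<phi> x = load f x * \<phi> x"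
          using load_eq by eventually_elim (simp only:)
      qed (use test_fun_measurable[OF \<phi>] in measurable)
      finally show "(LINT x|unit_ivl. fn u x * (deriv ^^ 4) \<phi> x) = (LINT x|unit_ivl. load f x * \<phi> x)" .
    qed
    with fn_inverse_A[OF f] have "AE x in unit_ivl. fn u x = fn (inverse_A f) x"
      by eventually_elim simp
    then show "u \<in> inverse_A ` L2w a" using f by (auto simp: ae_fun_eq_iff)
  qed
qed

end

theorem mainTheorem3:
  fixes a :: "real \<Rightarrow> real" and x0 :: real
  assumes "continuous_on {0..1} a"
    and "\<forall>x\<in>{0..1}. a x \<ge> 0"
    and "x0 \<in> {0<..<1}"
    and "a x0 = 0"
    and "\<forall>x\<in>{0..1} - {x0}. a x > 0"
    and "integrable (lebesgue_on {0<..<1}) (\<lambda>x. 1 / a x)"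
  shows "self_adjoint (L2w a) (ipw a) (dom_A a) (op_A a) \<and>
    non_negative (ipw a) (dom_A a) (op_A a) \<and>
    generates_contractive_analytic_semigroup (L2w a) (ipw a) (pi / 2) (dom_A a) (\<lambda>u. - op_A a u)"
proof -
  interpret degenerate_weight a x0 using assms by unfold_locales auto
  show ?thesis
    unfolding dom_A_eq using inverse_self_adjoint_generates[OF op_A_inverse_A] by blast
qed

end
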